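(* Let $n\ge 1$, let $\mathbb{H}$ be the real quaternions, and let $R=\mathbb{H}[x_1,\dots,x_n]$ be the ring of quaternionic polynomial functions $\mathbb{H}^n\to\mathbb{H}$. For $f\in R$ let $\overline f\in R$ denote the function $\overline f(a)=\overline{f(a)}$. (1) For every (two-sided) ideal $I$ of $R$ one has $\mathcal{I}(\mathcal{Z}(I))=\sqrt[\mathbb{H}]{I}$, where $$\sqrt[\mathbb{H}]{I}=\Big\{ f\in R:\ \exists\, m\ge 0,\ l\ge 0,\ f_1,\dots,f_l\in R \text{ such that } (f\overline f)^m+\sum_{i=1}^l f_i\overline{f_i}\in I\Big\}.$$ (2) The ideals of $R$ of the form $\mathcal{I}(Z)$ for some $Z\subseteq\mathbb{H}^n$ are precisely the (two-sided) ideals $I$ of $R$ satisfying the following condition: for all $l\ge 1$ and all $f_1,\dots,f_l\in R$, if $\sum_{i=1}^l f_i\overline{f_i}\in I$ then $f_1,\dots,f_l\in I$.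
   Context: $\mathbb{H}$ is Hamilton's algebra of real quaternions, with conjugation $\overline{a+b\boldsymbol{i}+c\boldsymbol{j}+d\boldsymbol{k}}=a-b\boldsymbol{i}-c\boldsymbol{j}-d\boldsymbol{k}$ for $a,b,c,d\in\mathbb{R}$. The ring $R=\mathbb{H}[x_1,\dots,x_n]$ of quaternionic polynomial functions consists of all functions $f:\mathbb{H}^n\to\mathbb{H}$ expressible in the form $$f(x_1,\dots,x_n)=\sum_{l=1}^{r}a_{l,1}x_{\mu_{l,1}}a_{l,2}x_{\mu_{l,2}}\cdots a_{l,k_l}x_{\mu_{l,k_l}}a_{l,k_l+1}$$ with $r\ge 0$, $k_l\ge 0$, $\mu_{l,p}\in\{1,\dots,n\}$ and $a_{l,p}\in\mathbb{H}$; the ring operations are pointwise addition and multiplication of functions. (For $f\in R$ the function $\overline f$ again belongs to $R$.) All ideals are two-sided. For an ideal $I\subseteq R$, $\mathcal{Z}(I)=\{a\in\mathbb{H}^n: f(a)=0 \text{ for all } f\in I\}$. For $Z\subseteq\mathbb{H}^n$, $\mathcal{I}(Z)=\{f\in R: f(a)=0\text{ for all }a\in Z\}$, which is an ideal of $R$. The power $(f\overline f)^0$ is the constant function $1$. *)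

theory Defs
  imports "HOL-Algebra.Ideal" "HOL-Analysis.Finite_Cartesian_Product"
begin

section \<open>Hamilton's quaternions\<close>

text \<open>\<open>Quat a b c d\<close> is the quaternion \<open>a + b i + c j + d k\<close>.\<close>

datatype quat = Quat (qre: real) (qi: real) (qj: real) (qk: real)

lemma quat_eq_iff: "p = q \<longleftrightarrow> qre p = qre q \<and> qi p = qi q \<and> qj p = qj q \<and> qk p = qk q"
  by (cases p; cases q) simp

instantiation quat :: ring_1
begin

definition "0 = Quat 0 0 0 0"

definition "1 = Quat 1 0 0 0"

definition "- p = Quat (- qre p) (- qi p) (- qj p) (- qk p)"

definition "p + q = Quat (qre p + qre q) (qi p + qi q) (qj p + qj q) (qk p + qk q)"

definition "p - q = Quat (qre p - qre q) (qi p - qi q) (qj p - qj q) (qk p - qk q)"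

definition "p * q = Quat
  (qre p * qre q - qi p * qi q - qj p * qj q - qk p * qk q)
  (qre p * qi q + qi p * qre q + qj p * qk q - qk p * qj q)
  (qre p * qj q - qi p * qk q + qj p * qre q + qk p * qi q)
  (qre p * qk q + qi p * qj q - qj p * qi q + qk p * qre q)"

instance
  by standard
    (simp_all add: quat_eq_iff zero_quat_def one_quat_def uminus_quat_def plus_quat_def
      minus_quat_def times_quat_def algebra_simps)

end

lemma quat_sel [simp]:
  "qre 0 = 0" "qi 0 = 0" "qj 0 = 0" "qk 0 = 0"
  "qre 1 = 1" "qi 1 = 0" "qj 1 = 0" "qk 1 = 0"
  "qre (- p) = - qre p" "qi (- p) = - qi p" "qj (- p) = - qj p" "qk (- p) = - qk p"
  "qre (p + q) = qre p + qre q" "qi (p + q) = qi p + qi q"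
  "qj (p + q) = qj p + qj q" "qk (p + q) = qk p + qk q"
  "qre (p - q) = qre p - qre q" "qi (p - q) = qi p - qi q"
  "qj (p - q) = qj p - qj q" "qk (p - q) = qk p - qk q"
  "qre (p * q) = qre p * qre q - qi p * qi q - qj p * qj q - qk p * qk q"
  "qi (p * q) = qre p * qi q + qi p * qre q + qj p * qk q - qk p * qj q"
  "qj (p * q) = qre p * qj q - qi p * qk q + qj p * qre q + qk p * qi q"
  "qk (p * q) = qre p * qk q + qi p * qj q - qj p * qi q + qk p * qre q"
  by (simp_all add: zero_quat_def one_quat_def uminus_quat_def plus_quat_def
      minus_quat_def times_quat_def)

definition quat_i :: quat where "quat_i = Quat 0 1 0 0"
definition quat_j :: quat where "quat_j = Quat 0 0 1 0"
definition quat_k :: quat where "quat_k = Quat 0 0 0 1"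

lemma hamilton_relations:
  "quat_i * quat_i = - 1" "quat_j * quat_j = - 1" "quat_k * quat_k = - 1"
  "quat_i * quat_j * quat_k = - 1"
  by (simp_all add: quat_eq_iff quat_i_def quat_j_def quat_k_def)

definition qcnj :: "quat \<Rightarrow> quat" where
  "qcnj q = Quat (qre q) (- qi q) (- qj q) (- qk q)"


section \<open>Quaternionic polynomial functions\<close>

text \<open>
  A list \<open>[(a\<^sub>1, \<mu>\<^sub>1), \<dots>, (a\<^sub>k, \<mu>\<^sub>k)]\<close> together with a last coefficient \<open>c\<close> encodes
  the monomial \<open>a\<^sub>1 x\<^bsub>\<mu>\<^sub>1\<^esub> \<cdots> a\<^sub>k x\<^bsub>\<mu>\<^sub>k\<^esub> c\<close>; the factors are multiplied in this order.
  A quaternionic polynomial function is a function given by a finite list of such monomials.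
\<close>

definition qmonom :: "(quat \<times> 'n) list \<times> quat \<Rightarrow> quat ^ 'n \<Rightarrow> quat" where
  "qmonom t x = (case t of (w, c) \<Rightarrow> prod_list (map (\<lambda>(a, \<mu>). a * x $ \<mu>) w) * c)"

definition qpoly_funs :: "(quat ^ 'n \<Rightarrow> quat) set" where
  "qpoly_funs = {f. \<exists>ts. \<forall>x. f x = (\<Sum>t\<leftarrow>ts. qmonom t x)}"

definition qpoly_ring :: "(quat ^ 'n \<Rightarrow> quat) ring" where
  "qpoly_ring = \<lparr>carrier = qpoly_funs, mult = (\<lambda>f g x. f x * g x), one = (\<lambda>x. 1),
     zero = (\<lambda>x. 0), add = (\<lambda>f g x. f x + g x)\<rparr>"

lemma qpoly_const: "(\<lambda>x. c) \<in> qpoly_funs"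
proof -
  have "\<forall>x. c = (\<Sum>t\<leftarrow>[([], c)]. qmonom t x)"
    by (simp add: qmonom_def)
  then show ?thesis
    unfolding qpoly_funs_def by blast
qed

lemma qpoly_var: "(\<lambda>x. x $ \<mu>) \<in> qpoly_funs"
proof -
  have "\<forall>x. x $ \<mu> = (\<Sum>t\<leftarrow>[([(1, \<mu>)], 1)]. qmonom t x)"
    by (simp add: qmonom_def)
  then show ?thesis
    unfolding qpoly_funs_def by blast
qed

lemma qpoly_add:
  assumes "f \<in> qpoly_funs" "g \<in> qpoly_funs"
  shows "(\<lambda>x. f x + g x) \<in> qpoly_funs"
proof -
  from assms obtain ts us where "\<forall>x. f x = (\<Sum>t\<leftarrow>ts. qmonom t x)"
    "\<forall>x. g x = (\<Sum>t\<leftarrow>us. qmonom t x)"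
    unfolding qpoly_funs_def by blast
  then have "\<forall>x. f x + g x = (\<Sum>t\<leftarrow>ts @ us. qmonom t x)"
    by simp
  then show ?thesis
    unfolding qpoly_funs_def by blast
qed

lemma qmonom_mult: "(\<lambda>x. qmonom s x * qmonom t x) \<in> qpoly_funs"
proof -
  obtain v c w d where st: "s = (v, c)" "t = (w, d)"
    by (cases s, cases t)
  have "\<exists>u. \<forall>x. qmonom s x * qmonom t x = qmonom u x"
  proof (cases w)
    case Nil
    then have "\<forall>x. qmonom s x * qmonom t x = qmonom (v, c * d) x"
      by (simp add: qmonom_def st mult.assoc)
    then show ?thesis by blast
  next
    case (Cons p w')
    obtain a \<mu> where "p = (a, \<mu>)" by (cases p)
    with Cons have "\<forall>x. qmonom s x * qmonom t x = qmonom (v @ (c * a, \<mu>) # w', d) x"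
      by (simp add: qmonom_def st mult.assoc)
    then show ?thesis by blast
  qed
  then obtain u where "\<forall>x. qmonom s x * qmonom t x = (\<Sum>t\<leftarrow>[u]. qmonom t x)"
    by auto
  then show ?thesis
    unfolding qpoly_funs_def by blast
qed

lemma qpoly_sum_list:
  assumes "\<And>t. F t \<in> qpoly_funs"
  shows "(\<lambda>x. \<Sum>t\<leftarrow>ts. F t x) \<in> qpoly_funs"
  by (induction ts) (simp_all add: qpoly_const qpoly_add assms)

lemma qpoly_mult:
  assumes "f \<in> qpoly_funs" "g \<in> qpoly_funs"
  shows "(\<lambda>x. f x * g x) \<in> qpoly_funs"
proof -
  from assms obtain ts us where "\<And>x. f x = (\<Sum>t\<leftarrow>ts. qmonom t x)"
    "\<And>x. g x = (\<Sum>t\<leftarrow>us. qmonom t x)"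
    unfolding qpoly_funs_def by blast
  then have "(\<lambda>x. f x * g x) = (\<lambda>x. \<Sum>t\<leftarrow>ts. \<Sum>u\<leftarrow>us. qmonom t x * qmonom u x)"
    by (simp add: sum_list_mult_const sum_list_const_mult)
  moreover have "(\<lambda>x. \<Sum>t\<leftarrow>ts. \<Sum>u\<leftarrow>us. qmonom t x * qmonom u x) \<in> qpoly_funs"
    by (intro qpoly_sum_list qmonom_mult)
  ultimately show ?thesis
    by simp
qed

lemma qpoly_uminus: "f \<in> qpoly_funs \<Longrightarrow> (\<lambda>x. - f x) \<in> qpoly_funs"
  using qpoly_mult[OF qpoly_const[of "- 1"]] by simp

lemma qpoly_cnj:
  assumes "f \<in> qpoly_funs"
  shows "(\<lambda>x. qcnj (f x)) \<in> qpoly_funs"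
proof -
  have "qcnj q = Quat (- 1 / 2) 0 0 0 *
      (q + quat_i * q * quat_i + quat_j * q * quat_j + quat_k * q * quat_k)" for q
    by (simp add: quat_eq_iff qcnj_def quat_i_def quat_j_def quat_k_def)
  then show ?thesis
    by (simp add: qpoly_add qpoly_mult qpoly_const assms)
qed

lemma ring_qpoly_ring: "ring (qpoly_ring :: (quat ^ 'n \<Rightarrow> quat) ring)"
proof (rule ringI)
  show "abelian_group (qpoly_ring :: (quat ^ 'n \<Rightarrow> quat) ring)"
  proof (rule abelian_groupI)
    fix f :: "quat ^ 'n \<Rightarrow> quat"
    assume "f \<in> carrier qpoly_ring"
    then show "\<exists>g\<in>carrier qpoly_ring. g \<oplus>\<^bsub>qpoly_ring\<^esub> f = \<zero>\<^bsub>qpoly_ring\<^esub>"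
      by (intro bexI[of _ "\<lambda>x. - f x"]) (simp_all add: qpoly_ring_def qpoly_uminus)
  qed (simp_all add: qpoly_ring_def qpoly_add qpoly_const algebra_simps)
  show "monoid (qpoly_ring :: (quat ^ 'n \<Rightarrow> quat) ring)"
    by (rule monoidI) (simp_all add: qpoly_ring_def qpoly_mult qpoly_const mult.assoc)
qed (simp_all add: qpoly_ring_def algebra_simps)


section \<open>Zero sets, vanishing ideals and the quaternionic radical\<close>

definition zero_set :: "(quat ^ 'n \<Rightarrow> quat) set \<Rightarrow> (quat ^ 'n) set" where
  "zero_set I = {a. \<forall>f\<in>I. f a = 0}"

definition vanishing_ideal :: "(quat ^ 'n) set \<Rightarrow> (quat ^ 'n \<Rightarrow> quat) set" where
  "vanishing_ideal Z = {f \<in> carrier qpoly_ring. \<forall>a\<in>Z. f a = 0}"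

definition quat_radical :: "(quat ^ 'n \<Rightarrow> quat) set \<Rightarrow> (quat ^ 'n \<Rightarrow> quat) set" where
  "quat_radical I = {f \<in> carrier qpoly_ring.
     \<exists>(m::nat) (l::nat) g. (\<forall>i<l. g i \<in> carrier qpoly_ring) \<and>
       (\<lambda>a. (f a * qcnj (f a)) ^ m + (\<Sum>i<l. g i a * qcnj (g i a))) \<in> I}"

end

theory Submission
  imports Defs "HOL-Algebra.Algebraic_Closure_Type"
begin

text \<open>
  A two-sided ideal \<open>I\<close> is determined by the real polynomial functions in the \<open>4 n\<close> real coordinates
  that it contains, because \<open>4 Re q = q - i q i - j q j - k q k\<close>. Hence everything reduces to the
  real Nullstellensatz: if \<open>f\<close> vanishes on the real zeros of \<open>J\<close>, then \<open>f\<^bsup>2m\<^esup> + s \<in> J\<close> for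
  some \<open>m\<close> and some sum of squares \<open>s\<close>. Otherwise an ideal \<open>p \<supseteq> J\<close> that is maximal among those
  containing no such element is prime with formally real residue field \<open>K\<close>. In a maximal formally real
  subfield \<open>L \<supseteq> K\<close> of the algebraic closure of \<open>K\<close> polynomials have the intermediate value property
  (Artin--Schreier). Cohen--Hoermander quantifier elimination therefore transfers the point of \<open>L\<^bsup>4n\<^esup>\<close>
  given by the coordinate functions, which annihilates a finite set of generators of \<open>p\<close> but not \<open>f\<close>,
  to a real point with the same properties; this is a contradiction.
\<close>

section \<open>Polynomials over fields with the intermediate value property\<close>

text \<open>A point with coordinates in \<open>L\<close> cannot simply be mapped to a real point,
  because \<open>L\<close> need not embed into the reals. Only signs can be compared, and only those
  of finitely many polynomials at once; this is why finite generation of \<open>p\<close> matters.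
  Quantifier elimination is used without formulas: for a finite set \<open>F\<close> of one-variable
  polynomials, \<open>one_variable_transfer\<close> provides a finite set \<open>G\<close> of
  coefficients such that, whenever two homomorphisms into real closed fields give equal signs on
  \<open>G\<close>, every sign vector of \<open>F\<close> under the first also occurs under the
  second. Since \<open>G\<close> is fixed before the homomorphisms, it can itself be transferred,
  which removes one coordinate after the other.

  Part (1) applies the real Nullstellensatz to \<open>N = f * qcnj f\<close>, which is real-valued
  and vanishes exactly where \<open>f\<close> does; hence the even exponent \<open>2 * m\<close>.
  Part (2) follows from (1), because every power \<open>N ^ k\<close> has the form
  \<open>h * qcnj h\<close>, so that the condition on sums can be applied again and again until
  \<open>f\<close> itself is reached.\<close>

text \<open>The constant \<^const>\<open>poly\<close> is not available inside a class specification.\<close>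

class real_closed = linordered_field +
  assumes sum_neg_pos_root: "a < b \<Longrightarrow> (\<Sum>i\<le>n. c i * a ^ i) < 0 \<Longrightarrow> 0 < (\<Sum>i\<le>n. c i * b ^ i)
    \<Longrightarrow> \<exists>x. a < x \<and> x < b \<and> (\<Sum>i\<le>n. c i * x ^ i) = 0"

lemma poly_neg_pos_root:
  fixes p :: "'a::real_closed poly"
  assumes "a < b" "poly p a < 0" "0 < poly p b"
  shows "\<exists>c. a < c \<and> c < b \<and> poly p c = 0"
  using sum_neg_pos_root[of a b "coeff p" "degree p"] assms by (simp add: poly_altdef)

instance real :: real_closed
proof
  fix a b :: real and c :: "nat \<Rightarrow> real" and n
  assume "a < b" "(\<Sum>i\<le>n. c i * a ^ i) < 0" "0 < (\<Sum>i\<le>n. c i * b ^ i)"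
  then show "\<exists>x. a < x \<and> x < b \<and> (\<Sum>i\<le>n. c i * x ^ i) = 0"
    using poly_IVT_pos[of a b "\<Sum>i\<le>n. monom (c i) i"] by (auto simp: poly_sum poly_monom)
qed

text \<open>The signum with values in a fixed type, so that signs in different fields can be compared.\<close>

definition sg :: "'a::linordered_idom \<Rightarrow> int" where
  "sg x = (if 0 < x then 1 else if x < 0 then - 1 else 0)"

lemma sg_0 [simp]: "sg 0 = 0"
  by (simp add: sg_def)

lemma sg_eq_0_iff [simp]: "sg x = 0 \<longleftrightarrow> x = 0"
  by (auto simp: sg_def)

lemma sg_mult: "sg (x * y) = sg x * sg y"
  by (auto simp: sg_def zero_less_mult_iff mult_less_0_iff)

lemma sg_minus: "sg (- x) = - sg x"
  by (auto simp: sg_def)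

lemma sg_power: "sg (x ^ n) = sg x ^ n"
  by (induction n) (simp_all add: sg_mult, simp add: sg_def)

lemma sg_eq_1_iff: "sg x = 1 \<longleftrightarrow> 0 < x"
  by (auto simp: sg_def)

lemma sg_eq_m1_iff: "sg x = - 1 \<longleftrightarrow> x < 0"
  by (auto simp: sg_def)

lemma sg_diff_eq_iff:
  fixes x y :: "'a::linordered_idom" and u v :: "'b::linordered_idom"
  shows "sg (x - y) = sg (u - v) \<longleftrightarrow> (x < y \<longleftrightarrow> u < v) \<and> (x = y \<longleftrightarrow> u = v)"
  by (auto simp: sg_def)

lemma poly_sg_neq_root:
  fixes p :: "'a::real_closed poly"
  assumes "a < b" "poly p a \<noteq> 0" "poly p b \<noteq> 0" "sg (poly p a) \<noteq> sg (poly p b)"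
  shows "\<exists>c. a < c \<and> c < b \<and> poly p c = 0"
proof (cases "poly p a < 0")
  case True
  then have "0 < poly p b"
    using assms by (auto simp: sg_def split: if_splits)
  then show ?thesis
    using poly_neg_pos_root[of a b p] True assms(1) by blast
next
  case False
  then have "poly (- p) a < 0" "0 < poly (- p) b"
    using assms by (auto simp: sg_def split: if_splits)
  then show ?thesis
    using poly_neg_pos_root[of a b "- p"] assms(1) by auto
qed

text \<open>Roots are excluded only inside the interval, while \<open>s\<close> and \<open>t\<close>
  may be its endpoints. Later this compares the sign inside a cell with the sign at an end where
  \<open>p\<close> does not vanish.\<close>

lemma poly_sg_const:
  fixes p :: "'a::real_closed poly"
  assumes "\<And>c. a < c \<Longrightarrow> c < b \<Longrightarrow> poly p c \<noteq> 0" "a \<le> s" "s \<le> b" "a \<le> t" "t \<le> b"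
    "poly p s \<noteq> 0" "poly p t \<noteq> 0"
  shows "sg (poly p s) = sg (poly p t)"
proof (rule ccontr)
  assume ne: "sg (poly p s) \<noteq> sg (poly p t)"
  have "\<exists>c. min s t < c \<and> c < max s t \<and> poly p c = 0"
  proof (cases "s < t")
    case True
    then show ?thesis using poly_sg_neq_root[of s t p] ne assms by auto
  next
    case False
    then have "t < s" using ne by (metis not_less_iff_gr_or_eq)
    then show ?thesis using poly_sg_neq_root[of t s p] ne assms by auto
  qed
  then obtain c where "min s t < c" "c < max s t" "poly p c = 0" by blast
  then show False
    using assms(1)[of c] assms(2-5) by (auto simp: min_def max_def split: if_splits)
qed

section \<open>Rolle's theorem and the mean value theorem without completeness\<close>

text \<open>There is no extremum argument in a general real closed field. Instead all factors x - a
  and x - b are split off from \<open>p\<close>; the remaining factor \<open>r\<close> keeps its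
  sign between the two roots, and this forces a sign change of a cofactor of the derivative.\<close>

lemma poly_Rolle_consecutive:
  fixes p :: "'a::real_closed poly"
  assumes "a < b" "poly p a = 0" "poly p b = 0" "\<And>c. a < c \<Longrightarrow> c < b \<Longrightarrow> poly p c \<noteq> 0" "p \<noteq> 0"
  shows "\<exists>c. a < c \<and> c < b \<and> poly (pderiv p) c = 0"
proof -
  obtain q where q: "p = [:- a, 1:] ^ order a p * q" "\<not> [:- a, 1:] dvd q"
    using order_decomp[OF assms(5)] by blast
  have q0: "q \<noteq> 0" using q(2) by auto
  obtain r where r: "q = [:- b, 1:] ^ order b q * r" "\<not> [:- b, 1:] dvd r"
    using order_decomp[OF q0] by blast
  have ma: "order a p \<noteq> 0"
    using assms(2,5) by (simp add: order_root)
  have "poly q b = 0"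
    using assms(1,3) arg_cong[OF q(1), of "\<lambda>p. poly p b"] by simp
  then have nb: "order b q \<noteq> 0"
    using q0 by (simp add: order_root)
  obtain m n where m: "order a p = Suc m" and n: "order b q = Suc n"
    using ma nb by (meson not0_implies_Suc)
  have qa: "poly q a \<noteq> 0" using q(2) by (simp add: poly_eq_0_iff_dvd)
  have ra: "poly r a \<noteq> 0"
    using qa arg_cong[OF r(1), of "\<lambda>p. poly p a"] by auto
  have rb: "poly r b \<noteq> 0" using r(2) by (simp add: poly_eq_0_iff_dvd)
  have rc: "poly r c \<noteq> 0" if "a < c" "c < b" for c
  proof
    assume "poly r c = 0"
    then have "poly q c = 0" using arg_cong[OF r(1), of "\<lambda>p. poly p c"] by simp
    then have "poly p c = 0" using arg_cong[OF q(1), of "\<lambda>p. poly p c"] by simp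
    with assms(4) that show False by blast
  qed
  have sgr: "sg (poly r a) = sg (poly r b)"
    by (rule poly_sg_const[of a b r]) (use rc ra rb assms(1) in auto)
  \<comment> \<open>The cofactor of (x - a)^m (x - b)^n in \<open>pderiv p\<close>. At a and at b
    only one summand survives, with the factor a - b or b - a respectively, so the two values have
    opposite signs.\<close>
  define w where "w = smult (of_nat (Suc m)) ([:- b, 1:] * r) + smult (of_nat (Suc n)) ([:- a, 1:] * r)
     + [:- a, 1:] * [:- b, 1:] * pderiv r"
  have pw: "pderiv p = [:- a, 1:] ^ m * [:- b, 1:] ^ n * w"
  proof -
    have lin: "pderiv [:- a, 1:] = 1" "pderiv [:- b, 1:] = 1"
      by (simp_all add: pderiv_pCons one_pCons)
    have "p = [:- a, 1:] ^ Suc m * ([:- b, 1:] ^ Suc n * r)"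
      using q(1) r(1) m n by simp
    moreover have "pderiv (u ^ Suc m * (v ^ Suc n * r)) = u ^ m * v ^ n *
        (smult (of_nat (Suc m)) (v * r) + smult (of_nat (Suc n)) (u * r) + u * v * pderiv r)"
      if "pderiv u = 1" "pderiv v = 1" for u v :: "'a poly"
      by (simp only: pderiv_mult pderiv_power_Suc that) (simp add: algebra_simps del: of_nat_Suc)
    ultimately show ?thesis
      unfolding w_def using lin by presburger
  qed
  have wa: "poly w a = of_nat (Suc m) * (a - b) * poly r a"
    and wb: "poly w b = of_nat (Suc n) * (b - a) * poly r b"
    by (simp_all add: w_def algebra_simps)
  have sgs: "sg (a - b) = - 1" "sg (b - a) = 1" "sg (of_nat (Suc k) :: 'a) = 1" for k
    using assms(1) by (auto simp: sg_eq_1_iff sg_eq_m1_iff simp del: of_nat_Suc)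
  have "sg (poly w a) = - sg (poly r a)" "sg (poly w b) = sg (poly r b)"
    unfolding wa wb by (simp_all only: sg_mult sgs)
  then have "poly w a \<noteq> 0" "poly w b \<noteq> 0" "sg (poly w a) \<noteq> sg (poly w b)"
    using ra rb sgr by (metis sg_eq_0_iff add.inverse_neutral minus_equation_iff,
        metis sg_eq_0_iff, metis sg_eq_0_iff equal_neg_zero)
  from poly_sg_neq_root[OF assms(1) this] show ?thesis
    by (auto simp: pw)
qed

lemma poly_Rolle:
  fixes p :: "'a::real_closed poly"
  assumes "a < b" "poly p a = 0" "poly p b = 0"
  shows "\<exists>c. a < c \<and> c < b \<and> poly (pderiv p) c = 0"
proof (cases "p = 0")
  case True
  then show ?thesis using dense[OF assms(1)] by auto
next
  case False
  \<comment> \<open>The least root above \<open>a\<close> replaces \<open>b\<close>, which makes the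
    two roots consecutive.\<close>
  define S where "S = {r. poly p r = 0 \<and> a < r}"
  have fin: "finite S"
    unfolding S_def by (rule finite_subset[OF _ poly_roots_finite[OF False]]) auto
  have bS: "b \<in> S" using assms by (simp add: S_def)
  have mS: "Min S \<in> S" using fin bS by (intro Min_in) auto
  have "Min S \<le> b" using fin bS by simp
  have "\<exists>c. a < c \<and> c < Min S \<and> poly (pderiv p) c = 0"
  proof (rule poly_Rolle_consecutive[OF _ assms(2) _ _ False])
    fix c assume "a < c" "c < Min S"
    then have "c \<notin> S"
      using fin Min_le leD by blast
    then show "poly p c \<noteq> 0"
      using \<open>a < c\<close> by (simp add: S_def)
  qed (use mS in \<open>auto simp: S_def\<close>)
  then show ?thesis
    using \<open>Min S \<le> b\<close> by force
qed

lemma poly_mean_value: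
  fixes p :: "'a::real_closed poly"
  assumes "a < b"
  shows "\<exists>c. a < c \<and> c < b \<and> poly p b - poly p a = (b - a) * poly (pderiv p) c"
proof -
  \<comment> \<open>The usual difference of \<open>p\<close> and its chord, scaled by
    \<open>b - a\<close> to avoid division.\<close>
  define q where "q = smult (b - a) p - smult (poly p b - poly p a) [:- a, 1:] - [:(b - a) * poly p a:]"
  have "poly q a = 0" "poly q b = 0"
    by (simp_all add: q_def algebra_simps)
  from poly_Rolle[OF assms this] obtain c where c: "a < c" "c < b" "poly (pderiv q) c = 0"
    by blast
  have "pderiv q = smult (b - a) (pderiv p) - [:poly p b - poly p a:]"
    by (simp add: q_def pderiv_diff pderiv_smult pderiv_pCons)
  then show ?thesis
    using c by auto
qed

text \<open>The derivative has constant sign on the interval, and the mean value theorem on both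
  sides of \<open>r\<close> expresses \<open>- poly p l\<close> and \<open>poly p u\<close> as
  positive multiples of its values. The sign change is what can be carried over to another field,
  where it produces a root again.\<close>

lemma poly_sg_change_at_root:
  fixes p :: "'a::real_closed poly"
  assumes "\<And>c. l < c \<Longrightarrow> c < u \<Longrightarrow> poly (pderiv p) c \<noteq> 0" "l < r" "r < u" "poly p r = 0"
  shows "poly p l \<noteq> 0" "poly p u \<noteq> 0" "sg (poly p l) \<noteq> sg (poly p u)"
proof -
  obtain c where c: "l < c" "c < r" "poly p r - poly p l = (r - l) * poly (pderiv p) c"
    using poly_mean_value[OF assms(2)] by blast
  obtain d where d: "r < d" "d < u" "poly p u - poly p r = (u - r) * poly (pderiv p) d"
    using poly_mean_value[OF assms(3)] by blast
  have nz: "poly (pderiv p) c \<noteq> 0" "poly (pderiv p) d \<noteq> 0"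
    using assms(1) c d assms(2,3) by (auto intro: order.strict_trans)
  have "sg (poly (pderiv p) c) = sg (poly (pderiv p) d)"
    by (rule poly_sg_const[of l u]) (use assms c d nz in auto)
  moreover have "sg (poly p u) = sg (poly (pderiv p) d)"
    "sg (- poly p l) = sg (poly (pderiv p) c)"
    using c(3) d(3) assms(2-4) by (simp_all add: sg_mult) (simp_all add: sg_def)
  ultimately show "poly p l \<noteq> 0" "poly p u \<noteq> 0" "sg (poly p l) \<noteq> sg (poly p u)"
    using nz by (auto simp: sg_minus)
qed

lemma poly_ge_lead_coeff:
  fixes p :: "'a::linordered_field poly"
  assumes "lead_coeff p > 0"
  shows "\<exists>n. \<forall>x\<ge>n. poly p x \<ge> lead_coeff p"
  using assms
proof (induction p)
  case 0
  then show ?case by simp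
next
  case (pCons a p)
  show ?case
  proof (cases "p = 0")
    case True
    then show ?thesis by auto
  next
    case False
    define c where "c = lead_coeff p"
    have c: "c > 0" using pCons.prems False by (simp add: c_def)
    obtain n where n: "\<And>x. x \<ge> n \<Longrightarrow> poly p x \<ge> c"
      using pCons.IH c by (auto simp: c_def)
    \<comment> \<open>The bound on \<open>x\<close> gives
      \<open>x * c \<ge> c + \<bar>a\<bar>\<close>, so the constant term \<open>a\<close> cannot
      push the value below \<open>c\<close>.\<close>
    have "poly (pCons a p) x \<ge> c" if x: "x \<ge> max n (1 + \<bar>a\<bar> / c)" for x
    proof -
      have "\<bar>a\<bar> / c \<ge> 0" using c by simp
      moreover have x1: "x \<ge> 1 + \<bar>a\<bar> / c" using x by simp
      ultimately have "x \<ge> 0" by linarith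
      have "(1 + \<bar>a\<bar> / c) * c \<le> x * c"
        using x1 c by (intro mult_right_mono) auto
      also have "\<dots> \<le> x * poly p x"
        using n[of x] x \<open>x \<ge> 0\<close> by (intro mult_left_mono) auto
      finally have "c + \<bar>a\<bar> \<le> x * poly p x"
        using c by (simp add: distrib_right)
      then show ?thesis by simp
    qed
    moreover have "lead_coeff (pCons a p) = c" using False by (simp add: c_def)
    ultimately show ?thesis by metis
  qed
qed

lemma poly_sg_at_top:
  fixes p :: "'a::linordered_field poly"
  shows "\<exists>n. \<forall>x\<ge>n. sg (poly p x) = sg (lead_coeff p)"
proof -
  consider "p = 0" | "lead_coeff p > 0" | "lead_coeff (- p) > 0"
    by (metis leading_coeff_0_iff linorder_neqE_linordered_idom lead_coeff_minus neg_0_less_iff_less)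
  then show ?thesis
  proof cases
    case 2
    with poly_ge_lead_coeff[OF 2] show ?thesis
      by (metis sg_eq_1_iff order_less_le_trans)
  next
    case 3
    obtain n where n: "\<And>x. x \<ge> n \<Longrightarrow> poly (- p) x \<ge> lead_coeff (- p)"
      using poly_ge_lead_coeff[OF 3] by blast
    have "sg (poly p x) = sg (lead_coeff p)" if "x \<ge> n" for x
      using n[OF that] 3 by (auto simp: sg_def)
    then show ?thesis by blast
  qed simp
qed

section \<open>Ring homomorphisms and coefficientwise images of polynomials\<close>

text \<open>The constant \<^const>\<open>pderiv\<close> is only available over rings without zero divisors.\<close>

definition formal_deriv :: "'a::comm_ring_1 poly \<Rightarrow> 'a poly" where
  "formal_deriv p = (\<Sum>i<degree p. monom (of_nat (Suc i) * coeff p (Suc i)) i)"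

lemma coeff_formal_deriv: "coeff (formal_deriv p) i = of_nat (Suc i) * coeff p (Suc i)"
  by (auto simp: formal_deriv_def coeff_sum coeff_eq_0 not_less simp del: of_nat_Suc)

lemma degree_formal_deriv: "0 < degree p \<Longrightarrow> degree (formal_deriv p) < degree p"
  by (rule degree_lessI) (auto simp: coeff_formal_deriv coeff_eq_0)

locale cring_hom =
  fixes h :: "'a::comm_ring_1 \<Rightarrow> 'b::comm_ring_1"
  assumes hom_add: "h (x + y) = h x + h y"
    and hom_mult: "h (x * y) = h x * h y"
    and hom_one [simp]: "h 1 = 1"
begin

lemma hom_zero [simp]: "h 0 = 0"
  using hom_add[of 0 0] by simp

lemma hom_uminus: "h (- x) = - h x"
  using hom_add[of x "- x"] by (simp add: eq_neg_iff_add_eq_0 add.commute)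

lemma hom_diff: "h (x - y) = h x - h y"
  using hom_add[of x "- y"] by (simp add: hom_uminus)

lemma hom_sum: "h (sum f A) = (\<Sum>i\<in>A. h (f i))"
  by (induction A rule: infinite_finite_induct) (simp_all add: hom_add)

lemma hom_of_nat: "h (of_nat n) = of_nat n"
  by (induction n) (simp_all add: hom_add)

lemma hom_power: "h (x ^ n) = h x ^ n"
  by (induction n) (simp_all add: hom_mult)

lemma map_poly_hom_add: "map_poly h (p + q) = map_poly h p + map_poly h q"
  by (intro poly_eqI) (simp add: coeff_map_poly hom_add)

lemma map_poly_hom_diff: "map_poly h (p - q) = map_poly h p - map_poly h q"
  by (intro poly_eqI) (simp add: coeff_map_poly hom_diff)

lemma map_poly_hom_mult: "map_poly h (p * q) = map_poly h p * map_poly h q"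
  by (intro poly_eqI) (simp add: coeff_map_poly coeff_mult hom_sum hom_mult)

lemma map_poly_hom_smult: "map_poly h (smult c p) = smult (h c) (map_poly h p)"
  by (intro poly_eqI) (simp add: coeff_map_poly hom_mult)

lemma poly_map_poly_hom: "poly (map_poly h p) (h x) = h (poly p x)"
  by (induction p) (simp_all add: map_poly_pCons hom_add hom_mult)

end

lemma map_poly_formal_deriv:
  fixes h :: "'a::comm_ring_1 \<Rightarrow> 'b::idom"
  assumes "cring_hom h"
  shows "map_poly h (formal_deriv p) = pderiv (map_poly h p)"
proof -
  interpret cring_hom h by (rule assms)
  show ?thesis
    by (intro poly_eqI)
      (simp add: coeff_map_poly coeff_pderiv coeff_formal_deriv hom_mult hom_add hom_of_nat)
qed

lemma cring_hom_comp: "cring_hom g \<Longrightarrow> cring_hom h \<Longrightarrow> cring_hom (\<lambda>x. g (h x))"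
  by (simp add: cring_hom_def)


section \<open>Transfer of sign conditions between real closed fields\<close>

text \<open>
  A finite set \<open>D\<close> of pairs \<open>(z, w)\<close> pairs the roots of polynomials over one field with the roots of
  their counterparts over another one. The cells of \<open>D\<close> are its points and the open intervals
  between them.
\<close>

definition order_matching :: "('a::linordered_idom \<times> 'b::linordered_idom) set \<Rightarrow> bool" where
  "order_matching D \<longleftrightarrow> (\<forall>(z, w)\<in>D. \<forall>(z', w')\<in>D. sg (z - z') = sg (w - w'))"

definition same_cell :: "('a::linordered_idom \<times> 'b::linordered_idom) set \<Rightarrow> 'a \<Rightarrow> 'b \<Rightarrow> bool" where
  "same_cell D t s \<longleftrightarrow> (\<forall>(z, w)\<in>D. sg (t - z) = sg (s - w))"

lemma order_matching_converse: "order_matching (D\<inverse>) \<longleftrightarrow> order_matching D"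
  by (force simp: order_matching_def)

lemma same_cell_mono: "same_cell D' t s \<Longrightarrow> D \<subseteq> D' \<Longrightarrow> same_cell D t s"
  by (auto simp: same_cell_def)

lemma same_cellD:
  assumes "same_cell D t s" "(z, w) \<in> D"
  shows "t < z \<longleftrightarrow> s < w" "t = z \<longleftrightarrow> s = w" "z < t \<longleftrightarrow> w < s"
proof -
  have "sg (t - z) = sg (s - w)"
    using assms by (auto simp: same_cell_def)
  then show "t < z \<longleftrightarrow> s < w" "t = z \<longleftrightarrow> s = w" "z < t \<longleftrightarrow> w < s"
    unfolding sg_diff_eq_iff by auto
qed

lemma order_matching_same_cell: "order_matching D \<Longrightarrow> (z, w) \<in> D \<Longrightarrow> same_cell D z w"
  by (auto simp: order_matching_def same_cell_def)

lemma order_matching_insert: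
  "order_matching D \<Longrightarrow> same_cell D t s \<Longrightarrow> order_matching (insert (t, s) D)"
  by (auto simp: order_matching_def same_cell_def sg_diff_eq_iff split: prod.splits)

lemma exists_between_finite_sets:
  fixes A B :: "'a::linordered_field set"
  assumes "finite A" "finite B" "\<And>a b. a \<in> A \<Longrightarrow> b \<in> B \<Longrightarrow> a < b"
  shows "\<exists>s. (\<forall>a\<in>A. a < s) \<and> (\<forall>b\<in>B. s < b)"
proof (cases "A = {}")
  case True
  show ?thesis
  proof (cases "B = {}")
    case False
    have "Min B - 1 < b" if "b \<in> B" for b
      using Min_le[OF assms(2) that] by (simp add: less_le_trans[of _ "Min B"])
    then show ?thesis using True by blast
  qed (use True in simp)
next
  case False
  show ?thesis
  proof (cases "B = {}")
    case True
    have "a < Max A + 1" if "a \<in> A" for a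
      using Max_ge[OF assms(1) that] by (simp add: le_less_trans[of _ "Max A"])
    then show ?thesis using True by blast
  next
    case B: False
    have "Max A < Min B"
      using False B assms by simp
    then obtain s where "Max A < s" "s < Min B"
      using dense by blast
    then show ?thesis
      using False B assms(1,2) by auto
  qed
qed

text \<open>A matched \<open>t\<close> has its partner. Otherwise the partners of the points below
  \<open>t\<close> lie below the partners of the points above \<open>t\<close>, and an ordered field
  is dense and unbounded, so there is room between them.\<close>

lemma same_cell_total:
  fixes D :: "('a::linordered_idom \<times> 'b::linordered_field) set"
  assumes "finite D" "order_matching D"
  shows "\<exists>s. same_cell D t s"
proof (cases "t \<in> fst ` D")
  case True
  then show ?thesis
    using order_matching_same_cell[OF assms(2)] by force
next
  case False
  have "\<exists>s. (\<forall>a\<in>snd ` {d \<in> D. fst d < t}. a < s) \<and> (\<forall>b\<in>snd ` {d \<in> D. t < fst d}. s < b)"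
  proof (rule exists_between_finite_sets)
    fix a b assume "a \<in> snd ` {d \<in> D. fst d < t}" "b \<in> snd ` {d \<in> D. t < fst d}"
    then obtain z z' where z: "(z, a) \<in> D" "z < t" "(z', b) \<in> D" "t < z'" by auto
    then show "a < b"
      using same_cellD(1)[OF order_matching_same_cell[OF assms(2) z(1)] z(3)] by simp
  qed (use assms(1) in auto)
  then obtain s where s: "\<forall>a\<in>snd ` {d \<in> D. fst d < t}. a < s" "\<forall>b\<in>snd ` {d \<in> D. t < fst d}. s < b"
    by blast
  have "sg (t - z) = sg (s - w)" if "(z, w) \<in> D" for z w
  proof (cases "z < t")
    case True
    then have "w < s" using s(1) that by force
    then show ?thesis using True by (simp add: sg_def)
  next
    case f: False
    have "z \<noteq> t" using False that by force
    with f have "t < z" by simp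
    moreover from this have "s < w" using s(2) that by force
    ultimately show ?thesis by (simp add: sg_def)
  qed
  then show ?thesis by (auto simp: same_cell_def)
qed

section \<open>Adding the roots of one more polynomial to a matching\<close>

text \<open>The right end of an open cell is the next matched pair. If the cell is unbounded, two
  points far to the right stand in for it, where the signs are those of the leading
  coefficients.\<close>

lemma cell_upper_neighbour:
  fixes p :: "'a::linordered_field poly" and q :: "'b::linordered_field poly"
  assumes "finite D" "order_matching D" "same_cell D t s" "t \<notin> fst ` D"
    and "sg (lead_coeff p) = sg (lead_coeff q)"
    and "\<And>z w. (z, w) \<in> D \<Longrightarrow> sg (poly p z) = sg (poly q w)"
  shows "\<exists>u u'. t < u \<and> s < u' \<and> (\<forall>(z, w)\<in>D. z < t \<and> w < s \<or> u \<le> z \<and> u' \<le> w) \<and>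
    sg (poly p u) = sg (poly q u')"
proof (cases "{d \<in> D. t < fst d} = {}")
  case True
  obtain n where n: "\<And>x. x \<ge> n \<Longrightarrow> sg (poly p x) = sg (lead_coeff p)"
    using poly_sg_at_top by blast
  obtain m where m: "\<And>x. x \<ge> m \<Longrightarrow> sg (poly q x) = sg (lead_coeff q)"
    using poly_sg_at_top by blast
  have "z < t \<and> w < s" if "(z, w) \<in> D" for z w
  proof -
    have "\<not> t < z" "t \<noteq> z" using that True assms(4) by force+
    then show ?thesis using same_cellD(3)[OF assms(3) that] by auto
  qed
  moreover have "t < max (t + 1) n" "s < max (s + 1) m"
    by (simp_all add: less_max_iff_disj)
  ultimately show ?thesis
    using n[of "max (t + 1) n"] m[of "max (s + 1) m"] assms(5) by (metis (lifting) case_prodI2 max.cobounded2)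
next
  case False
  have "finite {d \<in> D. t < fst d}" using assms(1) by simp
  then have fin: "finite (fst ` {d \<in> D. t < fst d})" by simp
  define u where "u = Min (fst ` {d \<in> D. t < fst d})"
  have u: "u \<in> fst ` {d \<in> D. t < fst d}" "\<And>z. z \<in> fst ` {d \<in> D. t < fst d} \<Longrightarrow> u \<le> z"
    using Min_in[OF fin] Min_le[OF fin] False unfolding u_def by simp_all
  from u(1) obtain u' where u': "(u, u') \<in> D" "t < u" by auto
  have "z < t \<and> w < s \<or> u \<le> z \<and> u' \<le> w" if zw: "(z, w) \<in> D" for z w
  proof (cases "z < t")
    case True
    then show ?thesis using same_cellD(3)[OF assms(3) zw] by simp
  next
    case f: False
    have "z \<noteq> t" using assms(4) zw by force
    with f have "t < z" by simp
    then have "u \<le> z" using u(2) zw by force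
    then have "u' \<le> w"
      using same_cellD(3)[OF order_matching_same_cell[OF assms(2) u'(1)] zw] by (auto simp: not_less[symmetric])
    with \<open>u \<le> z\<close> show ?thesis by simp
  qed
  then show ?thesis
    using u' assms(6)[OF u'(1)] same_cellD(1)[OF assms(3) u'(1)] by blast
qed

text \<open>Reflection x -> -x reduces this to the upper neighbour. It multiplies the leading
  coefficients by a power of -1 with the degree as exponent, hence the hypothesis of equal
  degrees.\<close>

lemma cell_lower_neighbour:
  fixes p :: "'a::linordered_field poly" and q :: "'b::linordered_field poly"
  assumes "finite D" "order_matching D" "same_cell D t s" "t \<notin> fst ` D"
    and "degree p = degree q" "sg (lead_coeff p) = sg (lead_coeff q)"
    and "\<And>z w. (z, w) \<in> D \<Longrightarrow> sg (poly p z) = sg (poly q w)"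
  shows "\<exists>l l'. l < t \<and> l' < s \<and> (\<forall>(z, w)\<in>D. z \<le> l \<and> w \<le> l' \<or> t < z \<and> s < w) \<and>
    sg (poly p l) = sg (poly q l')"
proof -
  let ?D = "map_prod uminus uminus ` D"
  have neg: "sg (- x - - y) = - sg (x - y)" for x y :: "'c::linordered_idom"
    by (simp flip: sg_minus)
  have "\<exists>u u'. - t < u \<and> - s < u' \<and> (\<forall>(z, w)\<in>?D. z < - t \<and> w < - s \<or> u \<le> z \<and> u' \<le> w) \<and>
    sg (poly (pcompose p [:0, -1:]) u) = sg (poly (pcompose q [:0, -1:]) u')"
  proof (rule cell_upper_neighbour)
    show "order_matching ?D"
      using assms(2) by (fastforce simp: order_matching_def neg)
    show "same_cell ?D (- t) (- s)"
      using same_cellD[OF assms(3)] by (fastforce simp: same_cell_def sg_diff_eq_iff)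
    show "- t \<notin> fst ` ?D"
      using assms(4) by force
    have "sg (- 1 :: 'a) = - 1" "sg (- 1 :: 'b) = - 1" by (simp_all add: sg_def)
    then show "sg (lead_coeff (pcompose p [:0, -1:])) = sg (lead_coeff (pcompose q [:0, -1:]))"
      using assms(5,6) by (simp add: lead_coeff_comp sg_mult sg_power)
  qed (use assms(1,7) in \<open>auto simp: poly_pcompose\<close>)
  then obtain u u' where u: "- t < u" "- s < u'"
    "\<forall>(z, w)\<in>?D. z < - t \<and> w < - s \<or> u \<le> z \<and> u' \<le> w" "sg (poly p (- u)) = sg (poly q (- u'))"
    by (auto simp: poly_pcompose)
  have "z \<le> - u \<and> w \<le> - u' \<or> t < z \<and> s < w" if "(z, w) \<in> D" for z w
    using bspec[OF u(3), of "(- z, - w)"] that by (force simp: le_minus_iff)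
  then show ?thesis
    using u by (intro exI[of _ "- u"] exI[of _ "- u'"]) (auto simp: minus_less_iff)
qed

lemma cell_neighbours:
  fixes p :: "'a::linordered_field poly" and q :: "'b::linordered_field poly"
  assumes "finite D" "order_matching D" "same_cell D t s" "t \<notin> fst ` D"
    and "degree p = degree q" "sg (lead_coeff p) = sg (lead_coeff q)"
    and "\<And>z w. (z, w) \<in> D \<Longrightarrow> sg (poly p z) = sg (poly q w)"
  obtains l u l' u' where "l < t" "t < u" "l' < s" "s < u'"
    "\<And>z w. (z, w) \<in> D \<Longrightarrow> z \<le> l \<and> w \<le> l' \<or> u \<le> z \<and> u' \<le> w"
    "sg (poly p l) = sg (poly q l')" "sg (poly p u) = sg (poly q u')"
proof -
  obtain u u' where u: "t < u" "s < u'" "\<forall>(z, w)\<in>D. z < t \<and> w < s \<or> u \<le> z \<and> u' \<le> w"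
    "sg (poly p u) = sg (poly q u')"
    using cell_upper_neighbour[OF assms(1-4,6,7)] by blast
  obtain l l' where l: "l < t" "l' < s" "\<forall>(z, w)\<in>D. z \<le> l \<and> w \<le> l' \<or> t < z \<and> s < w"
    "sg (poly p l) = sg (poly q l')"
    using cell_lower_neighbour[OF assms] by blast
  have "z \<le> l \<and> w \<le> l' \<or> u \<le> z \<and> u' \<le> w" if "(z, w) \<in> D" for z w
    using bspec[OF u(3) that] bspec[OF l(3) that] by auto
  with u l show ?thesis using that by blast
qed

text \<open>All roots of the derivative are matched, so none lies inside the open cell of
  \<open>r\<close>, and \<open>p\<close> changes sign across that cell. The signs at the two ends
  agree with those of \<open>q\<close>, so \<open>q\<close> changes sign across the corresponding
  cell and has a root there.\<close>

lemma matching_root: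
  fixes p :: "'a::real_closed poly" and q :: "'b::real_closed poly"
  assumes "finite D" "order_matching D"
    and "degree p = degree q" "sg (lead_coeff p) = sg (lead_coeff q)"
    and "\<And>z w. (z, w) \<in> D \<Longrightarrow> sg (poly p z) = sg (poly q w)"
    and "\<And>c. poly (pderiv p) c = 0 \<Longrightarrow> c \<in> fst ` D"
    and "poly p r = 0" "r \<notin> fst ` D"
  shows "\<exists>r'. poly q r' = 0 \<and> same_cell D r r'"
proof -
  obtain s where s: "same_cell D r s"
    using same_cell_total[OF assms(1,2)] by blast
  obtain l u l' u' where lu: "l < r" "r < u" "l' < s" "s < u'"
    "\<And>z w. (z, w) \<in> D \<Longrightarrow> z \<le> l \<and> w \<le> l' \<or> u \<le> z \<and> u' \<le> w"
    "sg (poly p l) = sg (poly q l')" "sg (poly p u) = sg (poly q u')"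
    using cell_neighbours[OF assms(1,2) s assms(8,3,4,5)] by blast
  have nr: "poly (pderiv p) c \<noteq> 0" if "l < c" "c < u" for c
  proof
    assume "poly (pderiv p) c = 0"
    then obtain w where "(c, w) \<in> D" using assms(6) by force
    then show False using lu(5)[of c w] that by auto
  qed
  have sc: "poly p l \<noteq> 0" "poly p u \<noteq> 0" "sg (poly p l) \<noteq> sg (poly p u)"
    using poly_sg_change_at_root[of l u p r] nr lu assms(7) by blast+
  then have nz: "poly q l' \<noteq> 0" "poly q u' \<noteq> 0" "sg (poly q l') \<noteq> sg (poly q u')"
    using lu(6,7) by (metis sg_eq_0_iff)+
  have "l' < u'" using lu by simp
  then obtain r' where r': "l' < r'" "r' < u'" "poly q r' = 0"
    using poly_sg_neq_root[of l' u' q] nz by blast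
  have "sg (r - z) = sg (r' - w)" if "(z, w) \<in> D" for z w
    using lu(1,2) lu(5)[OF that] r' by (auto simp: sg_def)
  then show ?thesis
    using r' by (auto simp: same_cell_def)
qed

lemma matching_add_roots:
  fixes p :: "'a::real_closed poly" and q :: "'b::real_closed poly"
  assumes "finite R" "finite D" "order_matching D"
    and "degree p = degree q" "sg (lead_coeff p) = sg (lead_coeff q)"
    and "\<And>z w. (z, w) \<in> D \<Longrightarrow> sg (poly p z) = sg (poly q w)"
    and "\<And>c. poly (pderiv p) c = 0 \<Longrightarrow> c \<in> fst ` D"
    and "\<And>r. r \<in> R \<Longrightarrow> poly p r = 0"
  shows "\<exists>D'. D \<subseteq> D' \<and> finite D' \<and> order_matching D' \<and> R \<subseteq> fst ` D' \<and>
    (\<forall>(z, w)\<in>D' - D. poly p z = 0 \<and> poly q w = 0)"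
  using assms(1,8)
proof (induction R)
  case empty
  then show ?case using assms(2,3) by auto
next
  case (insert r R)
  have "\<exists>D'. D \<subseteq> D' \<and> finite D' \<and> order_matching D' \<and> R \<subseteq> fst ` D' \<and>
    (\<forall>(z, w)\<in>D' - D. poly p z = 0 \<and> poly q w = 0)"
    using insert.IH insert.prems by blast
  then obtain D' where D': "D \<subseteq> D'" "finite D'" "order_matching D'" "R \<subseteq> fst ` D'"
    "\<And>z w. (z, w) \<in> D' - D \<Longrightarrow> poly p z = 0 \<and> poly q w = 0"
    by blast
  show ?case
  proof (cases "r \<in> fst ` D'")
    case True
    then show ?thesis using D' by (intro exI[of _ D']) auto
  next
    case False
    \<comment> \<open>New pairs consist of roots of both polynomials, so the sign hypothesis
      survives each insertion.\<close>
    have "sg (poly p z) = sg (poly q w)" if "(z, w) \<in> D'" for z w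
      using D'(5)[of z w] assms(6)[of z w] that by (cases "(z, w) \<in> D") auto
    moreover have "c \<in> fst ` D'" if "poly (pderiv p) c = 0" for c
      using assms(7)[OF that] D'(1) by auto
    ultimately obtain r' where r': "poly q r' = 0" "same_cell D' r r'"
      using matching_root[OF D'(2,3) assms(4,5) _ _ insert.prems[of r] False] by blast
    then show ?thesis
      using D' insert.prems[of r] order_matching_insert[OF D'(3) r'(2)]
      by (intro exI[of _ "insert (r, r') D'"]) auto
  qed
qed

text \<open>The roots of \<open>p\<close> are added first, then those of \<open>q\<close> by the
  same lemma on the converse relation. Afterwards neither polynomial vanishes inside an open cell,
  so its sign there is the sign at an end where it is nonzero. Such an end exists: if
  \<open>p\<close> vanished at both, Rolle would put a root of the derivative inside the cell, but
  all of these are matched.\<close>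

lemma matching_add_poly:
  fixes p :: "'a::real_closed poly" and q :: "'b::real_closed poly"
  assumes "finite D" "order_matching D"
    and "degree p = degree q" "sg (lead_coeff p) = sg (lead_coeff q)" "p \<noteq> 0"
    and "\<And>z w. (z, w) \<in> D \<Longrightarrow> sg (poly p z) = sg (poly q w)"
    and "\<And>c. poly (pderiv p) c = 0 \<Longrightarrow> c \<in> fst ` D"
    and "\<And>c. poly (pderiv q) c = 0 \<Longrightarrow> c \<in> snd ` D"
  obtains D' where "D \<subseteq> D'" "finite D'" "order_matching D'"
    "\<And>z w. (z, w) \<in> D' - D \<Longrightarrow> poly p z = 0 \<and> poly q w = 0"
    "\<And>c. poly p c = 0 \<Longrightarrow> c \<in> fst ` D'" "\<And>c. poly q c = 0 \<Longrightarrow> c \<in> snd ` D'"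
    "\<And>t s. same_cell D' t s \<Longrightarrow> sg (poly p t) = sg (poly q s)"
proof -
  have "q \<noteq> 0"
    using assms(4,5) by auto
  obtain D1 where D1: "D \<subseteq> D1" "finite D1" "order_matching D1" "{r. poly p r = 0} \<subseteq> fst ` D1"
    "\<And>z w. (z, w) \<in> D1 - D \<Longrightarrow> poly p z = 0 \<and> poly q w = 0"
    using matching_add_roots[OF poly_roots_finite[OF assms(5)] assms(1-4,6,7)] by blast
  have sgn1: "sg (poly p z) = sg (poly q w)" if "(z, w) \<in> D1" for z w
    using D1(5)[of z w] assms(6)[of z w] that by (cases "(z, w) \<in> D") auto
  have "\<exists>D'. D1\<inverse> \<subseteq> D' \<and> finite D' \<and> order_matching D' \<and> {r. poly q r = 0} \<subseteq> fst ` D' \<and>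
    (\<forall>(z, w)\<in>D' - D1\<inverse>. poly q z = 0 \<and> poly p w = 0)"
  proof (rule matching_add_roots[OF poly_roots_finite[OF \<open>q \<noteq> 0\<close>]])
    show "c \<in> fst ` D1\<inverse>" if "poly (pderiv q) c = 0" for c
      using assms(8)[OF that] D1(1) by force
  qed (use D1 assms(3,4) sgn1 in \<open>auto simp: order_matching_converse\<close>)
  then obtain D2 where D2: "D1\<inverse> \<subseteq> D2" "finite D2" "order_matching D2" "{r. poly q r = 0} \<subseteq> fst ` D2"
    "\<And>z w. (z, w) \<in> D2 - D1\<inverse> \<Longrightarrow> poly q z = 0 \<and> poly p w = 0"
    by blast
  define D' where "D' = D2\<inverse>"
  have sub: "D1 \<subseteq> D'" using D2(1) by (auto simp: D'_def)
  then have sub0: "D \<subseteq> D'" using D1(1) by blast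
  have fin: "finite D'" and om: "order_matching D'"
    using D2(2,3) by (simp_all add: D'_def order_matching_converse)
  have new: "poly p z = 0 \<and> poly q w = 0" if "(z, w) \<in> D' - D" for z w
    using D2(5)[of w z] D1(5)[of z w] that by (auto simp: D'_def)
  have rp: "c \<in> fst ` D'" if "poly p c = 0" for c
    using D1(4) sub that by blast
  have rq: "c \<in> snd ` D'" if "poly q c = 0" for c
    using D2(4) that by (force simp: D'_def)
  have sgn: "sg (poly p z) = sg (poly q w)" if "(z, w) \<in> D'" for z w
    using new[of z w] assms(6)[of z w] that by (cases "(z, w) \<in> D") auto
  have "sg (poly p t) = sg (poly q s)" if cell: "same_cell D' t s" for t s
  proof (cases "t \<in> fst ` D'")
    case True
    then obtain w where w: "(t, w) \<in> D'" by auto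
    then have "s = w" using same_cellD(2)[OF cell w] by simp
    then show ?thesis using sgn[OF w] by simp
  next
    case False
    obtain l u l' u' where lu: "l < t" "t < u" "l' < s" "s < u'"
      "\<And>z w. (z, w) \<in> D' \<Longrightarrow> z \<le> l \<and> w \<le> l' \<or> u \<le> z \<and> u' \<le> w"
      "sg (poly p l) = sg (poly q l')" "sg (poly p u) = sg (poly q u')"
      using cell_neighbours[OF fin om cell False assms(3,4) sgn] by blast
    have np: "poly p c \<noteq> 0" if "l < c" "c < u" for c
      using rp[of c] lu(5)[of c] that by fastforce
    have nq: "poly q c \<noteq> 0" if "l' < c" "c < u'" for c
      using rq[of c] lu(5)[of _ c] that by fastforce
    have cp: "sg (poly p t) = sg (poly p x)" if "x \<in> {l, u}" "poly p x \<noteq> 0" for x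
      by (rule poly_sg_const[of l u]) (use np lu that in auto)
    have cq: "sg (poly q s) = sg (poly q x)" if "x \<in> {l', u'}" "poly q x \<noteq> 0" for x
      by (rule poly_sg_const[of l' u']) (use nq lu that in auto)
    consider "poly p l \<noteq> 0" | "poly p u \<noteq> 0" | "poly p l = 0" "poly p u = 0"
      by blast
    then show ?thesis
    proof cases
      case 1
      then have "poly q l' \<noteq> 0" using lu(6) by (metis sg_eq_0_iff)
      then show ?thesis using cp[of l] cq[of l'] 1 lu(6) by simp
    next
      case 2
      then have "poly q u' \<noteq> 0" using lu(7) by (metis sg_eq_0_iff)
      then show ?thesis using cp[of u] cq[of u'] 2 lu(7) by simp
    next
      case 3
      have "l < u" using lu by simp
      then obtain c where c: "l < c" "c < u" "poly (pderiv p) c = 0"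
        using poly_Rolle 3 by blast
      then obtain w where "(c, w) \<in> D'" using assms(7)[of c] sub0 by force
      then show ?thesis using lu(5)[of c w] c by auto
    qed
  qed
  then show ?thesis
    using that[OF sub0 fin om new rp rq] by blast
qed

section \<open>Closing a finite set under derivatives, truncations and pseudo-remainders\<close>

lemma (in cring_hom) degree_map_poly_hom:
  assumes "h (lead_coeff p) \<noteq> 0"
  shows "degree (map_poly h p) = degree p"
proof (rule antisym)
  show "degree (map_poly h p) \<le> degree p"
    by (rule degree_le) (simp add: coeff_map_poly coeff_eq_0)
  show "degree p \<le> degree (map_poly h p)"
    by (rule le_degree) (simp add: coeff_map_poly assms)
qed

text \<open>The coefficients form a mere commutative ring, in which leading coefficients cannot be
  inverted; pseudo-division only costs a power of the leading coefficient of the divisor.\<close>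

definition pseudo_rem :: "'a::comm_ring_1 poly \<Rightarrow> 'a poly \<Rightarrow> 'a poly" where
  "pseudo_rem f g = snd (pseudo_divmod f g)"

text \<open>This replaces \<open>f\<close> under homomorphisms that send its leading coefficient to
  0.\<close>

definition truncate_poly :: "'a::comm_ring_1 poly \<Rightarrow> 'a poly" where
  "truncate_poly f = f - monom (lead_coeff f) (degree f)"

lemma degree_truncate_poly:
  assumes "0 < degree f"
  shows "degree (truncate_poly f) < degree f"
proof (rule degree_lessI)
  show "\<forall>k\<ge>degree f. coeff (truncate_poly f) k = 0"
    by (auto simp: truncate_poly_def coeff_eq_0)
qed (use assms in simp)

lemma pseudo_rem_eq:
  assumes "0 < degree g"
  obtains m q where "smult (lead_coeff g ^ m) f = g * q + pseudo_rem f g"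
  using pseudo_divmod(1)[of g f "fst (pseudo_divmod f g)" "pseudo_rem f g"] assms
  by (fastforce simp: pseudo_rem_def)

lemma degree_pseudo_rem:
  assumes "0 < degree g"
  shows "degree (pseudo_rem f g) < degree g"
  using pseudo_divmod(2)[of g f "fst (pseudo_divmod f g)" "pseudo_rem f g"] assms
  by (fastforce simp: pseudo_rem_def)

text \<open>
  \<open>derived_closed_above j H\<close> only requires closure for the members of degree at least \<open>j\<close>. Since
  every derived polynomial has smaller degree, closure can be achieved by lowering \<open>j\<close> step by step.
\<close>

definition derived_closed_above :: "nat \<Rightarrow> 'a::comm_ring_1 poly set \<Rightarrow> bool" where
  "derived_closed_above j H \<longleftrightarrow>
    (\<forall>f\<in>H. j \<le> degree f \<longrightarrow> 0 < degree f \<longrightarrow> formal_deriv f \<in> H \<and> truncate_poly f \<in> H) \<and>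
    (\<forall>f\<in>H. \<forall>g\<in>H. j \<le> degree g \<longrightarrow> 0 < degree g \<longrightarrow> degree g \<le> degree f \<longrightarrow> pseudo_rem f g \<in> H)"

lemma derived_closed_above_step:
  assumes "finite H" "derived_closed_above (Suc j) H"
  shows "\<exists>H'. H \<subseteq> H' \<and> finite H' \<and> derived_closed_above j H'"
proof -
  define P where "P = {(f, g). f \<in> H \<and> g \<in> H \<and> 0 < degree g \<and> degree g \<le> degree f}"
  define Q where "Q = {f \<in> H. 0 < degree f}"
  define H' where "H' = H \<union> formal_deriv ` Q \<union> truncate_poly ` Q \<union> case_prod pseudo_rem ` P"
  have "P \<subseteq> H \<times> H" "Q \<subseteq> H" by (auto simp: P_def Q_def)
  then have "finite P" "finite Q"
    using assms(1) by (auto intro: finite_subset)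
  then have fin: "finite H'"
    using assms(1) by (simp add: H'_def)
  \<comment> \<open>Nothing new appears in degree \<open>j\<close> or above: a derived polynomial of
    such a degree comes from members of degree at least \<open>Suc j\<close> (for a pseudo-remainder
    this refers to the divisor), where \<open>H\<close> is already closed.\<close>
  have old: "f \<in> H" if "f \<in> H'" "j \<le> degree f" for f
  proof -
    consider "f \<in> H" | g where "g \<in> Q" "f = formal_deriv g" | g where "g \<in> Q" "f = truncate_poly g"
      | g k where "(g, k) \<in> P" "f = pseudo_rem g k"
      using \<open>f \<in> H'\<close> by (auto simp: H'_def)
    then show ?thesis
    proof cases
      case 2
      then have "Suc j \<le> degree g" "0 < degree g" "g \<in> H"
        using degree_formal_deriv[of g] that(2) by (auto simp: Q_def)
      then show ?thesis using assms(2) 2 by (auto simp: derived_closed_above_def)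
    next
      case 3
      then have "Suc j \<le> degree g" "0 < degree g" "g \<in> H"
        using degree_truncate_poly[of g] that(2) by (auto simp: Q_def)
      then show ?thesis using assms(2) 3 by (auto simp: derived_closed_above_def)
    next
      case 4
      then have "Suc j \<le> degree k" "0 < degree k" "g \<in> H" "k \<in> H" "degree k \<le> degree g"
        using degree_pseudo_rem[of k g] that(2) by (auto simp: P_def)
      then show ?thesis using assms(2) 4 by (auto simp: derived_closed_above_def)
    qed
  qed
  have "derived_closed_above j H'"
    unfolding derived_closed_above_def
  proof (intro conjI ballI impI)
    fix f assume "f \<in> H'" "j \<le> degree f" "0 < degree f"
    with old[of f] have "f \<in> Q" by (simp add: Q_def)
    then show "formal_deriv f \<in> H'" "truncate_poly f \<in> H'" by (auto simp: H'_def)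
  next
    fix f g assume "f \<in> H'" "g \<in> H'" "j \<le> degree g" "0 < degree g" "degree g \<le> degree f"
    with old[of f] old[of g] have "(f, g) \<in> P" by (simp add: P_def)
    then show "pseudo_rem f g \<in> H'" by (force simp: H'_def)
  qed
  with fin show ?thesis by (auto simp: H'_def intro!: exI[of _ H'])
qed

lemma derived_closure:
  assumes "finite F"
  shows "\<exists>H. F \<subseteq> H \<and> finite H \<and> derived_closed_above 0 H"
proof -
  have "\<exists>H. F \<subseteq> H \<and> finite H \<and> derived_closed_above (d - k) H"
    if d: "d = Suc (Max (insert 0 (degree ` F)))" for d k
  proof (induction k)
    case 0
    have "degree f < d" if "f \<in> F" for f
      using assms that d by (auto simp: less_Suc_eq_le)
    then have "derived_closed_above d F"
      unfolding derived_closed_above_def by (meson leD le_trans)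
    with assms show ?case by auto
  next
    case (Suc k)
    then obtain H where H: "F \<subseteq> H" "finite H" "derived_closed_above (d - k) H" by blast
    show ?case
    proof (cases "k < d")
      case True
      then have "d - k = Suc (d - Suc k)" by simp
      with derived_closed_above_step[of H "d - Suc k"] H show ?thesis
        by (metis subset_trans)
    qed (use H in auto)
  qed
  from this[OF refl, of "Suc (Max (insert 0 (degree ` F)))"] show ?thesis by simp
qed

section \<open>The Cohen-Hoermander induction\<close>

text \<open>The induction invariant. Every matched pair must come from a member \<open>g\<close> of
  \<open>E\<close> with surviving leading coefficient, because pseudo-division by this
  \<open>g\<close> gives the sign of later polynomials at the pair. Polynomials with image 0 are
  exempt from the root clauses, since every point is a root of them.\<close>

definition sign_matching ::
    "('b::comm_ring_1 \<Rightarrow> 'l::real_closed) \<Rightarrow> ('b \<Rightarrow> 'm::real_closed) \<Rightarrow> 'b poly set \<Rightarrow> ('l \<times> 'm) set \<Rightarrow> bool" where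
  "sign_matching \<phi> \<psi> E D \<longleftrightarrow> finite D \<and> order_matching D \<and>
    (\<forall>z w. (z, w) \<in> D \<longrightarrow> (\<exists>g\<in>E. 0 < degree g \<and> \<phi> (lead_coeff g) \<noteq> 0 \<and>
      poly (map_poly \<phi> g) z = 0 \<and> poly (map_poly \<psi> g) w = 0)) \<and>
    (\<forall>f\<in>E. map_poly \<phi> f \<noteq> 0 \<longrightarrow> (\<forall>c. poly (map_poly \<phi> f) c = 0 \<longrightarrow> c \<in> fst ` D)) \<and>
    (\<forall>f\<in>E. map_poly \<psi> f \<noteq> 0 \<longrightarrow> (\<forall>c. poly (map_poly \<psi> f) c = 0 \<longrightarrow> c \<in> snd ` D)) \<and>
    (\<forall>t s. same_cell D t s \<longrightarrow> (\<forall>f\<in>E. sg (poly (map_poly \<phi> f) t) = sg (poly (map_poly \<psi> f) s)))"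

text \<open>
  The Cohen--Hoermander argument. The members of \<open>E\<close> are added in order of increasing degree; the
  sign of a new polynomial at an old root is the sign of a pseudo-remainder, which is already known.
\<close>

lemma derived_closed_matching:
  fixes \<phi> :: "'b::comm_ring_1 \<Rightarrow> 'l::real_closed" and \<psi> :: "'b \<Rightarrow> 'm::real_closed"
  assumes "cring_hom \<phi>" "cring_hom \<psi>" "finite H" "derived_closed_above 0 H"
    and lc: "\<And>f. f \<in> H \<Longrightarrow> sg (\<phi> (lead_coeff f)) = sg (\<psi> (lead_coeff f))"
    and "E \<subseteq> H" "\<And>f h. f \<in> E \<Longrightarrow> h \<in> H \<Longrightarrow> degree h < degree f \<Longrightarrow> h \<in> E"
  shows "\<exists>D. sign_matching \<phi> \<psi> E D"
  using assms(6,7)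
proof (induction "card E" arbitrary: E)
  case 0
  then have "E = {}"
    using assms(3) by (metis card_eq_0_iff finite_subset)
  then show ?case
    by (intro exI[of _ "{}"]) (simp add: sign_matching_def order_matching_def)
next
  case (Suc n)
  interpret \<phi>: cring_hom \<phi> by (rule assms(1))
  interpret \<psi>: cring_hom \<psi> by (rule assms(2))
  let ?P = "map_poly \<phi>" and ?Q = "map_poly \<psi>"
  have finE: "finite E" using Suc.prems(1) assms(3) by (rule finite_subset)
  have "E \<noteq> {}" using Suc.hyps(2) by auto
  have "\<exists>f\<in>E. degree f = Max (degree ` E)"
    using Max_in[OF finite_imageI[OF finE], of degree] \<open>E \<noteq> {}\<close> by (auto simp: image_iff)
  then obtain f where f: "f \<in> E" "degree f = Max (degree ` E)" by blast
  have fmax: "degree g \<le> degree f" if "g \<in> E" for g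
    using finE that by (simp add: f(2))
  \<comment> \<open>Because \<open>f\<close> has maximal degree in \<open>E\<close>, removing it
    leaves a set that still contains all members of \<open>H\<close> of smaller degree than one of
    its elements.\<close>
  define E' where "E' = E - {f}"
  have lowE': "h \<in> E'" if "h \<in> H" "degree h < degree f" for h
    using Suc.prems(2)[OF f(1) that] that by (auto simp: E'_def)
  have fH: "f \<in> H" using f Suc.prems(1) by blast
  have "n = card E'" using Suc.hyps(2) f(1) finE by (simp add: E'_def)
  moreover have "h \<in> E'" if "g \<in> E'" "h \<in> H" "degree h < degree g" for g h
    using that fmax[of g] Suc.prems(2)[of g h] lowE'[of h] by (auto simp: E'_def)
  moreover have "E' \<subseteq> H" using Suc.prems(1) by (auto simp: E'_def)
  ultimately obtain D where IH: "sign_matching \<phi> \<psi> E' D"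
    using Suc.hyps(1)[of E'] by blast
  have D: "finite D" "order_matching D"
    "\<And>z w. (z, w) \<in> D \<Longrightarrow> \<exists>g\<in>E'. 0 < degree g \<and> \<phi> (lead_coeff g) \<noteq> 0 \<and>
        poly (?P g) z = 0 \<and> poly (?Q g) w = 0"
    "\<And>f c. f \<in> E' \<Longrightarrow> ?P f \<noteq> 0 \<Longrightarrow> poly (?P f) c = 0 \<Longrightarrow> c \<in> fst ` D"
    "\<And>f c. f \<in> E' \<Longrightarrow> ?Q f \<noteq> 0 \<Longrightarrow> poly (?Q f) c = 0 \<Longrightarrow> c \<in> snd ` D"
    "\<And>t s f. same_cell D t s \<Longrightarrow> f \<in> E' \<Longrightarrow> sg (poly (?P f) t) = sg (poly (?Q f) s)"
    using IH unfolding sign_matching_def by blast+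
  have E: "E = insert f E'" using f(1) by (auto simp: E'_def)
  \<comment> \<open>The part of the invariant that concerns \<open>E'\<close> survives any
    enlargement of \<open>D\<close>; each case below only has to treat \<open>f\<close>.\<close>
  have keep: "sign_matching \<phi> \<psi> E D'"
    if "finite D'" "order_matching D'" "D \<subseteq> D'"
      "\<And>z w. (z, w) \<in> D' - D \<Longrightarrow> 0 < degree f \<and> \<phi> (lead_coeff f) \<noteq> 0 \<and>
        poly (?P f) z = 0 \<and> poly (?Q f) w = 0"
      "\<And>c. ?P f \<noteq> 0 \<Longrightarrow> poly (?P f) c = 0 \<Longrightarrow> c \<in> fst ` D'"
      "\<And>c. ?Q f \<noteq> 0 \<Longrightarrow> poly (?Q f) c = 0 \<Longrightarrow> c \<in> snd ` D'"
      "\<And>t s. same_cell D' t s \<Longrightarrow> sg (poly (?P f) t) = sg (poly (?Q f) s)" for D'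
    unfolding sign_matching_def
  proof (intro conjI allI impI ballI)
    fix z w assume zw: "(z, w) \<in> D'"
    show "\<exists>g\<in>E. 0 < degree g \<and> \<phi> (lead_coeff g) \<noteq> 0 \<and> poly (?P g) z = 0 \<and> poly (?Q g) w = 0"
    proof (cases "(z, w) \<in> D")
      case True
      then show ?thesis using D(3) unfolding E by blast
    next
      case False
      then show ?thesis using that(4)[of z w] zw unfolding E by blast
    qed
  next
    fix g c assume "g \<in> E" "?P g \<noteq> 0" "poly (?P g) c = 0"
    then show "c \<in> fst ` D'"
      using D(4)[of g c] that(3) that(5)[of c] image_mono[OF that(3), of fst] unfolding E by blast
  next
    fix g c assume "g \<in> E" "?Q g \<noteq> 0" "poly (?Q g) c = 0"
    then show "c \<in> snd ` D'"
      using D(5)[of g c] that(3) that(6)[of c] image_mono[OF that(3), of snd] unfolding E by blast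
  next
    fix t s g assume "same_cell D' t s" "g \<in> E"
    then show "sg (poly (?P g) t) = sg (poly (?Q g) s)"
      using D(6)[of t s g] same_cell_mono[of D' t s D] that(3) that(7)[of t s] unfolding E by blast
  qed (use that in auto)
  have sglc: "sg (\<phi> (lead_coeff f)) = sg (\<psi> (lead_coeff f))"
    using lc fH by blast
  then have lc0: "\<phi> (lead_coeff f) = 0 \<longleftrightarrow> \<psi> (lead_coeff f) = 0"
    by (metis sg_eq_0_iff)
  consider (const) "degree f = 0" | (drop) "0 < degree f" "\<phi> (lead_coeff f) = 0"
    | (main) "0 < degree f" "\<phi> (lead_coeff f) \<noteq> 0"
    by blast
  then show ?case
  proof cases
    case const
    then obtain c where "f = [:c:]" by (metis degree_0_id)
    then have "?P f = [:\<phi> c:]" "?Q f = [:\<psi> c:]" "sg (\<phi> c) = sg (\<psi> c)"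
      using sglc by (simp_all add: map_poly_pCons)
    then show ?thesis using D(1,2) by (intro exI[of _ D] keep) auto
  next
    case drop
    \<comment> \<open>The leading coefficient vanishes under both homomorphisms, so \<open>f\<close>
      acts like its truncation, which has smaller degree and is already treated.\<close>
    have "?P f = ?P (truncate_poly f)" "?Q f = ?Q (truncate_poly f)"
      using drop lc0
      by (simp_all add: truncate_poly_def \<phi>.map_poly_hom_diff \<psi>.map_poly_hom_diff map_poly_monom)
    moreover have "truncate_poly f \<in> E'"
      using assms(4) fH drop(1) degree_truncate_poly[of f]
      by (intro lowE') (auto simp: derived_closed_above_def)
    ultimately show ?thesis
      using D(1,2,4,5,6) by (intro exI[of _ D] keep) auto
  next
    case main
    have degP: "degree (?P f) = degree f" and lcP: "lead_coeff (?P f) = \<phi> (lead_coeff f)"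
      and degQ: "degree (?Q f) = degree f" and lcQ: "lead_coeff (?Q f) = \<psi> (lead_coeff f)"
      using main(2) lc0 \<phi>.degree_map_poly_hom[of f] \<psi>.degree_map_poly_hom[of f]
      by (simp_all add: coeff_map_poly)
    have P0: "?P f \<noteq> 0" using degP main(1) by auto
    have fd: "formal_deriv f \<in> E'"
      using assms(4) fH main(1) degree_formal_deriv[of f]
      by (intro lowE') (auto simp: derived_closed_above_def)
    have dP: "pderiv (?P f) = ?P (formal_deriv f)" and dQ: "pderiv (?Q f) = ?Q (formal_deriv f)"
      using assms(1,2) by (simp_all add: map_poly_formal_deriv)
    \<comment> \<open>In characteristic 0 the derivatives are nonzero, so the root clauses for
      \<open>formal_deriv f\<close> apply and all their roots are already matched.\<close>
    have d0: "pderiv (?P f) \<noteq> 0" "pderiv (?Q f) \<noteq> 0"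
      using main(1) degP degQ by (simp_all add: pderiv_eq_0_iff)
    have sgD: "sg (poly (?P f) z) = sg (poly (?Q f) w)" if zw: "(z, w) \<in> D" for z w
    proof -
      obtain g where g: "g \<in> E'" "0 < degree g" "\<phi> (lead_coeff g) \<noteq> 0"
        "poly (?P g) z = 0" "poly (?Q g) w = 0"
        using D(3)[OF zw] by blast
      have gH: "g \<in> H" using g(1) \<open>E' \<subseteq> H\<close> by blast
      have "degree g \<le> degree f" using fmax g(1) by (auto simp: E'_def)
      then have "pseudo_rem f g \<in> E'"
        using assms(4) fH gH g(2) degree_pseudo_rem[of g f]
        by (intro lowE') (auto simp: derived_closed_above_def)
      then have rem: "sg (poly (?P (pseudo_rem f g)) z) = sg (poly (?Q (pseudo_rem f g)) w)"
        using D(6) order_matching_same_cell[OF D(2) zw] by blast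
      obtain m q where eq: "smult (lead_coeff g ^ m) f = g * q + pseudo_rem f g"
        using pseudo_rem_eq[OF g(2)] by blast
      have "smult (\<phi> (lead_coeff g) ^ m) (?P f) = ?P g * ?P q + ?P (pseudo_rem f g)"
        using arg_cong[OF eq, of ?P]
        by (simp add: \<phi>.map_poly_hom_add \<phi>.map_poly_hom_mult \<phi>.map_poly_hom_smult \<phi>.hom_power)
      from arg_cong[OF this, of "\<lambda>p. sg (poly p z)"]
      have 1: "sg (\<phi> (lead_coeff g)) ^ m * sg (poly (?P f) z) = sg (poly (?P (pseudo_rem f g)) z)"
        using g(4) by (simp add: sg_mult sg_power)
      have "smult (\<psi> (lead_coeff g) ^ m) (?Q f) = ?Q g * ?Q q + ?Q (pseudo_rem f g)"
        using arg_cong[OF eq, of ?Q]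
        by (simp add: \<psi>.map_poly_hom_add \<psi>.map_poly_hom_mult \<psi>.map_poly_hom_smult \<psi>.hom_power)
      from arg_cong[OF this, of "\<lambda>p. sg (poly p w)"]
      have 2: "sg (\<psi> (lead_coeff g)) ^ m * sg (poly (?Q f) w) = sg (poly (?Q (pseudo_rem f g)) w)"
        using g(5) by (simp add: sg_mult sg_power)
      \<comment> \<open>The leading coefficient of \<open>g\<close> has the same nonzero sign in
        both fields, so its power cancels.\<close>
      have "sg (\<phi> (lead_coeff g)) ^ m \<noteq> 0"
        using g(3) by simp
      with 1 2 rem lc[OF gH] show ?thesis
        by (metis mult_cancel_left)
    qed
    have lcPQ: "sg (lead_coeff (?P f)) = sg (lead_coeff (?Q f))"
      using sglc by (simp only: lcP lcQ)
    obtain D' where D': "D \<subseteq> D'" "finite D'" "order_matching D'"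
      "\<And>z w. (z, w) \<in> D' - D \<Longrightarrow> poly (?P f) z = 0 \<and> poly (?Q f) w = 0"
      "\<And>c. poly (?P f) c = 0 \<Longrightarrow> c \<in> fst ` D'" "\<And>c. poly (?Q f) c = 0 \<Longrightarrow> c \<in> snd ` D'"
      "\<And>t s. same_cell D' t s \<Longrightarrow> sg (poly (?P f) t) = sg (poly (?Q f) s)"
    proof (rule matching_add_poly[OF D(1,2) _ lcPQ P0 sgD])
      show "c \<in> fst ` D" if "poly (pderiv (?P f)) c = 0" for c
        using D(4)[OF fd] that d0 by (simp add: dP)
      show "c \<in> snd ` D" if "poly (pderiv (?Q f)) c = 0" for c
        using D(5)[OF fd] that d0 by (simp add: dQ)
    qed (use degP degQ in auto)
    show ?thesis
      using D' main by (intro exI[of _ D'] keep) auto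
  qed
qed

text \<open>\<open>G\<close> consists of the leading coefficients of the derived closure of
  \<open>F\<close> and does not depend on the two homomorphisms. Given equal signs on
  \<open>G\<close>, a matching exists, and any \<open>s\<close> in the cell corresponding to that of
  \<open>t\<close> works.\<close>

theorem one_variable_transfer:
  fixes F :: "'b::comm_ring_1 poly set"
  assumes "finite F"
  shows "\<exists>G. finite G \<and> (\<forall>(\<phi> :: 'b \<Rightarrow> 'l::real_closed) (\<psi> :: 'b \<Rightarrow> 'm::real_closed).
    cring_hom \<phi> \<longrightarrow> cring_hom \<psi> \<longrightarrow> (\<forall>g\<in>G. sg (\<phi> g) = sg (\<psi> g)) \<longrightarrow>
    (\<forall>t. \<exists>s. \<forall>f\<in>F. sg (poly (map_poly \<phi> f) t) = sg (poly (map_poly \<psi> f) s)))"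
proof -
  obtain H where H: "F \<subseteq> H" "finite H" "derived_closed_above 0 H"
    using derived_closure[OF assms] by blast
  show ?thesis
  proof (intro exI[of _ "lead_coeff ` H"] conjI allI impI)
    fix \<phi> :: "'b \<Rightarrow> 'l" and \<psi> :: "'b \<Rightarrow> 'm" and t
    assume hom: "cring_hom \<phi>" "cring_hom \<psi>" and sgn: "\<forall>g\<in>lead_coeff ` H. sg (\<phi> g) = sg (\<psi> g)"
    then obtain D where D: "finite D" "order_matching D"
      "\<forall>t s. same_cell D t s \<longrightarrow> (\<forall>f\<in>H. sg (poly (map_poly \<phi> f) t) = sg (poly (map_poly \<psi> f) s))"
      using derived_closed_matching[OF hom H(2,3), of H] unfolding sign_matching_def by fastforce
    obtain s where "same_cell D t s"
      using same_cell_total[OF D(1,2)] by blast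
    with D(3) H(1) show "\<exists>s. \<forall>f\<in>F. sg (poly (map_poly \<phi> f) t) = sg (poly (map_poly \<psi> f) s)"
      by blast
  qed (use H in simp)
qed

section \<open>Sums of squares and formally real fields\<close>

text \<open>The set of allowed roots is a parameter because subfields of an algebraic closure are
  studied below: there -1 is a square, and only sums of squares taken within the subfield are
  meaningful.\<close>

inductive_set sos_on :: "'a::comm_ring_1 set \<Rightarrow> 'a set" for S where
  sos_on_zero: "0 \<in> sos_on S"
| sos_on_step: "s \<in> sos_on S \<Longrightarrow> a \<in> S \<Longrightarrow> s + a * a \<in> sos_on S"

abbreviation sos :: "'a::comm_ring_1 set" where
  "sos \<equiv> sos_on UNIV"

lemma sos_on_mono: "s \<in> sos_on S \<Longrightarrow> S \<subseteq> T \<Longrightarrow> s \<in> sos_on T"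
  by (induction rule: sos_on.induct) (auto intro: sos_on.intros)

lemma sos_square: "a * a \<in> sos"
  using sos_on_step[OF sos_on_zero, of a UNIV] by simp

lemma sos_one: "1 \<in> sos"
  using sos_square[of 1] by simp

lemma sos_add:
  assumes "t \<in> sos" "s \<in> sos"
  shows "s + t \<in> sos"
  using assms
proof (induction rule: sos_on.induct)
  case (sos_on_step t a)
  then show ?case
    using sos_on.sos_on_step[of "s + t" UNIV a] by (simp add: add.assoc)
qed simp

lemma sos_mult_square:
  assumes "s \<in> sos"
  shows "s * (a * a) \<in> sos"
  using assms
proof (induction rule: sos_on.induct)
  case (sos_on_step s b)
  then show ?case
    using sos_on.sos_on_step[of "s * (a * a)" UNIV "b * a"] by (simp add: algebra_simps)
qed (simp add: sos_on_zero)

lemma sos_mult: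
  assumes "t \<in> sos" "s \<in> sos"
  shows "s * t \<in> sos"
  using assms
proof (induction rule: sos_on.induct)
  case (sos_on_step t a)
  then show ?case
    using sos_add[OF sos_mult_square[of s a], of "s * t"] by (simp add: distrib_left)
qed (simp add: sos_on_zero)

lemma sos_onE_sum:
  assumes "s \<in> sos_on S"
  obtains n :: nat and f where "s = (\<Sum>i<n. f i * f i)" "\<And>i. i < n \<Longrightarrow> f i \<in> S"
proof -
  from assms have "\<exists>(n::nat) f. s = (\<Sum>i<n. f i * f i) \<and> (\<forall>i<n. f i \<in> S)"
  proof (induction rule: sos_on.induct)
    case sos_on_zero
    show ?case by (intro exI[of _ 0]) simp
  next
    case (sos_on_step s a)
    then obtain n :: nat and f where "s = (\<Sum>i<n. f i * f i)" "\<forall>i<n. f i \<in> S" by blast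
    then have "s + a * a = (\<Sum>i<Suc n. (f(n := a)) i * (f(n := a)) i) \<and> (\<forall>i<Suc n. (f(n := a)) i \<in> S)"
      using sos_on_step(2) by (auto simp: less_Suc_eq)
    then show ?case by blast
  qed
  then show thesis using that by blast
qed

lemma (in cring_hom) hom_sos: "s \<in> sos_on S \<Longrightarrow> h s \<in> sos_on (h ` S)"
  by (induction rule: sos_on.induct) (auto simp: hom_add hom_mult intro: sos_on.intros)

class formally_real = idom +
  assumes sum_squares_eq_0: "(\<Sum>i<n. f i * f i) = 0 \<Longrightarrow> i < (n::nat) \<Longrightarrow> f i = 0"

lemma square_plus_sos_eq_0:
  fixes a :: "'a::formally_real"
  assumes "s \<in> sos" "s + a * a = 0"
  shows "a = 0"
proof -
  obtain n f where f: "s = (\<Sum>i<n::nat. f i * f i)"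
    using sos_onE_sum[OF assms(1)] by metis
  have "(\<Sum>i<Suc n. (f(n := a)) i * (f(n := a)) i) = 0"
    using assms(2) f by simp
  from sum_squares_eq_0[OF this, of n] show ?thesis by simp
qed

lemma formally_realI:
  assumes "\<And>s a :: 'a::idom. s \<in> sos \<Longrightarrow> s + a * a = 0 \<Longrightarrow> a = 0"
  shows "OFCLASS('a, formally_real_class)"
proof
  fix n i :: nat and f :: "nat \<Rightarrow> 'a"
  assume sum: "(\<Sum>i<n. f i * f i) = 0" and "i < n"
  have "(\<Sum>j\<in>A. f j * f j) \<in> sos" if "finite A" for A
    using that by induction (auto intro: sos_on_zero sos_add sos_square)
  moreover have "(\<Sum>j\<in>{..<n} - {i}. f j * f j) + f i * f i = 0"
    using sum sum.remove[of "{..<n}" i "\<lambda>j. f j * f j"] \<open>i < n\<close> by (simp add: add.commute)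
  ultimately show "f i = 0" using assms by blast
qed


section \<open>A real closure of a formally real field\<close>

definition real_subfield :: "'a::field set \<Rightarrow> bool" where
  "real_subfield S \<longleftrightarrow> 1 \<in> S \<and> (\<forall>x\<in>S. \<forall>y\<in>S. x - y \<in> S \<and> x * y \<in> S) \<and> (\<forall>x\<in>S. inverse x \<in> S) \<and>
    (\<forall>s\<in>sos_on S. 1 + s \<noteq> 0)"

lemma real_subfieldD:
  assumes "real_subfield S"
  shows "1 \<in> S" "x \<in> S \<Longrightarrow> y \<in> S \<Longrightarrow> x - y \<in> S" "x \<in> S \<Longrightarrow> y \<in> S \<Longrightarrow> x * y \<in> S"
    "x \<in> S \<Longrightarrow> inverse x \<in> S" "s \<in> sos_on S \<Longrightarrow> 1 + s \<noteq> 0"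
    "0 \<in> S" "x \<in> S \<Longrightarrow> - x \<in> S" "x \<in> S \<Longrightarrow> y \<in> S \<Longrightarrow> x + y \<in> S"
proof -
  show *: "1 \<in> S" "x \<in> S \<Longrightarrow> y \<in> S \<Longrightarrow> x - y \<in> S" "x \<in> S \<Longrightarrow> y \<in> S \<Longrightarrow> x * y \<in> S"
    "x \<in> S \<Longrightarrow> inverse x \<in> S" "s \<in> sos_on S \<Longrightarrow> 1 + s \<noteq> 0" for x y s
    using assms by (auto simp: real_subfield_def)
  show z: "0 \<in> S" using *(2)[OF *(1) *(1)] by simp
  show m: "x \<in> S \<Longrightarrow> - x \<in> S" for x using *(2)[OF z] by simp
  show "x \<in> S \<Longrightarrow> y \<in> S \<Longrightarrow> x + y \<in> S" using *(2)[of x "- y"] m[of y] by simp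
qed

text \<open>A sum of squares involves finitely many elements, which lie in one member of the chain.
  So the union in Zorn's lemma stays formally real.\<close>

lemma sos_on_chain_Union:
  assumes "s \<in> sos_on (\<Union>C)" "C \<noteq> {}" "\<And>A B. A \<in> C \<Longrightarrow> B \<in> C \<Longrightarrow> A \<subseteq> B \<or> B \<subseteq> A"
  shows "\<exists>A\<in>C. s \<in> sos_on A"
  using assms(1)
proof (induction rule: sos_on.induct)
  case sos_on_zero
  then show ?case using assms(2) by (auto intro: sos_on.intros)
next
  case (sos_on_step s a)
  then obtain A B where AB: "A \<in> C" "s \<in> sos_on A" "B \<in> C" "a \<in> B" by blast
  show ?case
  proof (cases "A \<subseteq> B")
    case True
    then show ?thesis using AB by (auto intro: sos_on.intros sos_on_mono)
  next
    case False
    then have "a \<in> A" using assms(3)[of A B] AB by blast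
    then show ?thesis using AB by (auto intro: sos_on.intros)
  qed
qed

lemma real_subfield_range_to_ac: "real_subfield (range (to_ac :: 'a::{field,formally_real} \<Rightarrow> _))"
  unfolding real_subfield_def
proof (intro conjI ballI)
  fix s assume "s \<in> sos_on (range (to_ac :: 'a \<Rightarrow> _))"
  then have "\<exists>t\<in>sos. s = to_ac (t :: 'a)"
  proof (induction rule: sos_on.induct)
    case sos_on_zero
    then show ?case using sos_on.sos_on_zero by (metis to_ac_0)
  next
    case (sos_on_step s a)
    then obtain t b where "t \<in> sos" "s = to_ac (t :: 'a)" "a = to_ac b" by auto
    then have "t + b * b \<in> sos" "s + a * a = to_ac (t + b * b)" by (auto intro: sos_on.intros)
    then show ?case by blast
  qed
  then obtain t where t: "t \<in> sos" "s = to_ac (t :: 'a)" by blast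
  have "t + 1 * 1 \<noteq> 0" using square_plus_sos_eq_0[OF t(1), of 1] by auto
  then have "1 + t \<noteq> 0" by (simp add: add.commute)
  then have "to_ac (1 + t) \<noteq> 0" unfolding to_ac_eq_0_iff .
  then show "1 + s \<noteq> 0" by (simp add: t)
next
  show "1 \<in> range (to_ac :: 'a \<Rightarrow> _)" using to_ac_1 by (metis rangeI)
next
  fix x y assume "x \<in> range (to_ac :: 'a \<Rightarrow> _)" "y \<in> range (to_ac :: 'a \<Rightarrow> _)"
  then show "x - y \<in> range (to_ac :: 'a \<Rightarrow> _)" "x * y \<in> range (to_ac :: 'a \<Rightarrow> _)"
    by (auto simp flip: to_ac_diff to_ac_mult)
next
  fix x assume "x \<in> range (to_ac :: 'a \<Rightarrow> _)"
  then show "inverse x \<in> range (to_ac :: 'a \<Rightarrow> _)"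
    by (auto simp flip: to_ac_inverse)
qed

lemma maximal_real_subfield_exists:
  "\<exists>L. real_subfield L \<and> range (to_ac :: 'a::{field,formally_real} \<Rightarrow> _) \<subseteq> L \<and>
    (\<forall>M. real_subfield M \<longrightarrow> L \<subseteq> M \<longrightarrow> M = L)"
proof -
  let ?A = "{L. real_subfield L \<and> range (to_ac :: 'a \<Rightarrow> _) \<subseteq> L}"
  have "\<exists>M\<in>?A. \<forall>N\<in>?A. M \<subseteq> N \<longrightarrow> N = M"
  proof (rule subset_Zorn_nonempty)
    show "?A \<noteq> {}" using real_subfield_range_to_ac by blast
    fix C assume C: "C \<noteq> {}" "subset.chain ?A C"
    have chain: "A \<subseteq> B \<or> B \<subseteq> A" if "A \<in> C" "B \<in> C" for A B
      using C(2) that by (auto simp: subset_chain_def)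
    have CA: "real_subfield A" "range to_ac \<subseteq> A" if "A \<in> C" for A
      using C(2) that by (auto simp: subset_chain_def)
    obtain A0 where A0: "A0 \<in> C" using C(1) by blast
    have "real_subfield (\<Union>C)"
      unfolding real_subfield_def
    proof (intro conjI ballI)
      fix s assume "s \<in> sos_on (\<Union>C)"
      from sos_on_chain_Union[OF this C(1) chain] obtain A where A: "A \<in> C" "s \<in> sos_on A"
        by blast
      from real_subfieldD(5)[OF CA(1)[OF A(1)] A(2)] show "1 + s \<noteq> 0" .
    next
      from real_subfieldD(1)[OF CA(1)[OF A0]] show "1 \<in> \<Union>C" using A0 by blast
    next
      fix x y assume "x \<in> \<Union>C" "y \<in> \<Union>C"
      then obtain A B where AB: "A \<in> C" "x \<in> A" "B \<in> C" "y \<in> B" by blast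
      then have "\<exists>A\<in>C. x \<in> A \<and> y \<in> A"
        using chain[of A B] by blast
      then obtain A where A: "A \<in> C" "x \<in> A" "y \<in> A" by blast
      show "x - y \<in> \<Union>C" "x * y \<in> \<Union>C"
        using real_subfieldD(2,3)[OF CA(1)[OF A(1)] A(2,3)] A(1) by blast+
    next
      fix x assume "x \<in> \<Union>C"
      then obtain A where A: "A \<in> C" "x \<in> A" by blast
      show "inverse x \<in> \<Union>C"
        using real_subfieldD(4)[OF CA(1)[OF A(1)] A(2)] A(1) by blast
    qed
    moreover have "range to_ac \<subseteq> \<Union>C"
      using CA(2)[OF A0] A0 by blast
    ultimately show "\<Union>C \<in> ?A" by simp
  qed
  then obtain M where M: "real_subfield M" "range (to_ac :: 'a \<Rightarrow> _) \<subseteq> M"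
    "\<And>N. real_subfield N \<Longrightarrow> range to_ac \<subseteq> N \<Longrightarrow> M \<subseteq> N \<Longrightarrow> N = M" by auto
  then show ?thesis
    by (intro exI[of _ M]) auto
qed

definition rclos_set :: "'a::{field,formally_real} alg_closure set" where
  "rclos_set = (SOME L. real_subfield L \<and> range (to_ac :: 'a \<Rightarrow> _) \<subseteq> L \<and>
    (\<forall>M. real_subfield M \<longrightarrow> L \<subseteq> M \<longrightarrow> M = L))"

lemma real_subfield_rclos_set: "real_subfield rclos_set"
  and to_ac_in_rclos_set: "to_ac x \<in> rclos_set"
  and rclos_set_maximal: "real_subfield M \<Longrightarrow> rclos_set \<subseteq> M \<Longrightarrow> M = rclos_set"
  using someI_ex[OF maximal_real_subfield_exists] unfolding rclos_set_def[symmetric] by auto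

typedef (overloaded) 'a rclos = "rclos_set :: 'a::{field,formally_real} alg_closure set"
  using to_ac_in_rclos_set by blast

setup_lifting type_definition_rclos

instantiation rclos :: ("{field,formally_real}") field
begin

lift_definition zero_rclos :: "'a rclos" is 0
  by (rule real_subfieldD(6)[OF real_subfield_rclos_set])

lift_definition one_rclos :: "'a rclos" is 1
  by (rule real_subfieldD(1)[OF real_subfield_rclos_set])

lift_definition uminus_rclos :: "'a rclos \<Rightarrow> 'a rclos" is uminus
  by (rule real_subfieldD(7)[OF real_subfield_rclos_set])

lift_definition plus_rclos :: "'a rclos \<Rightarrow> 'a rclos \<Rightarrow> 'a rclos" is "(+)"
  by (rule real_subfieldD(8)[OF real_subfield_rclos_set])

lift_definition minus_rclos :: "'a rclos \<Rightarrow> 'a rclos \<Rightarrow> 'a rclos" is "(-)"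
  by (rule real_subfieldD(2)[OF real_subfield_rclos_set])

lift_definition times_rclos :: "'a rclos \<Rightarrow> 'a rclos \<Rightarrow> 'a rclos" is "(*)"
  by (rule real_subfieldD(3)[OF real_subfield_rclos_set])

lift_definition inverse_rclos :: "'a rclos \<Rightarrow> 'a rclos" is inverse
  by (rule real_subfieldD(4)[OF real_subfield_rclos_set])

definition divide_rclos :: "'a rclos \<Rightarrow> 'a rclos \<Rightarrow> 'a rclos" where
  "divide_rclos x y = x * inverse y"

instance
proof
  fix a b c :: "'a rclos"
  show "a * b * c = a * (b * c)" "a * b = b * a" "a + b + c = a + (b + c)" "a + b = b + a"
    "(a + b) * c = a * c + b * c"
    by (transfer, simp add: algebra_simps)+
  show "1 * a = a" "0 + a = a" "- a + a = 0" "a - b = a + - b" "(0 :: 'a rclos) \<noteq> 1"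
    "inverse (0 :: 'a rclos) = 0"
    by (transfer, simp)+
  show "a \<noteq> 0 \<Longrightarrow> inverse a * a = 1"
    by transfer simp
  show "a div b = a * inverse b"
    by (rule divide_rclos_def)
qed

end

lemma cring_hom_Rep_rclos: "cring_hom Rep_rclos"
  by standard (simp_all add: plus_rclos.rep_eq times_rclos.rep_eq one_rclos.rep_eq)

interpretation Rep_rclos: cring_hom Rep_rclos
  by (rule cring_hom_Rep_rclos)

lemma Rep_rclos_eq_0_iff: "Rep_rclos x = 0 \<longleftrightarrow> x = 0"
  by (simp flip: Rep_rclos_inject)

lemma range_Rep_rclos: "range Rep_rclos = rclos_set"
  by (rule type_definition.Rep_range[OF type_definition_rclos])

definition to_rclos :: "'a::{field,formally_real} \<Rightarrow> 'a rclos" where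
  "to_rclos x = Abs_rclos (to_ac x)"

lemma Rep_to_rclos: "Rep_rclos (to_rclos x) = to_ac x"
  by (simp add: to_rclos_def Abs_rclos_inverse to_ac_in_rclos_set)

lemma to_rclos_eq_0_iff: "to_rclos x = 0 \<longleftrightarrow> x = 0"
  by (simp flip: Rep_rclos_eq_0_iff add: Rep_to_rclos)

lemma cring_hom_to_rclos: "cring_hom to_rclos"
proof
  show "to_rclos (x + y) = to_rclos x + to_rclos y" for x y :: 'a
    by (simp flip: Rep_rclos_inject add: Rep_rclos.hom_add Rep_to_rclos)
  show "to_rclos (x * y) = to_rclos x * to_rclos y" for x y :: 'a
    by (simp flip: Rep_rclos_inject add: Rep_rclos.hom_mult Rep_to_rclos)
  show "to_rclos (1 :: 'a) = 1"
    by (simp flip: Rep_rclos_inject add: Rep_to_rclos)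
qed

lemma one_plus_sos_rclos: "1 + s \<noteq> 0" if "s \<in> sos" for s :: "'a::{field,formally_real} rclos"
proof
  assume "1 + s = 0"
  then have "1 + Rep_rclos s = 0"
    by (metis Rep_rclos.hom_add Rep_rclos.hom_one Rep_rclos.hom_zero)
  moreover have "Rep_rclos s \<in> sos_on rclos_set"
    using Rep_rclos.hom_sos[OF that] by (simp add: range_Rep_rclos)
  ultimately show False
    using real_subfieldD(5)[OF real_subfield_rclos_set] by blast
qed

lemma square_plus_sos_rclos:
  fixes a :: "'a::{field,formally_real} rclos"
  assumes "s \<in> sos" "s + a * a = 0"
  shows "a = 0"
proof (rule ccontr)
  assume "a \<noteq> 0"
  have "s * (inverse a * inverse a) \<in> sos"
    by (rule sos_mult_square[OF assms(1)])
  moreover have "1 + s * (inverse a * inverse a) = (s + a * a) * (inverse a * inverse a)"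
    using \<open>a \<noteq> 0\<close> by (simp add: field_simps)
  ultimately show False
    using one_plus_sos_rclos assms(2) by (metis mult_zero_left)
qed

section \<open>Squares and the ordering of the real closure\<close>

lemma rclos_no_real_extension:
  assumes "real_subfield M" "range Rep_rclos \<subseteq> M"
  shows "M = range Rep_rclos"
  using rclos_set_maximal[of M] assms by (simp add: range_Rep_rclos)

text \<open>Adjoining a square root of a non-square \<open>a\<close> makes the field non-real, which exhibits \<open>- a\<close> as a sum of squares.\<close>

lemma rclos_nonsquare:
  fixes a :: "'a::{field,formally_real} rclos"
  assumes nsq: "\<nexists>b. a = b * b"
  shows "- a \<in> sos"
proof -
  let ?R = "Rep_rclos :: 'a rclos \<Rightarrow> _"
  obtain r where "r ^ 2 = ?R a"
    using nth_root_exists[of 2 "?R a"] by auto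
  then have r: "r * r = ?R a" by (simp add: power2_eq_square)
  have r_notin: "r \<noteq> ?R b" for b
  proof
    assume "r = ?R b"
    then have "?R a = ?R (b * b)" using r by (simp add: Rep_rclos.hom_mult)
    then have "a = b * b" unfolding Rep_rclos_inject .
    then show False using nsq by blast
  qed
  \<comment> \<open>The elements of the quadratic extension by \<open>r\<close> in coordinates
    \<open>u\<close>, \<open>v\<close>; \<open>M\<close> is this extension.\<close>
  define f where "f u v = ?R u + ?R v * r" for u v
  define M where "M = {f u v | u v. True}"
  have fM: "f u v \<in> M" for u v by (auto simp: M_def)
  have RM: "range ?R \<subseteq> M"
    using fM[of _ 0] by (auto simp: f_def)
  have f_diff: "f u v - f u' v' = f (u - u') (v - v')" for u v u' v'
    by (simp add: f_def Rep_rclos.hom_diff algebra_simps)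
  have f_add: "f u v + f u' v' = f (u + u') (v + v')" for u v u' v'
    by (simp add: f_def Rep_rclos.hom_add algebra_simps)
  have f_mult: "f u v * f u' v' = f (u * u' + a * (v * v')) (u * v' + v * u')" for u v u' v'
  proof -
    have "f u v * f u' v' = ?R u * ?R u' + ?R v * ?R v' * (r * r) + (?R u * ?R v' + ?R v * ?R u') * r"
      by (simp add: f_def algebra_simps)
    then show ?thesis
      by (simp add: r f_def Rep_rclos.hom_add Rep_rclos.hom_mult algebra_simps)
  qed
  have f_eq_0: "u = 0 \<and> v = 0" if "f u v = 0" for u v
  proof (cases "v = 0")
    case True
    then show ?thesis using that by (simp add: f_def Rep_rclos_eq_0_iff)
  next
    case False
    have "?R v * ?R (inverse v) = 1"
      using False by (metis Rep_rclos.hom_mult Rep_rclos.hom_one right_inverse)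
    have "r = ?R v * ?R (inverse v) * r"
      using \<open>?R v * ?R (inverse v) = 1\<close> by simp
    also have "\<dots> = ?R (inverse v) * (f u v - ?R u)"
      by (simp add: f_def)
    also have "\<dots> = ?R (- (inverse v * u))"
      using that by (simp add: Rep_rclos.hom_mult Rep_rclos.hom_uminus)
    finally show ?thesis using r_notin by blast
  qed
  have inv: "inverse x \<in> M" if "x \<in> M" for x
  proof (cases "x = 0")
    case True
    then show ?thesis using fM[of 0 0] by (simp add: f_def)
  next
    case False
    obtain u v where x: "x = f u v" using \<open>x \<in> M\<close> by (auto simp: M_def)
    \<comment> \<open>The norm of \<open>f u v\<close>. It is nonzero because \<open>a\<close> is
      not a square, and the conjugate divided by it is the inverse.\<close>
    define d where "d = u * u - a * (v * v)"
    have "d \<noteq> 0"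
    proof
      assume "d = 0"
      then have uv: "u * u = a * (v * v)" by (simp add: d_def)
      show False
      proof (cases "v = 0")
        case True
        then show False using uv x False by (simp add: f_def)
      next
        case False
        then have "a = (u / v) * (u / v)" using uv by (simp add: field_simps)
        then show False using nsq by blast
      qed
    qed
    have "x * f (u * inverse d) (- v * inverse d) = f (d * inverse d) 0"
      unfolding x f_mult by (simp add: d_def algebra_simps)
    also have "\<dots> = 1" using \<open>d \<noteq> 0\<close> by (simp add: f_def)
    finally have "inverse x = f (u * inverse d) (- v * inverse d)"
      by (rule inverse_unique)
    then show ?thesis using fM by simp
  qed
  have "M \<noteq> range ?R"
  proof
    assume "M = range ?R"
    then have "f 0 1 \<in> range ?R" using fM by blast
    then show False using r_notin by (auto simp: f_def)
  qed
  then have "\<not> real_subfield M"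
    using rclos_no_real_extension[OF _ RM] by blast
  moreover have "1 \<in> M" using fM[of 1 0] by (simp add: f_def)
  moreover have "x - y \<in> M \<and> x * y \<in> M" if "x \<in> M" "y \<in> M" for x y
  proof -
    obtain u v u' v' where "x = f u v" "y = f u' v'" using \<open>x \<in> M\<close> \<open>y \<in> M\<close> by (auto simp: M_def)
    then show ?thesis using fM by (simp add: f_diff f_mult)
  qed
  ultimately obtain s where s: "s \<in> sos_on M" "1 + s = 0"
    using inv by (auto simp: real_subfield_def)
  \<comment> \<open>The first coordinate of the square of \<open>f u v\<close> is
    \<open>u * u + a * (v * v)\<close>, so a sum of squares has a first coordinate of the form
    \<open>U + a * V\<close>.\<close>
  from s(1) have "\<exists>U V W. U \<in> sos \<and> V \<in> sos \<and> s = f (U + a * V) W"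
  proof (induction rule: sos_on.induct)
    case sos_on_zero
    then show ?case
      using sos_on.sos_on_zero by (intro exI[of _ 0]) (simp add: f_def sos_on.sos_on_zero)
  next
    case (sos_on_step s x)
    then obtain U V W where UV: "U \<in> sos" "V \<in> sos" "s = f (U + a * V) W" by blast
    obtain u v where x: "x = f u v" using sos_on_step(2) by (auto simp: M_def)
    have "s + x * x = f ((U + u * u) + a * (V + v * v)) (W + (u * v + v * u))"
      unfolding UV(3) x f_mult f_add by (simp add: algebra_simps)
    moreover have "U + u * u \<in> sos" "V + v * v \<in> sos"
      using UV by (auto intro: sos_on.intros)
    ultimately show ?case by blast
  qed
  then obtain U V W where UV: "U \<in> sos" "V \<in> sos" "s = f (U + a * V) W" by blast
  have "f 1 0 + s = 0" using s(2) by (simp add: f_def)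
  then have "f (1 + (U + a * V)) W = 0" by (simp add: UV(3) f_add)
  then have eq: "1 + (U + a * V) = 0" using f_eq_0 by blast
  have "V \<noteq> 0"
    using eq one_plus_sos_rclos[OF UV(1)] by auto
  have "1 + U = - (a * V)"
    using eq by (simp only: eq_neg_iff_add_eq_0 add.assoc)
  then have "- a * V = 1 + U"
    by simp
  \<comment> \<open>Division by \<open>V\<close> is written as multiplication by \<open>V\<close>
    and by a square, which visibly stays within the sums of squares.\<close>
  then have "- a = (1 + U) * V * (inverse V * inverse V)"
    using \<open>V \<noteq> 0\<close> by (simp add: field_simps)
  moreover have "(1 + U) * V * (inverse V * inverse V) \<in> sos"
    by (intro sos_mult_square sos_mult sos_add sos_one UV)
  ultimately show ?thesis by simp
qed

text \<open>If \<open>q\<close> were no square, then \<open>- q\<close> would be a sum of squares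
  too, and so would -1, the product of \<open>- q\<close>, \<open>q\<close> and the square of
  \<open>inverse q\<close>.\<close>

lemma rclos_sos_square:
  fixes q :: "'a::{field,formally_real} rclos"
  assumes "q \<in> sos"
  shows "\<exists>b. q = b * b"
proof (rule ccontr)
  assume nsq: "\<not> ?thesis"
  then have "q \<noteq> 0" by (metis mult_zero_left)
  have "- q \<in> sos" by (rule rclos_nonsquare) (use nsq in blast)
  then have "- q * q * (inverse q * inverse q) \<in> sos"
    by (intro sos_mult_square sos_mult assms)
  then have "- 1 \<in> (sos :: 'a rclos set)"
    using \<open>q \<noteq> 0\<close> by (simp add: field_simps)
  then show False using one_plus_sos_rclos by fastforce
qed

lemma rclos_square_or_neg:
  fixes a :: "'a::{field,formally_real} rclos"
  shows "(\<exists>b. a = b * b) \<or> (\<exists>b. - a = b * b)"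
  using rclos_nonsquare[of a] rclos_sos_square[of "- a"] by blast

instantiation rclos :: ("{field,formally_real}") linordered_field
begin

text \<open>The squares are the only possible nonnegative cone. \<open>rclos_sos_square\<close>
  makes it closed under addition and \<open>rclos_square_or_neg\<close> makes the order
  total.\<close>

definition less_eq_rclos :: "'a rclos \<Rightarrow> 'a rclos \<Rightarrow> bool" where
  "less_eq_rclos x y \<longleftrightarrow> (\<exists>z. y - x = z * z)"

definition less_rclos :: "'a rclos \<Rightarrow> 'a rclos \<Rightarrow> bool" where
  "less_rclos x y \<longleftrightarrow> x \<le> y \<and> x \<noteq> y"

definition abs_rclos :: "'a rclos \<Rightarrow> 'a rclos" where
  "abs_rclos x = (if x < 0 then - x else x)"

definition sgn_rclos :: "'a rclos \<Rightarrow> 'a rclos" where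
  "sgn_rclos x = (if x = 0 then 0 else if 0 < x then 1 else - 1)"

instance
proof
  fix x y z :: "'a rclos"
  show refl: "x \<le> x" by (simp add: less_eq_rclos_def)
  show antisym: "x = y" if xy: "x \<le> y" "y \<le> x"
  proof -
    obtain u v where uv: "y - x = u * u" "x - y = v * v"
      using xy by (auto simp: less_eq_rclos_def)
    then have "u * u + v * v = 0"
      by (metis add.commute add_uminus_conv_diff diff_add_cancel minus_diff_eq right_minus)
    then have "v = 0" using square_plus_sos_rclos[OF sos_square] by blast
    with uv show "x = y" by simp
  qed
  show "(x < y) = (x \<le> y \<and> \<not> y \<le> x)"
    using refl antisym by (auto simp: less_rclos_def)
  show "x \<le> z" if "x \<le> y" "y \<le> z"
  proof -
    obtain u v where uv: "y - x = u * u" "z - y = v * v"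
      using \<open>x \<le> y\<close> \<open>y \<le> z\<close> by (auto simp: less_eq_rclos_def)
    have "z - x = v * v + u * u" by (simp flip: uv)
    moreover have "v * v + u * u \<in> sos" by (intro sos_add sos_square)
    ultimately show ?thesis using rclos_sos_square by (metis less_eq_rclos_def)
  qed
  show "x \<le> y \<or> y \<le> x"
    using rclos_square_or_neg[of "x - y"] by (auto simp: less_eq_rclos_def)
  show "z + x \<le> z + y" if "x \<le> y"
    using that by (simp add: less_eq_rclos_def)
  show "z * x < z * y" if "x < y" "0 < z"
  proof -
    have "x \<le> y" "x \<noteq> y" "0 \<le> z" "z \<noteq> 0"
      using \<open>x < y\<close> \<open>0 < z\<close> by (auto simp: less_rclos_def)
    then obtain u v where uv: "y - x = u * u" "z = v * v"
      by (auto simp: less_eq_rclos_def)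
    have "z * y - z * x = (v * u) * (v * u)"
      using arg_cong[OF uv(1), of "(*) z"] by (simp add: uv(2) algebra_simps)
    then show ?thesis
      using \<open>x \<noteq> y\<close> \<open>z \<noteq> 0\<close> by (auto simp: less_rclos_def less_eq_rclos_def)
  qed
  show "\<bar>x\<bar> = (if x < 0 then - x else x)" by (rule abs_rclos_def)
  show "sgn x = (if x = 0 then 0 else if 0 < x then 1 else - 1)" by (rule sgn_rclos_def)
qed

end

text \<open>
  The Artin--Schreier argument: if \<open>m\<close> is the minimal polynomial of \<open>\<theta>\<close>, then adjoining \<open>\<theta>\<close>
  yields \<open>1 + S = m h\<close> with \<open>S\<close> a sum of squares and \<open>h\<close> of smaller degree than \<open>m\<close>; so \<open>h\<close>
  changes sign wherever \<open>m\<close> does.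
\<close>

lemma rclos_sign_change_root:
  fixes f :: "'a::{field,formally_real} rclos poly"
  assumes "sg (poly f a) * sg (poly f b) = - 1"
  shows "\<exists>c. poly f c = 0"
  using assms
proof (induction "degree f" arbitrary: f rule: less_induct)
  case less
  let ?R = "Rep_rclos :: 'a rclos \<Rightarrow> _"
  let ?P = "map_poly ?R"
  show ?case
  proof (rule ccontr)
    assume noroot: "\<not> ?case"
    have "f \<noteq> 0" using less.prems by auto
    have "degree f \<noteq> 0"
    proof
      assume "degree f = 0"
      then obtain c where "f = [:c:]" by (metis degree_0_id)
      then have "sg c * sg c = - 1" using less.prems by simp
      then show False by (metis not_square_less_zero neg_less_0_iff_less zero_less_one)
    qed
    moreover have "degree (?P f) = degree f"
      using \<open>f \<noteq> 0\<close> by (intro Rep_rclos.degree_map_poly_hom) (simp add: Rep_rclos_eq_0_iff)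
    ultimately obtain \<theta> where \<theta>: "poly (?P f) \<theta> = 0"
      using alg_closed_imp_poly_has_root[of "?P f"] by auto
    define e where "e g = poly (?P g) \<theta>" for g
    have e_hom: "cring_hom e"
      by standard (simp_all add: e_def Rep_rclos.map_poly_hom_add Rep_rclos.map_poly_hom_mult)
    interpret e: cring_hom e by (rule e_hom)
    have e_const: "e [:c:] = ?R c" for c
      by (simp add: e_def map_poly_pCons)
    obtain m where m: "m \<noteq> 0" "e m = 0" "\<And>g. g \<noteq> 0 \<Longrightarrow> e g = 0 \<Longrightarrow> degree m \<le> degree g"
      using ex_has_least_nat[of "\<lambda>g. g \<noteq> 0 \<and> e g = 0" f degree] \<theta> \<open>f \<noteq> 0\<close> by (auto simp: e_def)
    have m_dvd: "m dvd g" if "e g = 0" for g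
    proof -
      have "g = m * (g div m) + g mod m" by simp
      then have "e (g mod m) = 0"
        using that m(2) by (metis add_0 e.hom_add e.hom_mult mult_zero_left)
      then have "g mod m = 0"
        using m(3)[of "g mod m"] degree_mod_less[OF m(1), of g] by fastforce
      then show ?thesis by (simp add: mod_eq_0_iff_dvd)
    qed
    have deg_m: "degree m > 0"
    proof (rule ccontr)
      assume "\<not> degree m > 0"
      then obtain c where "m = [:c:]" by (metis degree_0_id gr0I)
      then show False using m(1,2) by (simp add: e_const Rep_rclos_eq_0_iff)
    qed
    obtain k where k: "f = m * k" using m_dvd[of f] \<theta> by (auto simp: e_def)
    have deg_f: "degree f = degree m + degree k"
      using \<open>f \<noteq> 0\<close> by (auto simp: k degree_mult_eq)
    have "sg (poly m a) * sg (poly m b) * (sg (poly k a) * sg (poly k b)) = - 1"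
      using less.prems by (simp add: k sg_mult mult_ac)
    then have sgn_mk: "sg (poly m a) * sg (poly m b) = - 1 \<or> sg (poly k a) * sg (poly k b) = - 1"
      by (auto simp: sg_def split: if_splits)
    \<comment> \<open>A sign change of the cofactor \<open>k\<close> would give a root of
      \<open>k\<close>, hence of \<open>f\<close>, by induction. So the sign change belongs to
      \<open>m\<close>.\<close>
    have "sg (poly k a) * sg (poly k b) \<noteq> - 1"
      using less.hyps[of k] deg_f deg_m noroot by (auto simp: k)
    with sgn_mk have sgn_m: "sg (poly m a) * sg (poly m b) = - 1" by blast
    have m_noroot: "poly m c \<noteq> 0" for c
      using noroot by (auto simp: k)
    define M where "M = range e"
    have RM: "range ?R \<subseteq> M"
      by (auto simp: M_def simp flip: e_const)
    \<comment> \<open>Inverses come from the Euclidean algorithm. The remainder \<open>r\<close> of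
      \<open>m\<close> modulo \<open>g\<close> is nonzero by minimality of \<open>m\<close> and has
      smaller degree than \<open>g\<close>; up to sign \<open>e r\<close> is a multiple of
      \<open>e g\<close>, so an inverse of \<open>e r\<close> yields one of
      \<open>e g\<close>.\<close>
    have inv_low: "\<exists>v. e v * e g = 1" if "g \<noteq> 0" "degree g < degree m" for g
      using that
    proof (induction "degree g" arbitrary: g rule: less_induct)
      case less
      show ?case
      proof (cases "degree g = 0")
        case True
        then obtain c where c: "g = [:c:]" by (metis degree_0_id)
        then have "e [:inverse c:] * e g = e [:inverse c * c:]"
          unfolding e.hom_mult[symmetric] by (simp add: mult.commute)
        also have "\<dots> = 1" using less.prems c by (simp add: e_const)
        finally show ?thesis by blast
      next
        case False
        define r where "r = m mod g"
        have eq: "m = g * (m div g) + r" by (simp add: r_def)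
        have r: "r \<noteq> 0"
        proof
          assume "r = 0"
          then have "m = g * (m div g)" using eq by simp
          then have "e g * e (m div g) = 0" using m(2) by (metis e.hom_mult)
          moreover have "e g \<noteq> 0" using m(3)[of g] less.prems by auto
          ultimately have "e (m div g) = 0" by simp
          moreover have "m div g \<noteq> 0" using \<open>m = g * (m div g)\<close> m(1) by auto
          ultimately have "degree m \<le> degree (m div g)" by (rule m(3)[rotated])
          moreover have "degree m = degree g + degree (m div g)"
            using \<open>m = g * (m div g)\<close> m(1) degree_mult_eq[of g "m div g"] by fastforce
          ultimately show False using False by simp
        qed
        have "degree r < degree g"
          using degree_mod_less[OF less.prems(1), of m] r by (simp add: r_def)
        then obtain v where v: "e v * e r = 1"
          using less.hyps[of r] r less.prems(2) by auto
        have "e g * e (m div g) + e r = 0"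
          using eq m(2) by (metis e.hom_add e.hom_mult)
        then have "e r = - (e g * e (m div g))" by (simp add: eq_neg_iff_add_eq_0 add.commute)
        then have "e (- v * (m div g)) * e g = 1"
          using v by (simp add: e.hom_mult e.hom_uminus mult_ac)
        then show ?thesis by blast
      qed
    qed
    have red: "\<exists>g'. e g' = e g \<and> degree g' < degree m" for g
    proof -
      have "g = m * (g div m) + g mod m" by simp
      then have "e g = e (g mod m)"
        using m(2) by (metis add_0 e.hom_add e.hom_mult mult_zero_left)
      moreover have "degree (g mod m) < degree m"
        using degree_mod_less[OF m(1), of g] deg_m by auto
      ultimately show ?thesis by metis
    qed
    have inv: "inverse x \<in> M" if "x \<in> M" for x
    proof (cases "x = 0")
      case True
      then show ?thesis using that by simp
    next
      case False
      obtain g where "x = e g" using \<open>x \<in> M\<close> by (auto simp: M_def)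
      then obtain g where g: "x = e g" "degree g < degree m" using red by metis
      moreover from g have "g \<noteq> 0" using False by auto
      ultimately obtain v where "x * e v = 1" using inv_low by (metis mult.commute)
      then have "inverse x = e v" by (rule inverse_unique)
      then show ?thesis by (simp add: M_def)
    qed
    have "M \<noteq> range ?R"
    proof
      assume "M = range ?R"
      moreover have "e [:0, 1:] = \<theta>" by (simp add: e_def map_poly_pCons)
      ultimately obtain c where "\<theta> = ?R c" by (metis M_def rangeE rangeI)
      then have "?R (poly m c) = 0"
        using m(2) by (simp add: e_def Rep_rclos.poly_map_poly_hom)
      then show False using m_noroot by (simp add: Rep_rclos_eq_0_iff)
    qed
    then have "\<not> real_subfield M"
      using rclos_no_real_extension[OF _ RM] by blast
    moreover have "1 \<in> M" by (metis M_def e.hom_one rangeI)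
    moreover have "x - y \<in> M \<and> x * y \<in> M" if "x \<in> M" "y \<in> M" for x y
      using that by (auto simp: M_def simp flip: e.hom_diff e.hom_mult)
    ultimately obtain s where s: "s \<in> sos_on M" "1 + s = 0"
      using inv by (auto simp: real_subfield_def)
    \<comment> \<open>Each element of \<open>M\<close> has a representative of degree below that of
      \<open>m\<close>, whose square has degree at most \<open>2 * degree m - 2\<close>. This bound
      will force the cofactor \<open>h\<close> to have smaller degree than \<open>m\<close>.\<close>
    from s(1) have "\<exists>S. s = e S \<and> degree S < 2 * degree m - 1 \<and> (\<forall>x. 0 \<le> poly S x)"
    proof (induction rule: sos_on.induct)
      case sos_on_zero
      then show ?case using deg_m by (intro exI[of _ 0]) simp
    next
      case (sos_on_step s y)
      then obtain S where S: "s = e S" "degree S < 2 * degree m - 1" "\<forall>x. 0 \<le> poly S x" by blast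
      obtain g where "y = e g" using sos_on_step(2) by (auto simp: M_def)
      then obtain g where g: "y = e g" "degree g < degree m" using red by metis
      have "degree (g * g) < 2 * degree m - 1"
        using degree_mult_le[of g g] g(2) by linarith
      then have "degree (S + g * g) < 2 * degree m - 1"
        using S(2) by (intro degree_add_less)
      then show ?case
        using S g by (intro exI[of _ "S + g * g"]) (simp add: e.hom_add e.hom_mult)
    qed
    then obtain S where S: "s = e S" "degree S < 2 * degree m - 1" "\<And>x. 0 \<le> poly S x" by blast
    define T where "T = 1 + S"
    have Tpos: "0 < poly T x" for x using S(3)[of x] by (simp add: T_def add_pos_nonneg)
    have "e T = 0" using s(2) by (simp add: T_def e.hom_add S(1))
    then obtain h where h: "T = m * h" using m_dvd by blast
    have "degree T < 2 * degree m - 1"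
      unfolding T_def using S(2) deg_m by (intro degree_add_less) auto
    moreover have "m \<noteq> 0" "h \<noteq> 0" using Tpos[of 0] by (auto simp: h)
    ultimately have "degree h < degree m" by (simp add: h degree_mult_eq)
    have "sg (poly T x) = 1" for x using Tpos by (simp add: sg_eq_1_iff)
    then have "sg (poly m x) * sg (poly h x) = 1" for x
      by (simp add: h sg_mult)
    then have "sg (poly m a) * sg (poly m b) * (sg (poly h a) * sg (poly h b)) = 1"
      by (metis (no_types, lifting) mult.left_commute mult.assoc mult.right_neutral)
    then have "sg (poly h a) * sg (poly h b) = - 1" using sgn_m by simp
    \<comment> \<open>The induction applies because
      \<open>degree h < degree m \<le> degree f\<close>; but at a root of \<open>h\<close> the
      everywhere positive \<open>T\<close> would vanish.\<close>
    then obtain c where "poly h c = 0"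
      using less.hyps[of h] \<open>degree h < degree m\<close> deg_f by auto
    then show False using Tpos[of c] by (simp add: h)
  qed
qed

text \<open>The root \<open>c\<close> given by the sign change may lie outside the interval. Then x
  - c has constant sign on it, so the quotient by this factor, or its negative, still goes from
  negative to positive, and its degree is smaller.\<close>

lemma rclos_neg_pos_root:
  fixes f :: "'a::{field,formally_real} rclos poly"
  assumes "a < b" "poly f a < 0" "0 < poly f b"
  shows "\<exists>c. a < c \<and> c < b \<and> poly f c = 0"
  using assms
proof (induction "degree f" arbitrary: f rule: less_induct)
  case less
  have "sg (poly f a) * sg (poly f b) = - 1"
    using less.prems by (simp add: sg_def)
  then obtain c where c: "poly f c = 0" using rclos_sign_change_root by blast
  then obtain g where g: "f = [:- c, 1:] * g" by (metis dvdE poly_eq_0_iff_dvd)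
  have "f \<noteq> 0" using less.prems by auto
  then have "g \<noteq> 0" by (auto simp: g)
  then have deg: "degree g < degree f" unfolding g by (subst degree_mult_eq) auto
  have fg: "poly f x = (x - c) * poly g x" for x by (simp add: g algebra_simps)
  have "c \<noteq> a" "c \<noteq> b" using c less.prems by auto
  then consider "a < c" "c < b" | "c < a" | "b < c" by (metis linorder_neqE_linordered_idom)
  then show ?case
  proof cases
    case 1
    then show ?thesis using c by blast
  next
    case 2
    have "poly g a < 0" "0 < poly g b"
      using less.prems 2 by (auto simp: fg mult_less_0_iff zero_less_mult_iff)
    then show ?thesis using less.hyps[OF deg less.prems(1)] by (auto simp: fg)
  next
    case 3
    have "poly (- g) a < 0" "0 < poly (- g) b"
      using less.prems 3 by (auto simp: fg mult_less_0_iff zero_less_mult_iff)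
    then show ?thesis using less.hyps[of "- g"] deg less.prems(1) by (auto simp: fg)
  qed
qed

instance rclos :: ("{field,formally_real}") real_closed
proof
  fix a b :: "'a rclos" and c :: "nat \<Rightarrow> 'a rclos" and n
  assume "a < b" "(\<Sum>i\<le>n. c i * a ^ i) < 0" "0 < (\<Sum>i\<le>n. c i * b ^ i)"
  then show "\<exists>x. a < x \<and> x < b \<and> (\<Sum>i\<le>n. c i * x ^ i) = 0"
    using rclos_neg_pos_root[of a b "\<Sum>i\<le>n. monom (c i) i"] by (auto simp: poly_sum poly_monom)
qed

section \<open>Real polynomial functions\<close>

text \<open>Functions are used instead of formal polynomials, since the quaternionic polynomials are
  functions as well; identities can then be checked pointwise.\<close>

inductive_set polyfun :: "(('v \<Rightarrow> real) \<Rightarrow> real) set" where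
  polyfun_const: "(\<lambda>x. c) \<in> polyfun"
| polyfun_var: "(\<lambda>x. x v) \<in> polyfun"
| polyfun_add: "f \<in> polyfun \<Longrightarrow> g \<in> polyfun \<Longrightarrow> (\<lambda>x. f x + g x) \<in> polyfun"
| polyfun_mult: "f \<in> polyfun \<Longrightarrow> g \<in> polyfun \<Longrightarrow> (\<lambda>x. f x * g x) \<in> polyfun"

lemma polyfun_uminus: "f \<in> polyfun \<Longrightarrow> (\<lambda>x. - f x) \<in> polyfun"
  using polyfun_mult[OF polyfun_const[of "- 1"]] by simp

lemma polyfun_diff: "f \<in> polyfun \<Longrightarrow> g \<in> polyfun \<Longrightarrow> (\<lambda>x. f x - g x) \<in> polyfun"
  using polyfun_add[OF _ polyfun_uminus] by simp

lemma polyfun_restrict: "f \<in> polyfun \<Longrightarrow> (\<lambda>x. f (x(v := 0))) \<in> polyfun"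
proof (induction rule: polyfun.induct)
  case (polyfun_var w)
  then show ?case
    by (cases "w = v") (simp_all add: polyfun.intros)
qed (simp_all add: polyfun.intros)

typedef 'v rpoly = "polyfun :: (('v \<Rightarrow> real) \<Rightarrow> real) set"
  using polyfun_const by blast

setup_lifting type_definition_rpoly

instantiation rpoly :: (type) comm_ring_1
begin

lift_definition zero_rpoly :: "'v rpoly" is "\<lambda>x. 0" by (rule polyfun_const)
lift_definition one_rpoly :: "'v rpoly" is "\<lambda>x. 1" by (rule polyfun_const)
lift_definition plus_rpoly :: "'v rpoly \<Rightarrow> 'v rpoly \<Rightarrow> 'v rpoly" is "\<lambda>f g x. f x + g x"
  by (rule polyfun_add)
lift_definition times_rpoly :: "'v rpoly \<Rightarrow> 'v rpoly \<Rightarrow> 'v rpoly" is "\<lambda>f g x. f x * g x"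
  by (rule polyfun_mult)
lift_definition uminus_rpoly :: "'v rpoly \<Rightarrow> 'v rpoly" is "\<lambda>f x. - f x"
  by (rule polyfun_uminus)
lift_definition minus_rpoly :: "'v rpoly \<Rightarrow> 'v rpoly \<Rightarrow> 'v rpoly" is "\<lambda>f g x. f x - g x"
  by (rule polyfun_diff)

instance
proof
  fix a b c :: "'v rpoly"
  show "a * b * c = a * (b * c)" "a * b = b * a" "a + b + c = a + (b + c)" "a + b = b + a"
    "(a + b) * c = a * c + b * c"
    by (transfer, simp add: algebra_simps fun_eq_iff)+
  show "1 * a = a" "0 + a = a" "- a + a = 0" "a - b = a + - b"
    by (transfer, simp)+
  show "(0 :: 'v rpoly) \<noteq> 1"
    by transfer (simp add: fun_eq_iff)
qed

end

lift_definition Cst :: "real \<Rightarrow> 'v rpoly" is "\<lambda>c x. c" by (rule polyfun_const)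
lift_definition Var :: "'v \<Rightarrow> 'v rpoly" is "\<lambda>v x. x v" by (rule polyfun_var)
text \<open>The fixed points of this map are the polynomial functions that do not involve
  \<open>v\<close>, so independence of a variable becomes an equation.\<close>

lift_definition restrict_var :: "'v \<Rightarrow> 'v rpoly \<Rightarrow> 'v rpoly" is "\<lambda>v f x. f (x(v := 0))"
  by (rule polyfun_restrict)

abbreviation "ev \<equiv> Rep_rpoly"

lemmas ev_simps [simp] = zero_rpoly.rep_eq one_rpoly.rep_eq plus_rpoly.rep_eq times_rpoly.rep_eq
  uminus_rpoly.rep_eq minus_rpoly.rep_eq Cst.rep_eq Var.rep_eq restrict_var.rep_eq

lemma rpoly_eqI: "(\<And>x. ev f x = ev g x) \<Longrightarrow> f = g"
  by (simp flip: Rep_rpoly_inject add: fun_eq_iff)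

lemma rpoly_induct [case_names Cst Var add mult]:
  assumes "\<And>c. P (Cst c)" "\<And>v. P (Var v)" "\<And>f g. P f \<Longrightarrow> P g \<Longrightarrow> P (f + g)"
    "\<And>f g. P f \<Longrightarrow> P g \<Longrightarrow> P (f * g)"
  shows "P f"
proof -
  have "P (Abs_rpoly g)" if "g \<in> polyfun" for g
    using that
  proof (induction rule: polyfun.induct)
    case (polyfun_const c)
    then show ?case using assms(1)[of c] by (simp add: Cst_def)
  next
    case (polyfun_var v)
    then show ?case using assms(2)[of v] by (simp add: Var_def)
  next
    case (polyfun_add f g)
    then have "Abs_rpoly (\<lambda>x. f x + g x) = Abs_rpoly f + Abs_rpoly g"
      by (intro rpoly_eqI) (simp add: Abs_rpoly_inverse polyfun.polyfun_add)
    with polyfun_add show ?case using assms(3) by simp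
  next
    case (polyfun_mult f g)
    then have "Abs_rpoly (\<lambda>x. f x * g x) = Abs_rpoly f * Abs_rpoly g"
      by (intro rpoly_eqI) (simp add: Abs_rpoly_inverse polyfun.polyfun_mult)
    with polyfun_mult show ?case using assms(4) by simp
  qed
  from this[OF Rep_rpoly[of f]] show ?thesis by (simp add: Rep_rpoly_inverse)
qed

lemma cring_hom_ev: "cring_hom (\<lambda>f. ev f a)"
  by standard simp_all

lemma cring_hom_Cst: "cring_hom Cst"
  by standard (rule rpoly_eqI, simp)+

lemma cring_hom_restrict_var: "cring_hom (restrict_var v)"
  by standard (rule rpoly_eqI, simp)+

lemma restrict_var_Var: "restrict_var v (Var w) = (if w = v then 0 else Var w)"
  by (rule rpoly_eqI) simp

lemma restrict_var_Cst: "restrict_var v (Cst c) = Cst c"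
  by (rule rpoly_eqI) simp

text \<open>The coefficients stay in the same type, so that the one-variable result can be iterated
  without changing the ring.\<close>

lemma rpoly_expand_var:
  "\<exists>q. f = poly q (Var v) \<and> (\<forall>i. restrict_var v (coeff q i) = coeff q i)"
proof -
  interpret r: cring_hom "restrict_var v" by (rule cring_hom_restrict_var)
  show ?thesis
  proof (induction f rule: rpoly_induct)
    case (Cst c)
    then show ?case
      by (intro exI[of _ "[:Cst c:]"]) (simp add: coeff_pCons restrict_var_Cst split: nat.splits)
  next
    case (Var w)
    show ?case
    proof (cases "w = v")
      case True
      then show ?thesis
        by (intro exI[of _ "[:0, 1:]"]) (simp add: coeff_pCons split: nat.splits)
    next
      case False
      then show ?thesis
        by (intro exI[of _ "[:Var w:]"]) (simp add: coeff_pCons restrict_var_Var split: nat.splits)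
    qed
  next
    case (add f g)
    then obtain p q where "f = poly p (Var v)" "\<forall>i. restrict_var v (coeff p i) = coeff p i"
      "g = poly q (Var v)" "\<forall>i. restrict_var v (coeff q i) = coeff q i" by blast
    then show ?case
      by (intro exI[of _ "p + q"]) (simp add: r.hom_add)
  next
    case (mult f g)
    then obtain p q where "f = poly p (Var v)" "\<forall>i. restrict_var v (coeff p i) = coeff p i"
      "g = poly q (Var v)" "\<forall>i. restrict_var v (coeff q i) = coeff q i" by blast
    then show ?case
      by (intro exI[of _ "p * q"]) (simp add: coeff_mult r.hom_sum r.hom_mult)
  qed
qed

text \<open>A positive real is the square of a unit, so its image is a nonzero square and thus
  positive.\<close>

lemma sg_hom_Cst:
  fixes \<phi> :: "'v rpoly \<Rightarrow> 'l::linordered_idom"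
  assumes "cring_hom \<phi>"
  shows "sg (\<phi> (Cst c)) = sg c"
proof -
  interpret h: cring_hom "\<lambda>c. \<phi> (Cst c)"
    using cring_hom_comp[OF assms cring_hom_Cst] .
  have pos: "0 < \<phi> (Cst c)" if "0 < c" for c
  proof -
    have "\<phi> (Cst (sqrt c)) * \<phi> (Cst (1 / sqrt c)) = 1"
      using that by (simp flip: h.hom_mult)
    then have "\<phi> (Cst (sqrt c)) \<noteq> 0" by auto
    then have "0 < \<phi> (Cst (sqrt c)) * \<phi> (Cst (sqrt c))"
      by (metis mult_neg_neg mult_pos_pos linorder_neqE_linordered_idom)
    then show ?thesis using that by (simp flip: h.hom_mult)
  qed
  show ?thesis
  proof (cases c "0 :: real" rule: linorder_cases)
    case less
    then have "\<phi> (Cst c) < 0" using pos[of "- c"] by (simp add: h.hom_uminus)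
    then show ?thesis using less by (simp add: sg_def)
  next
    case equal
    then show ?thesis by (simp add: h.hom_zero)
  next
    case greater
    then show ?thesis using pos by (simp add: sg_def)
  qed
qed

text \<open>The induction runs over the variables that need not be sent to 0. With none left,
  \<open>\<phi>\<close> agrees with evaluation at the origin followed by \<open>\<phi>\<close> on
  constants, where signs are preserved. In the step, the coefficients in \<open>G\<close> are
  transferred first, and then a real value for \<open>v\<close> is found.\<close>

theorem multivariate_transfer:
  fixes \<phi> :: "'v rpoly \<Rightarrow> 'l::real_closed"
  assumes "finite W" "cring_hom \<phi>" "\<And>v. v \<notin> W \<Longrightarrow> \<phi> (Var v) = 0" "finite F"
  shows "\<exists>a. \<forall>f\<in>F. sg (\<phi> f) = sg (ev f a)"
  using assms
proof (induction W arbitrary: \<phi> F)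
  case empty
  interpret cring_hom \<phi> by (rule empty(1))
  have "\<phi> f = \<phi> (Cst (ev f (\<lambda>_. 0)))" for f
  proof (induction f rule: rpoly_induct)
    case (Cst c)
    then show ?case by simp
  next
    case (Var v)
    then show ?case using empty(2)[of v] cring_hom.hom_zero[OF cring_hom_comp[OF empty(1) cring_hom_Cst]] by simp
  next
    case (add f g)
    then show ?case
      using cring_hom.hom_add[OF cring_hom_comp[OF empty(1) cring_hom_Cst]] by (simp add: hom_add)
  next
    case (mult f g)
    then show ?case
      using cring_hom.hom_mult[OF cring_hom_comp[OF empty(1) cring_hom_Cst]] by (simp add: hom_mult)
  qed
  then have "sg (\<phi> f) = sg (ev f (\<lambda>_. 0))" for f
    using sg_hom_Cst[OF empty(1)] by metis
  then show ?case by blast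
next
  case (insert v W)
  interpret \<phi>: cring_hom \<phi> by (rule insert.prems(1))
  obtain q where q: "\<And>f. f = poly (q f) (Var v)"
    "\<And>f i. restrict_var v (coeff (q f) i) = coeff (q f) i"
    using rpoly_expand_var[of _ v] by metis
  obtain G where G: "finite G" "\<forall>(\<phi> :: 'v rpoly \<Rightarrow> 'l) (\<psi> :: 'v rpoly \<Rightarrow> real).
    cring_hom \<phi> \<longrightarrow> cring_hom \<psi> \<longrightarrow> (\<forall>g\<in>G. sg (\<phi> g) = sg (\<psi> g)) \<longrightarrow>
    (\<forall>t. \<exists>s. \<forall>f\<in>q ` F. sg (poly (map_poly \<phi> f) t) = sg (poly (map_poly \<psi> f) s))"
    using one_variable_transfer[OF finite_imageI[OF insert.prems(3), of q]] by blast
  \<comment> \<open>On coefficients free of \<open>v\<close> this agrees with \<open>\<phi>\<close>,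
    but it sends \<open>Var v\<close> to 0, as the induction hypothesis requires.\<close>
  define \<phi>' where "\<phi>' f = \<phi> (restrict_var v f)" for f
  have hom': "cring_hom \<phi>'"
    unfolding \<phi>'_def by (rule cring_hom_comp[OF insert.prems(1) cring_hom_restrict_var])
  have "\<phi>' (Var w) = 0" if "w \<notin> W" for w
    using insert.prems(2)[of w] that by (simp add: \<phi>'_def restrict_var_Var)
  from insert.IH[OF hom' this G(1)] obtain a where a: "\<forall>g\<in>G. sg (\<phi>' g) = sg (ev g a)"
    by blast
  from G(2)[rule_format, OF hom' cring_hom_ev, of a "\<phi> (Var v)"] a obtain s where
    s: "\<And>f. f \<in> F \<Longrightarrow> sg (poly (map_poly \<phi>' (q f)) (\<phi> (Var v))) = sg (poly (map_poly (\<lambda>g. ev g a) (q f)) s)"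
    by blast
  have "sg (\<phi> f) = sg (ev f (a(v := s)))" if "f \<in> F" for f
  proof -
    have "map_poly \<phi>' (q f) = map_poly \<phi> (q f)"
      by (intro poly_eqI)
        (simp add: coeff_map_poly \<phi>.hom_zero cring_hom.hom_zero[OF hom'], simp add: \<phi>'_def q(2))
    then have 1: "\<phi> f = poly (map_poly \<phi>' (q f)) (\<phi> (Var v))"
      using q(1)[of f] by (simp add: \<phi>.poly_map_poly_hom)
    have "ev (coeff (q f) i) a = ev (coeff (q f) i) (a(v := s))" for i
    proof -
      have "ev (coeff (q f) i) x = ev (coeff (q f) i) (x(v := 0))" for x
        using arg_cong[OF q(2)[of f i], of "\<lambda>g. ev g x"] by simp
      from this[of a] this[of "a(v := s)"] show ?thesis by simp
    qed
    then have "map_poly (\<lambda>g. ev g a) (q f) = map_poly (\<lambda>g. ev g (a(v := s))) (q f)"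
      by (intro poly_eqI) (simp add: coeff_map_poly)
    moreover have "poly (map_poly (\<lambda>g. ev g (a(v := s))) (q f)) (ev (Var v) (a(v := s))) =
        ev (poly (q f) (Var v)) (a(v := s))"
      by (rule cring_hom.poly_map_poly_hom[OF cring_hom_ev])
    ultimately have 2: "ev f (a(v := s)) = poly (map_poly (\<lambda>g. ev g a) (q f)) s"
      using q(1)[of f] by simp
    show ?thesis using s[OF that] by (simp only: 1 2)
  qed
  then show ?case by blast
qed


section \<open>Hilbert's basis theorem\<close>

text \<open>The ring of scalars is a subset \<open>B\<close> of the type, so that the constants and
  the rings obtained by adjoining one coordinate after another all live inside the single type
  \<open>'v rpoly\<close>.\<close>

inductive_set gen_by :: "'a::comm_ring_1 set \<Rightarrow> 'a set \<Rightarrow> 'a set" for B S where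
  gen_by_zero: "0 \<in> gen_by B S"
| gen_by_step: "x \<in> gen_by B S \<Longrightarrow> b \<in> B \<Longrightarrow> s \<in> S \<Longrightarrow> b * s + x \<in> gen_by B S"

definition subring_set :: "'a::comm_ring_1 set \<Rightarrow> bool" where
  "subring_set B \<longleftrightarrow> 1 \<in> B \<and> (\<forall>x\<in>B. \<forall>y\<in>B. x - y \<in> B \<and> x * y \<in> B)"

definition ideal_in :: "'a::comm_ring_1 set \<Rightarrow> 'a set \<Rightarrow> bool" where
  "ideal_in B S \<longleftrightarrow> S \<subseteq> B \<and> 0 \<in> S \<and> (\<forall>x\<in>S. \<forall>y\<in>S. x + y \<in> S) \<and> (\<forall>b\<in>B. \<forall>x\<in>S. b * x \<in> S)"

definition noetherian_set :: "'a::comm_ring_1 set \<Rightarrow> bool" where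
  "noetherian_set B \<longleftrightarrow> subring_set B \<and>
    (\<forall>S. ideal_in B S \<longrightarrow> (\<exists>F. finite F \<and> F \<subseteq> S \<and> S \<subseteq> gen_by B F))"

lemma subring_setD:
  assumes "subring_set B"
  shows "1 \<in> B" "0 \<in> B" "x \<in> B \<Longrightarrow> y \<in> B \<Longrightarrow> x - y \<in> B" "x \<in> B \<Longrightarrow> y \<in> B \<Longrightarrow> x * y \<in> B"
    "x \<in> B \<Longrightarrow> - x \<in> B" "x \<in> B \<Longrightarrow> y \<in> B \<Longrightarrow> x + y \<in> B"
proof -
  show *: "1 \<in> B" "x \<in> B \<Longrightarrow> y \<in> B \<Longrightarrow> x - y \<in> B" "x \<in> B \<Longrightarrow> y \<in> B \<Longrightarrow> x * y \<in> B" for x y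
    using assms by (auto simp: subring_set_def)
  show z: "0 \<in> B" using *(2)[OF *(1) *(1)] by simp
  show m: "x \<in> B \<Longrightarrow> - x \<in> B" for x using *(2)[OF z] by simp
  show "x \<in> B \<Longrightarrow> y \<in> B \<Longrightarrow> x + y \<in> B" using *(2)[of x "- y"] m[of y] by simp
qed

lemma subring_set_sum:
  "subring_set B \<Longrightarrow> (\<And>i. i \<in> I \<Longrightarrow> f i \<in> B) \<Longrightarrow> sum f I \<in> B"
  by (induction I rule: infinite_finite_induct) (auto intro: subring_setD)

lemma gen_by_mono: "x \<in> gen_by B S \<Longrightarrow> S \<subseteq> T \<Longrightarrow> x \<in> gen_by B T"
  by (induction rule: gen_by.induct) (auto intro: gen_by.intros)

lemma gen_by_base: "subring_set B \<Longrightarrow> s \<in> S \<Longrightarrow> s \<in> gen_by B S"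
  using gen_by_step[OF gen_by_zero, of 1 B s S] subring_setD(1)[of B] by simp

lemma gen_by_add: "x \<in> gen_by B S \<Longrightarrow> y \<in> gen_by B S \<Longrightarrow> x + y \<in> gen_by B S"
  by (induction rule: gen_by.induct) (auto intro: gen_by.intros simp: add.assoc)

lemma gen_by_mult:
  assumes "x \<in> gen_by B S" "subring_set B" "b \<in> B"
  shows "b * x \<in> gen_by B S"
  using assms(1)
proof (induction rule: gen_by.induct)
  case (gen_by_step x c s)
  then show ?case
    using gen_by.gen_by_step[of "b * x" B S "b * c" s] subring_setD(4)[OF assms(2,3)]
    by (simp add: distrib_left mult.assoc)
qed (simp add: gen_by_zero)

lemma gen_by_idem:
  assumes "x \<in> gen_by B S" "S \<subseteq> gen_by B T" "subring_set B"
  shows "x \<in> gen_by B T"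
  using assms(1)
  by induction (use assms(2,3) in \<open>auto intro: gen_by_zero gen_by_add gen_by_mult\<close>)

lemma gen_by_in_ideal:
  assumes "x \<in> gen_by B S" "S \<subseteq> I" "ideal_in B I"
  shows "x \<in> I"
  using assms(1) by induction (use assms(2,3) in \<open>auto simp: ideal_in_def\<close>)

lemma ideal_in_gen_by:
  assumes "subring_set B" "S \<subseteq> B"
  shows "ideal_in B (gen_by B S)"
proof -
  have "x \<in> B" if "x \<in> gen_by B S" for x
    using that by induction (use assms in \<open>auto intro: subring_setD\<close>)
  then show ?thesis
    using assms(1) by (auto simp: ideal_in_def intro: gen_by_zero gen_by_add gen_by_mult)
qed

lemma gen_by_range_finite:
  fixes s :: "nat \<Rightarrow> 'a::comm_ring_1"
  assumes "x \<in> gen_by B (range s)"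
  shows "\<exists>N. x \<in> gen_by B (s ` {..<N})"
  using assms
proof (induction rule: gen_by.induct)
  case gen_by_zero
  then show ?case by (auto intro: gen_by.intros)
next
  case (gen_by_step x b t)
  then obtain N k where N: "x \<in> gen_by B (s ` {..<N})" "t = s k" by blast
  have "x \<in> gen_by B (s ` {..<max N (Suc k)})"
    by (rule gen_by_mono[OF N(1)]) auto
  then have "b * t + x \<in> gen_by B (s ` {..<max N (Suc k)})"
    using N(2) gen_by_step(2) by (intro gen_by.gen_by_step) auto
  then show ?case by blast
qed

text \<open>The ascending chain condition in the form used by Hilbert's argument: finitely many
  generators of the ideal of the whole sequence involve only an initial segment of it.\<close>

lemma noetherian_sequence:
  fixes s :: "nat \<Rightarrow> 'a::comm_ring_1"
  assumes "noetherian_set B" "range s \<subseteq> B"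
  shows "\<exists>N. s N \<in> gen_by B (s ` {..<N})"
proof -
  have B: "subring_set B" using assms(1) by (simp add: noetherian_set_def)
  obtain F where F: "finite F" "F \<subseteq> gen_by B (range s)" "gen_by B (range s) \<subseteq> gen_by B F"
    using assms(1) ideal_in_gen_by[OF B assms(2)] unfolding noetherian_set_def by blast
  have "\<exists>N. F' \<subseteq> gen_by B (s ` {..<N})" if "F' \<subseteq> F" for F'
    using finite_subset[OF that F(1)] that
  proof (induction F')
    case (insert x F')
    then obtain N where N: "F' \<subseteq> gen_by B (s ` {..<N})" by blast
    obtain K where K: "x \<in> gen_by B (s ` {..<K})"
      using insert.prems F(2) gen_by_range_finite by blast
    have "s ` {..<N} \<subseteq> s ` {..<max N K}" "s ` {..<K} \<subseteq> s ` {..<max N K}"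
      by (intro image_mono; force)+
    then have "insert x F' \<subseteq> gen_by B (s ` {..<max N K})"
      using N K by (blast intro: gen_by_mono)
    then show ?case by blast
  qed simp
  then obtain N where N: "F \<subseteq> gen_by B (s ` {..<N})" by blast
  have "s N \<in> gen_by B F"
    using F(3) gen_by_base[OF B, of "s N" "range s"] by blast
  then have "s N \<in> gen_by B (s ` {..<N})" using gen_by_idem[OF _ N B] by blast
  then show ?thesis by blast
qed

definition adjoin :: "'a::comm_ring_1 set \<Rightarrow> 'a \<Rightarrow> 'a set" where
  "adjoin B x = {poly q x | q. \<forall>i. coeff q i \<in> B}"

lemma subring_set_adjoin:
  assumes "subring_set B"
  shows "subring_set (adjoin B x)"
  unfolding subring_set_def
proof (intro conjI ballI)
  show "1 \<in> adjoin B x"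
    using assms by (auto simp: adjoin_def coeff_1 intro!: exI[of _ 1] subring_setD)
  fix y z assume "y \<in> adjoin B x" "z \<in> adjoin B x"
  then obtain p q where p: "y = poly p x" "\<forall>i. coeff p i \<in> B" and q: "z = poly q x" "\<forall>i. coeff q i \<in> B"
    by (auto simp: adjoin_def)
  show "y - z \<in> adjoin B x"
    unfolding adjoin_def using p q subring_setD(3)[OF assms]
    by (intro CollectI exI[of _ "p - q"]) simp
  show "y * z \<in> adjoin B x"
    unfolding adjoin_def using p q subring_setD(4)[OF assms]
    by (intro CollectI exI[of _ "p * q"]) (simp add: coeff_mult subring_set_sum[OF assms])
qed

lemma adjoin_superset:
  assumes "subring_set B"
  shows "B \<subseteq> adjoin B x" "x \<in> adjoin B x"
proof
  fix b assume "b \<in> B"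
  then show "b \<in> adjoin B x"
    unfolding adjoin_def using subring_setD(2)[OF assms]
    by (intro CollectI exI[of _ "[:b:]"]) (auto simp: coeff_pCons split: nat.splits)
next
  show "x \<in> adjoin B x"
    unfolding adjoin_def using subring_setD(1,2)[OF assms]
    by (intro CollectI exI[of _ "[:0, 1:]"]) (auto simp: coeff_pCons split: nat.splits)
qed

text \<open>Hilbert's argument: if \<open>S\<close> were not finitely generated, polynomials
  \<open>q n\<close> of least degree could be chosen whose values lie in \<open>S\<close> but
  outside the ideal generated by the earlier values. Some leading coefficient is a combination of
  earlier ones, and subtracting cancels it, against minimality. Degrees refer to the chosen
  polynomials over \<open>B\<close>, so \<open>x\<close> may satisfy relations over
  \<open>B\<close>.\<close>

theorem noetherian_adjoin:
  assumes "noetherian_set B"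
  shows "noetherian_set (adjoin B x)"
  unfolding noetherian_set_def
proof (intro conjI allI impI)
  have B: "subring_set B" using assms by (simp add: noetherian_set_def)
  then show C: "subring_set (adjoin B x)" by (rule subring_set_adjoin)
  fix S assume S: "ideal_in (adjoin B x) S"
  let ?C = "adjoin B x" and ?e = "\<lambda>q. poly q x"
  show "\<exists>F. finite F \<and> F \<subseteq> S \<and> S \<subseteq> gen_by ?C F"
  proof (rule ccontr)
    assume nofin: "\<not> ?thesis"
    define ok where "ok Q q \<longleftrightarrow> (\<forall>i. coeff q i \<in> B) \<and> ?e q \<in> S \<and> ?e q \<notin> gen_by ?C (?e ` Q)" for Q q
    define c where "c Q = (ARG_MIN degree q. ok Q q)" for Q
    define A where "A = rec_nat {} (\<lambda>_ Q. insert (c Q) Q)"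
    have A_simps: "A 0 = {}" "A (Suc n) = insert (c (A n)) (A n)" for n
      by (simp_all add: A_def)
    have A_fin: "finite (A n)" for n by (induction n) (simp_all add: A_simps)
    have c_ok: "ok Q (c Q)" and c_min: "ok Q q \<Longrightarrow> degree (c Q) \<le> degree q"
      if "finite Q" "?e ` Q \<subseteq> S" for Q q
    proof -
      have "\<not> S \<subseteq> gen_by ?C (?e ` Q)"
        using nofin finite_imageI[OF that(1), of ?e] that(2) by blast
      then obtain y where y: "y \<in> S" "y \<notin> gen_by ?C (?e ` Q)" by blast
      then obtain p where "y = ?e p" "\<forall>i. coeff p i \<in> B"
        using S by (auto simp: ideal_in_def adjoin_def)
      with y have "ok Q p" by (simp add: ok_def)
      then show "ok Q (c Q)"
        unfolding c_def by (rule arg_min_natI)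
      show "degree (c Q) \<le> degree q" if "ok Q q"
        unfolding c_def using that by (rule arg_min_nat_le)
    qed
    have A_S: "?e ` A n \<subseteq> S" for n
    proof (induction n)
      case (Suc n)
      then show ?case using c_ok[OF A_fin Suc] by (simp add: A_simps ok_def)
    qed (simp add: A_simps)
    define q where "q n = c (A n)" for n
    have q_ok: "ok (A n) (q n)" for n
      unfolding q_def by (rule c_ok[OF A_fin A_S])
    have A_eq: "A n = q ` {..<n}" for n
      by (induction n) (simp_all add: A_simps q_def lessThan_Suc)
    have deg_mono: "degree (q i) \<le> degree (q n)" if "i < n" for i n
    proof -
      have "?e ` A i \<subseteq> ?e ` A n" using that by (auto simp: A_eq)
      then have "ok (A i) (q n)"
        using q_ok[of n] gen_by_mono[of "?e (q n)" ?C "?e ` A i" "?e ` A n"] by (auto simp: ok_def)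
      then show ?thesis using c_min[OF A_fin A_S] by (simp add: q_def)
    qed
    have "range (\<lambda>n. lead_coeff (q n)) \<subseteq> B" using q_ok by (auto simp: ok_def)
    from noetherian_sequence[OF assms this] obtain N where
      N: "lead_coeff (q N) \<in> gen_by B ((\<lambda>n. lead_coeff (q n)) ` {..<N})" by blast
    define d where "d = degree (q N)"
    \<comment> \<open>A combination of earlier leading coefficients is lifted to a polynomial having
      it as its coefficient at \<open>d\<close>: each \<open>q i\<close> is shifted up to degree
      \<open>d\<close>, which is possible since the degrees increase weakly.\<close>
    have "\<exists>p. (\<forall>i. coeff p i \<in> B) \<and> ?e p \<in> gen_by ?C (?e ` A N) \<and> degree p \<le> d \<and> coeff p d = y"
      if "y \<in> gen_by B ((\<lambda>n. lead_coeff (q n)) ` {..<N})" for y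
      using that
    proof (induction rule: gen_by.induct)
      case gen_by_zero
      show ?case
        using subring_setD(2)[OF B] by (intro exI[of _ 0]) (simp add: gen_by.gen_by_zero)
    next
      case (gen_by_step y b a)
      then obtain p i where p: "\<forall>i. coeff p i \<in> B" "?e p \<in> gen_by ?C (?e ` A N)" "degree p \<le> d"
        "coeff p d = y" and i: "i < N" "a = lead_coeff (q i)" by blast
      define k where "k = d - degree (q i)"
      have k: "degree (q i) + k = d" using deg_mono[OF i(1)] by (simp add: k_def d_def)
      have monomB: "\<forall>j. coeff (monom b k) j \<in> B"
        using gen_by_step(2) subring_setD(2)[OF B] by simp
      have qB: "\<forall>j. coeff (q i) j \<in> B" using q_ok by (simp add: ok_def)
      define p' where "p' = monom b k * q i + p"
      have "coeff p' j \<in> B" for j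
        unfolding p'_def using monomB qB p(1)
        by (simp add: coeff_mult subring_setD(4,6)[OF B] subring_set_sum[OF B] del: coeff_monom)
      moreover have "?e (monom b k) \<in> ?C" using monomB by (auto simp: adjoin_def)
      then have "?e p' \<in> gen_by ?C (?e ` A N)"
        unfolding p'_def poly_add poly_mult
        by (rule gen_by.gen_by_step[OF p(2)]) (use i(1) in \<open>simp add: A_eq\<close>)
      moreover have "degree (monom b k * q i) \<le> d"
        using degree_mult_le[of "monom b k" "q i"] degree_monom_le[of b k] k by linarith
      then have "degree p' \<le> d"
        unfolding p'_def using p(3) by (rule degree_add_le)
      moreover have "coeff (monom b k * q i) (degree (q i) + k) = b * a"
        by (simp add: coeff_monom_mult i(2))
      then have "coeff p' d = b * a + y"
        by (simp add: p'_def p(4) k)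
      ultimately show ?case by blast
    qed
    from this[OF N] obtain p where p: "\<forall>i. coeff p i \<in> B" "?e p \<in> gen_by ?C (?e ` A N)"
      "degree p \<le> d" "coeff p d = coeff (q N) d" by (auto simp: d_def)
    define r where "r = q N - p"
    have pS: "?e p \<in> S" by (rule gen_by_in_ideal[OF p(2) A_S S])
    have r_ok: "ok (A N) r"
      unfolding ok_def
    proof (intro conjI allI notI)
      show "coeff r i \<in> B" for i
        using q_ok[of N] p(1) by (auto simp: r_def ok_def intro: subring_setD[OF B])
      have "- 1 \<in> ?C" using subring_setD(1,5)[OF C] by blast
      then have "- 1 * ?e p \<in> S" using pS S by (auto simp: ideal_in_def)
      then have "?e (q N) + - 1 * ?e p \<in> S"
        using q_ok[of N] S by (auto simp: ideal_in_def ok_def)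
      then show "?e r \<in> S" by (simp add: r_def)
      assume "?e r \<in> gen_by ?C (?e ` A N)"
      from gen_by_add[OF this p(2)] have "?e (q N) \<in> gen_by ?C (?e ` A N)" by (simp add: r_def)
      then show False using q_ok[of N] by (simp add: ok_def)
    qed
    \<comment> \<open>Minimality forces degree exactly \<open>d\<close>, yet the coefficient there
      has been cancelled. So \<open>r = 0\<close>, whose value lies in every ideal.\<close>
    have "degree r \<le> d" "coeff r d = 0"
      using p(3,4) by (auto simp: r_def d_def intro: degree_diff_le)
    moreover have "d \<le> degree r"
      using c_min[OF A_fin A_S r_ok] by (simp add: d_def q_def)
    ultimately have "r = 0" by (metis antisym leading_coeff_0_iff)
    then show False using r_ok by (simp add: ok_def gen_by_zero)
  qed
qed

lemma noetherian_range_Cst: "noetherian_set (range (Cst :: real \<Rightarrow> 'v rpoly))"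
  unfolding noetherian_set_def
proof (intro conjI allI impI)
  interpret cring_hom "Cst :: real \<Rightarrow> 'v rpoly" by (rule cring_hom_Cst)
  have "(1 :: 'v rpoly) \<in> range Cst"
    by (rule range_eqI[of _ _ 1]) simp
  then show "subring_set (range (Cst :: real \<Rightarrow> 'v rpoly))"
    by (auto simp: subring_set_def simp flip: hom_diff hom_mult)
  fix S assume S: "ideal_in (range (Cst :: real \<Rightarrow> 'v rpoly)) S"
  show "\<exists>F. finite F \<and> F \<subseteq> S \<and> S \<subseteq> gen_by (range Cst) F"
  proof (cases "S \<subseteq> {0}")
    case True
    then show ?thesis by (intro exI[of _ "{}"]) (auto intro: gen_by_zero)
  next
    case False
    then obtain f where "f \<in> S" "f \<noteq> 0" by blast
    moreover have SC: "S \<subseteq> range Cst" using S by (simp add: ideal_in_def)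
    ultimately obtain c where c: "Cst c \<in> S" "Cst c \<noteq> (0 :: 'v rpoly)" by blast
    then have "c \<noteq> 0" by (metis hom_zero)
    have "(Cst d :: 'v rpoly) \<in> gen_by (range Cst) {Cst c}" for d
    proof -
      have "Cst (d / c) * Cst c + 0 \<in> gen_by (range Cst) {Cst c :: 'v rpoly}"
        by (intro gen_by_step gen_by_zero) auto
      moreover have "Cst (d / c) * Cst c = (Cst d :: 'v rpoly)"
        using \<open>c \<noteq> 0\<close> by (intro rpoly_eqI) simp
      ultimately show ?thesis by simp
    qed
    then have "S \<subseteq> gen_by (range Cst) {Cst c}" using SC by blast
    then show ?thesis using c(1) by (intro exI[of _ "{Cst c}"]) auto
  qed
qed

corollary noetherian_rpoly: "noetherian_set (UNIV :: 'v::finite rpoly set)"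
proof -
  have "\<exists>B. noetherian_set B \<and> range Cst \<subseteq> B \<and> Var ` W \<subseteq> B" if "finite W" for W :: "'v set"
    using that
  proof induction
    case empty
    show ?case using noetherian_range_Cst by (intro exI[of _ "range Cst"]) auto
  next
    case (insert v W)
    then obtain B where B: "noetherian_set B" "range Cst \<subseteq> B" "Var ` W \<subseteq> B" by blast
    then have "B \<subseteq> adjoin B (Var v)" "Var v \<in> adjoin B (Var v)"
      by (simp_all add: adjoin_superset noetherian_set_def)
    with B show ?case
      by (intro exI[of _ "adjoin B (Var v)"] conjI noetherian_adjoin) auto
  qed
  from this[of UNIV, OF finite] obtain B :: "'v rpoly set" where
    B: "noetherian_set B" "range Cst \<subseteq> B" "range Var \<subseteq> B" by (elim exE conjE)
  then have "subring_set B" by (simp add: noetherian_set_def)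
  note closed = subring_setD(4,6)[OF this]
  have "f \<in> B" for f
  proof (induction f rule: rpoly_induct)
    case (add f g)
    then show ?case by (rule closed(2))
  next
    case (mult f g)
    then show ?case by (rule closed(1))
  qed (use B(2,3) in auto)
  then have "B = UNIV" by auto
  then show ?thesis using B(1) by simp
qed

section \<open>The real Nullstellensatz\<close>

text \<open>The last clause makes the quotient domain, and with it the fraction field, formally
  real.\<close>

definition real_prime :: "'a::comm_ring_1 set \<Rightarrow> bool" where
  "real_prime p \<longleftrightarrow> ideal_in UNIV p \<and> 1 \<notin> p \<and> (\<forall>a b. a * b \<in> p \<longrightarrow> a \<in> p \<or> b \<in> p) \<and>
    (\<forall>s\<in>sos. \<forall>a. s + a * a \<in> p \<longrightarrow> a \<in> p)"

lemma ideal_inD: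
  assumes "ideal_in UNIV p"
  shows "0 \<in> p" "x \<in> p \<Longrightarrow> y \<in> p \<Longrightarrow> x + y \<in> p" "x \<in> p \<Longrightarrow> b * x \<in> p" "x \<in> p \<Longrightarrow> x * b \<in> p"
    "x \<in> p \<Longrightarrow> - x \<in> p" "x \<in> p \<Longrightarrow> y \<in> p \<Longrightarrow> x - y \<in> p"
proof -
  show *: "0 \<in> p" "x \<in> p \<Longrightarrow> y \<in> p \<Longrightarrow> x + y \<in> p" "x \<in> p \<Longrightarrow> b * x \<in> p" for x y b
    using assms by (auto simp: ideal_in_def)
  show "x \<in> p \<Longrightarrow> x * b \<in> p" using *(3)[of x b] by (simp add: mult.commute)
  show m: "x \<in> p \<Longrightarrow> - x \<in> p" for x using *(3)[of x "- 1"] by simp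
  show "x \<in> p \<Longrightarrow> y \<in> p \<Longrightarrow> x - y \<in> p" using *(2)[of x "- y"] m[of y] by simp
qed

text \<open>
  A type definition cannot depend on a variable. The quotient by an arbitrary real prime is avoided
  by passing to \<open>bad_prime\<close>, which is a counterexample to the Nullstellensatz if there is one.
\<close>

definition counterexample_prime :: "'v rpoly set \<Rightarrow> bool" where
  "counterexample_prime p \<longleftrightarrow>
    real_prime p \<and> (\<exists>f. f \<notin> p \<and> (\<forall>x. (\<forall>g\<in>p. ev g x = 0) \<longrightarrow> ev f x = 0))"

definition bad_prime :: "'v rpoly set" where
  "bad_prime = (SOME p. real_prime p \<and> ((\<exists>q :: 'v rpoly set. counterexample_prime q) \<longrightarrow> counterexample_prime p))"

lemma ev_sos_nonneg: "s \<in> sos \<Longrightarrow> 0 \<le> ev s x"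
  by (induction rule: sos_on.induct) auto

text \<open>Real primes exist, so \<open>bad_prime\<close> is one even when there is no
  counterexample, and the class instances of the quotient hold unconditionally.\<close>

lemma real_prime_point: "real_prime {f. ev f x = 0}"
proof -
  have "ev a x = 0" if "s \<in> sos" "ev s x + ev a x * ev a x = 0" for s a
    using ev_sos_nonneg[OF that(1), of x] that(2) by (simp add: add_nonneg_eq_0_iff)
  then show ?thesis by (auto simp: real_prime_def ideal_in_def)
qed

lemma real_prime_bad_prime: "real_prime (bad_prime :: 'v rpoly set)"
  and counterexample_bad_prime: "counterexample_prime (q :: 'v rpoly set) \<Longrightarrow> counterexample_prime (bad_prime :: 'v rpoly set)"
proof -
  have "\<exists>p. real_prime p \<and> ((\<exists>q :: 'v rpoly set. counterexample_prime q) \<longrightarrow> counterexample_prime (p :: 'v rpoly set))"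
  proof (cases "\<exists>q :: 'v rpoly set. counterexample_prime q")
    case True
    then show ?thesis by (auto simp: counterexample_prime_def)
  next
    case False
    then show ?thesis using real_prime_point by blast
  qed
  from someI_ex[OF this, folded bad_prime_def]
  show "real_prime (bad_prime :: 'v rpoly set)"
    "counterexample_prime (q :: 'v rpoly set) \<Longrightarrow> counterexample_prime (bad_prime :: 'v rpoly set)"
    by blast+
qed

lemma real_primeD:
  assumes "real_prime p"
  shows "ideal_in UNIV p" "1 \<notin> p" "a * b \<in> p \<Longrightarrow> a \<in> p \<or> b \<in> p"
    "s \<in> sos \<Longrightarrow> s + a * a \<in> p \<Longrightarrow> a \<in> p"
  using assms unfolding real_prime_def by blast+

lemmas ideal_bad_prime = real_primeD(1)[OF real_prime_bad_prime]
  and one_notin_bad_prime = real_primeD(2)[OF real_prime_bad_prime]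
  and prime_bad_prime = real_primeD(3)[OF real_prime_bad_prime]
  and real_bad_prime = real_primeD(4)[OF real_prime_bad_prime]

lemmas bad_prime_closed = ideal_inD[OF ideal_bad_prime]

\<comment> \<open>The residue domain and its field of fractions\<close>
quotient_type 'v rdom = "'v rpoly" / "\<lambda>a b. a - b \<in> bad_prime"
proof (rule equivpI)
  show "reflp (\<lambda>a b :: 'v rpoly. a - b \<in> bad_prime)"
    by (rule reflpI) (simp add: bad_prime_closed(1))
  show "symp (\<lambda>a b :: 'v rpoly. a - b \<in> bad_prime)"
    by (rule sympI) (drule bad_prime_closed(5), simp)
  show "transp (\<lambda>a b :: 'v rpoly. a - b \<in> bad_prime)"
    by (rule transpI) (drule (1) bad_prime_closed(2), simp)
qed

instantiation rdom :: (type) idom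
begin

lift_definition zero_rdom :: "'v rdom" is 0 .
lift_definition one_rdom :: "'v rdom" is 1 .
lift_definition plus_rdom :: "'v rdom \<Rightarrow> 'v rdom \<Rightarrow> 'v rdom" is "(+)"
  by (drule (1) bad_prime_closed(2)) (simp add: algebra_simps)
lift_definition minus_rdom :: "'v rdom \<Rightarrow> 'v rdom \<Rightarrow> 'v rdom" is "(-)"
  by (drule (1) bad_prime_closed(6)) (simp add: algebra_simps)
lift_definition uminus_rdom :: "'v rdom \<Rightarrow> 'v rdom" is uminus
  by (drule bad_prime_closed(5)) (simp add: algebra_simps)
lift_definition times_rdom :: "'v rdom \<Rightarrow> 'v rdom \<Rightarrow> 'v rdom" is "(*)"
proof -
  fix a b c d :: "'v rpoly"
  assume "a - b \<in> bad_prime" "c - d \<in> bad_prime"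
  then have "a * (c - d) + (a - b) * d \<in> bad_prime"
    by (intro bad_prime_closed(2) bad_prime_closed(3,4))
  then show "a * c - b * d \<in> bad_prime" by (simp add: algebra_simps)
qed

lemma abs_rdom_surj: "\<exists>b. a = abs_rdom b"
  by (metis Quotient_abs_rep Quotient_rdom)

lemma abs_rdom_eq_abs_0_iff: "abs_rdom f = abs_rdom 0 \<longleftrightarrow> f \<in> bad_prime"
  by (simp add: rdom.abs_eq_iff)

lemmas abs_rdom_hom = plus_rdom.abs_eq times_rdom.abs_eq uminus_rdom.abs_eq minus_rdom.abs_eq
  zero_rdom.abs_eq one_rdom.abs_eq

instance
proof
  fix a b c :: "'v rdom"
  obtain x y z where [simp]: "a = abs_rdom x" "b = abs_rdom y" "c = abs_rdom z"
    using abs_rdom_surj by metis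
  show "a * b * c = a * (b * c)" "a * b = b * a" "a + b + c = a + (b + c)" "a + b = b + a"
    "(a + b) * c = a * c + b * c" "a * (b + c) = a * b + a * c" "0 * a = 0" "a * 0 = 0"
    by (simp_all add: abs_rdom_hom algebra_simps)
  show "1 * a = a" "0 + a = a" "- a + a = 0" "a - b = a + - b"
    by (simp_all add: abs_rdom_hom)
  have "abs_rdom 1 \<noteq> (abs_rdom 0 :: 'v rdom)"
    unfolding abs_rdom_eq_abs_0_iff by (rule one_notin_bad_prime)
  then show "(0 :: 'v rdom) \<noteq> 1"
    unfolding one_rdom_def zero_rdom_def by (rule not_sym)
  show "a * b \<noteq> 0" if "a \<noteq> 0" "b \<noteq> 0"
    using that prime_bad_prime[of x y]
    by (auto simp: times_rdom.abs_eq zero_rdom_def abs_rdom_eq_abs_0_iff)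
qed

end

lemma abs_rdom_eq_0_iff: "abs_rdom f = 0 \<longleftrightarrow> f \<in> bad_prime"
  by (simp add: zero_rdom_def abs_rdom_eq_abs_0_iff)

lemma cring_hom_abs_rdom: "cring_hom abs_rdom"
  by standard (simp_all add: abs_rdom_hom)

instance rdom :: (type) formally_real
proof (rule formally_realI)
  interpret cring_hom abs_rdom by (rule cring_hom_abs_rdom)
  fix s a :: "'a rdom"
  assume s: "s \<in> sos" "s + a * a = 0"
  from s(1) have "\<exists>t\<in>sos. s = abs_rdom t"
  proof (induction rule: sos_on.induct)
    case sos_on_zero
    show ?case by (intro bexI[of _ 0] sos_on.sos_on_zero) simp
  next
    case (sos_on_step s a)
    then obtain t b where "t \<in> sos" "s = abs_rdom t" "a = abs_rdom b" using abs_rdom_surj by blast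
    then show ?case
      by (intro bexI[of _ "t + b * b"] sos_on.sos_on_step) (simp_all add: hom_add hom_mult)
  qed
  then obtain t b where t: "t \<in> sos" "s = abs_rdom t" "a = abs_rdom b" using abs_rdom_surj by blast
  then have "t + b * b \<in> bad_prime"
    using s(2) by (simp flip: abs_rdom_eq_0_iff add: hom_add hom_mult)
  with t(1) have "b \<in> bad_prime" by (rule real_bad_prime)
  then show "a = 0" by (simp add: t abs_rdom_eq_0_iff)
qed

text \<open>A sum of squares of fractions can be written over a common denominator that is itself a
  square, with a sum of squares as numerator; clearing it leads back to the domain.\<close>

instance fract :: (formally_real) formally_real
proof (rule formally_realI)
  fix s a :: "'a fract"
  assume s: "s \<in> sos" "s + a * a = 0"
  from s(1) have "\<exists>t d. t \<in> sos \<and> d \<noteq> 0 \<and> s = Fract t (d * d)"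
  proof (induction rule: sos_on.induct)
    case sos_on_zero
    show ?case
      by (intro exI[of _ 0] exI[of _ 1]) (simp add: sos_on.sos_on_zero fract_collapse)
  next
    case (sos_on_step s a)
    then obtain t d where t: "t \<in> sos" "d \<noteq> 0" "s = Fract t (d * d)" by blast
    obtain u v where a: "a = Fract u v" "v \<noteq> 0" by (rule Fract_cases)
    have "s + a * a = Fract (t * (v * v) + (u * d) * (u * d)) ((d * v) * (d * v))"
      using t a by (simp add: mult_ac)
    moreover have "t * (v * v) + (u * d) * (u * d) \<in> sos"
      by (intro sos_on.sos_on_step sos_mult_square t) simp
    ultimately show ?case using t(2) a(2) by (metis no_zero_divisors)
  qed
  then obtain t d where t: "t \<in> sos" "d \<noteq> 0" "s = Fract t (d * d)" by blast
  obtain u v where a: "a = Fract u v" "v \<noteq> 0" by (rule Fract_cases)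
  have "Fract (t * (v * v) + (u * d) * (u * d)) ((d * v) * (d * v)) = 0"
    using s(2) t a by (simp add: mult_ac)
  then have "t * (v * v) + (u * d) * (u * d) = 0"
    using t(2) a(2) by (simp add: Zero_fract_def eq_fract)
  then have "u * d = 0"
    using square_plus_sos_eq_0 sos_mult_square[OF t(1), of v] by blast
  then show "a = 0" using t(2) a by (simp add: fract_collapse)
qed

lemma no_counterexample_prime: "\<not> counterexample_prime (q :: 'v::finite rpoly set)"
proof
  assume "counterexample_prime q"
  from counterexample_bad_prime[OF this] obtain f where f: "f \<notin> (bad_prime :: 'v rpoly set)"
    "\<And>x. \<forall>g\<in>bad_prime. ev g x = 0 \<Longrightarrow> ev f x = 0"
    by (auto simp: counterexample_prime_def)
  \<comment> \<open>The generic point: its coordinates are the images of the variables in the real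
    closure of the residue field, and its kernel is exactly \<open>bad_prime\<close>.\<close>
  define h where "h g = to_rclos (Fract (abs_rdom g) 1)" for g :: "'v rpoly"
  have "cring_hom (\<lambda>a :: 'v rdom. Fract a 1)"
    by standard (simp_all add: One_fract_def)
  from cring_hom_comp[OF cring_hom_to_rclos cring_hom_comp[OF this cring_hom_abs_rdom]]
  have hom: "cring_hom h" unfolding h_def .
  have h0: "h g = 0 \<longleftrightarrow> g \<in> bad_prime" for g
    by (simp add: h_def to_rclos_eq_0_iff Zero_fract_def eq_fract abs_rdom_eq_0_iff)
  obtain F where F: "finite F" "F \<subseteq> bad_prime" "bad_prime \<subseteq> gen_by UNIV (F :: 'v rpoly set)"
    using noetherian_rpoly ideal_bad_prime unfolding noetherian_set_def by blast
  obtain x where x: "\<forall>g\<in>insert f F. sg (h g) = sg (ev g x)"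
    using multivariate_transfer[OF finite hom, of UNIV "insert f F"] F(1) by auto
  have evF: "ev g x = 0" if "g \<in> F" for g
    using bspec[OF x, of g] that F(2) h0[of g] by (auto simp: subset_iff)
  have "ev g x = 0" if "g \<in> gen_by UNIV F" for g
    using that by (induction rule: gen_by.induct) (auto simp: evF)
  then have "ev f x = 0" using f(2) F(3) by blast
  moreover have "sg (h f) \<noteq> 0" using h0[of f] f(1) by simp
  ultimately show False using x by simp
qed

lemma sos_power_square: "(f * f) ^ m \<in> sos"
  by (induction m) (simp_all add: sos_one sos_mult sos_square)

theorem real_nullstellensatz:
  fixes J :: "'v::finite rpoly set"
  assumes J: "ideal_in UNIV J" and f: "\<And>x. \<forall>g\<in>J. ev g x = 0 \<Longrightarrow> ev f x = 0"
  shows "\<exists>m. \<exists>s\<in>sos. (f * f) ^ m + s \<in> J"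
proof (rule ccontr)
  assume none: "\<not> ?thesis"
  let ?A = "{p. ideal_in UNIV p \<and> J \<subseteq> p \<and> (\<forall>m. \<forall>s\<in>sos. (f * f) ^ m + s \<notin> p)}"
  have "\<exists>M\<in>?A. \<forall>N\<in>?A. M \<subseteq> N \<longrightarrow> N = M"
  proof (rule subset_Zorn_nonempty)
    show "?A \<noteq> {}" using J none by blast
    fix C assume C: "C \<noteq> {}" "subset.chain ?A C"
    have CA: "ideal_in UNIV p" "J \<subseteq> p" "\<forall>m. \<forall>s\<in>sos. (f * f) ^ m + s \<notin> p" if "p \<in> C" for p
      using C(2) that by (auto simp: subset_chain_def)
    have chain: "p \<subseteq> q \<or> q \<subseteq> p" if "p \<in> C" "q \<in> C" for p q
      using C(2) that by (auto simp: subset_chain_def)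
    obtain p0 where p0: "p0 \<in> C" using C(1) by blast
    have "x + y \<in> \<Union>C" if "x \<in> \<Union>C" "y \<in> \<Union>C" for x y
    proof -
      obtain p q where "p \<in> C" "x \<in> p" "q \<in> C" "y \<in> q"
        using \<open>x \<in> \<Union>C\<close> \<open>y \<in> \<Union>C\<close> by blast
      then obtain r where r: "r \<in> C" "x \<in> r" "y \<in> r" using chain[of p q] by blast
      then show ?thesis using ideal_inD(2)[OF CA(1)[OF r(1)]] by blast
    qed
    moreover have "b * x \<in> \<Union>C" if "x \<in> \<Union>C" for b x
    proof -
      obtain p where p: "p \<in> C" "x \<in> p" using \<open>x \<in> \<Union>C\<close> by blast
      show ?thesis using ideal_inD(3)[OF CA(1)[OF p(1)] p(2)] p(1) by blast
    qed
    moreover have "0 \<in> \<Union>C" using ideal_inD(1)[OF CA(1)[OF p0]] p0 by blast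
    ultimately have "ideal_in UNIV (\<Union>C)" by (simp add: ideal_in_def)
    moreover have "J \<subseteq> \<Union>C" using CA(2)[OF p0] p0 by blast
    moreover have "\<forall>m. \<forall>s\<in>sos. (f * f) ^ m + s \<notin> \<Union>C" using CA(3) by blast
    ultimately show "\<Union>C \<in> ?A" by simp
  qed
  then obtain p where p: "ideal_in UNIV p" "J \<subseteq> p" "\<And>m s. s \<in> sos \<Longrightarrow> (f * f) ^ m + s \<notin> p"
    and max: "\<And>N. ideal_in UNIV N \<Longrightarrow> J \<subseteq> N \<Longrightarrow> \<forall>m. \<forall>s\<in>sos. (f * f) ^ m + s \<notin> N \<Longrightarrow> p \<subseteq> N \<Longrightarrow> N = p"
    by auto
  note pI = ideal_inD[OF p(1)]
  \<comment> \<open>By maximality the ideal generated by \<open>p\<close> and \<open>a\<close>,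
    called \<open>N\<close> below, contains one of the forbidden elements.\<close>
  have outside: "\<exists>m s y. s \<in> sos \<and> (f * f) ^ m + s - a * y \<in> p" if "a \<notin> p" for a
  proof (rule ccontr)
    assume no: "\<not> ?thesis"
    define N where "N = {x. \<exists>y. x - a * y \<in> p}"
    have "ideal_in UNIV N"
      unfolding ideal_in_def
    proof (intro conjI ballI)
      show "0 \<in> N" using pI(1) by (auto simp: N_def intro!: exI[of _ 0])
      fix x y assume "x \<in> N" "y \<in> N"
      then obtain u v where "x - a * u \<in> p" "y - a * v \<in> p" by (auto simp: N_def)
      from pI(2)[OF this] show "x + y \<in> N"
        unfolding N_def by (intro CollectI exI[of _ "u + v"]) (simp add: algebra_simps)
    next
      fix b x assume "x \<in> N"
      then obtain u where "x - a * u \<in> p" by (auto simp: N_def)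
      from pI(3)[OF this, of b] show "b * x \<in> N"
        unfolding N_def by (intro CollectI exI[of _ "b * u"]) (simp add: algebra_simps)
    qed simp
    moreover have pN: "p \<subseteq> N" by (auto simp: N_def intro!: exI[of _ 0])
    moreover have "\<forall>m. \<forall>s\<in>sos. (f * f) ^ m + s \<notin> N" using no by (auto simp: N_def)
    ultimately have "N = p" using max p(2) by blast
    moreover have "a \<in> N" using pI(1) by (auto simp: N_def intro!: exI[of _ 1])
    ultimately show False using that by simp
  qed
  have prime: "a \<in> p \<or> b \<in> p" if "a * b \<in> p" for a b
  proof (rule ccontr)
    assume "\<not> ?thesis"
    then have notin: "a \<notin> p" "b \<notin> p" by simp_all
    obtain m s y where s: "s \<in> sos" "(f * f) ^ m + s - a * y \<in> p"
      using outside[OF notin(1)] by blast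
    obtain k t z where t: "t \<in> sos" "(f * f) ^ k + t - b * z \<in> p"
      using outside[OF notin(2)] by blast
    define u v where "u = (f * f) ^ m + s" and "v = (f * f) ^ k + t"
    have "u - a * y \<in> p" "v - b * z \<in> p" using s(2) t(2) by (simp_all add: u_def v_def)
    \<comment> \<open>The sum equals \<open>u * v\<close>, and a product of two forbidden elements
      is again a power of \<open>f * f\<close> plus a sum of squares.\<close>
    then have "(u - a * y) * v + a * y * (v - b * z) + y * z * (a * b) \<in> p"
      by (intro pI(2) pI(4)[of "u - a * y"] pI(3)[of "v - b * z"] pI(3)[OF that])
    then have "u * v \<in> p" by (simp add: algebra_simps)
    then have "(f * f) ^ (m + k) + ((f * f) ^ m * t + (s * (f * f) ^ k + s * t)) \<in> p"
      by (simp add: u_def v_def power_add algebra_simps)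
    moreover have "(f * f) ^ m * t + (s * (f * f) ^ k + s * t) \<in> sos"
      by (intro sos_add sos_mult sos_power_square s(1) t(1))
    from p(3)[OF this] have "(f * f) ^ (m + k) + ((f * f) ^ m * t + (s * (f * f) ^ k + s * t)) \<notin> p" .
    ultimately show False by contradiction
  qed
  have real: "a \<in> p" if "s \<in> sos" "s + a * a \<in> p" for s a
  proof (rule ccontr)
    assume "a \<notin> p"
    from outside[OF this] obtain m t y where t: "t \<in> sos" "(f * f) ^ m + t - a * y \<in> p"
      by blast
    define u where "u = (f * f) ^ m + t"
    have "u - a * y \<in> p" using t(2) by (simp add: u_def)
    \<comment> \<open>The terms with \<open>a * a\<close> cancel and leave
      \<open>u * u + s * (y * y)\<close>, again a forbidden element.\<close>
    then have "(u - a * y) * (u + a * y) + (s + a * a) * (y * y) \<in> p"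
      by (intro pI(2) pI(4)[of "u - a * y"] pI(4)[OF that(2)])
    then have "u * u + s * (y * y) \<in> p" by (simp add: algebra_simps)
    then have "(f * f) ^ (m + m) + ((f * f) ^ m * t + (t * (f * f) ^ m + (t * t + s * (y * y)))) \<in> p"
      by (simp add: u_def power_add algebra_simps)
    moreover have "(f * f) ^ m * t + (t * (f * f) ^ m + (t * t + s * (y * y))) \<in> sos"
      by (intro sos_add sos_mult sos_power_square sos_square t(1) that(1))
    from p(3)[OF this] have "(f * f) ^ (m + m) +
      ((f * f) ^ m * t + (t * (f * f) ^ m + (t * t + s * (y * y)))) \<notin> p" .
    ultimately show False by contradiction
  qed
  \<comment> \<open>The forbidden elements with \<open>s = 0\<close> and exponents 0 and 1 are 1 and
    \<open>f * f\<close>.\<close>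
  have "1 \<notin> p" using p(3)[OF sos_on_zero, of 0] by simp
  then have "real_prime p"
    using p(1) prime real unfolding real_prime_def by blast
  moreover have "f \<notin> p" using p(3)[OF sos_on_zero, of 1] pI(3)[of f f] by auto
  moreover have "ev f x = 0" if "\<forall>g\<in>p. ev g x = 0" for x
    using f[of x] p(2) that by blast
  ultimately have "counterexample_prime p" by (auto simp: counterexample_prime_def)
  then show False using no_counterexample_prime by blast
qed

section \<open>Quaternionic polynomial functions and their real components\<close>

definition qreal :: "real \<Rightarrow> quat" where
  "qreal r = Quat r 0 0 0"

lemma qreal_sel [simp]: "qre (qreal r) = r" "qi (qreal r) = 0" "qj (qreal r) = 0" "qk (qreal r) = 0"
  by (simp_all add: qreal_def)

lemma qreal_hom: "qreal (r + s) = qreal r + qreal s" "qreal (r * s) = qreal r * qreal s"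
  "qreal 0 = 0" "qreal 1 = 1"
  by (simp_all add: quat_eq_iff)

lemma qreal_power: "qreal r ^ m = qreal (r ^ m)"
  by (induction m) (simp_all add: qreal_hom)

lemma qreal_sum: "qreal (sum f A) = (\<Sum>i\<in>A. qreal (f i))"
  by (induction A rule: infinite_finite_induct) (simp_all add: qreal_hom)

lemma qcnj_sel [simp]: "qre (qcnj q) = qre q" "qi (qcnj q) = - qi q" "qj (qcnj q) = - qj q" "qk (qcnj q) = - qk q"
  by (simp_all add: qcnj_def)

lemma qcnj_mult: "qcnj (p * q) = qcnj q * qcnj p"
  by (simp add: quat_eq_iff algebra_simps)

lemma qcnj_qreal: "qcnj (qreal r) = qreal r"
  by (simp add: quat_eq_iff)

definition qnorm2 :: "quat \<Rightarrow> real" where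
  "qnorm2 q = qre q * qre q + qi q * qi q + qj q * qj q + qk q * qk q"

lemma mult_qcnj: "q * qcnj q = qreal (qnorm2 q)"
  by (simp add: quat_eq_iff qnorm2_def algebra_simps)

lemma qnorm2_nonneg: "0 \<le> qnorm2 q"
  by (simp add: qnorm2_def)

lemma qnorm2_eq_0_iff: "qnorm2 q = 0 \<longleftrightarrow> q = 0"
  by (auto simp: qnorm2_def quat_eq_iff add_nonneg_eq_0_iff)

lemma qre_eq_sandwich:
  "qreal (qre q) = qreal (1 / 4) * (q - quat_i * q * quat_i - quat_j * q * quat_j - quat_k * q * quat_k)"
  by (simp add: quat_eq_iff quat_i_def quat_j_def quat_k_def)

lemma quat_components:
  "qi q = qre (- quat_i * q)" "qj q = qre (- quat_j * q)" "qk q = qre (- quat_k * q)"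
  by (simp_all add: quat_i_def quat_j_def quat_k_def)

text \<open>The two booleans name the four components, so the index type is finite with four
  elements for each quaternionic variable, as \<open>real_nullstellensatz\<close> requires.\<close>

definition coords :: "quat ^ 'n \<Rightarrow> 'n \<times> bool \<times> bool \<Rightarrow> real" where
  "coords x = (\<lambda>(\<mu>, b, c). if b then if c then qre (x $ \<mu>) else qi (x $ \<mu>)
     else if c then qj (x $ \<mu>) else qk (x $ \<mu>))"

lemma coords_surj: "\<exists>x. coords x = y"
proof
  show "coords (\<chi> \<mu>. Quat (y (\<mu>, True, True)) (y (\<mu>, True, False)) (y (\<mu>, False, True)) (y (\<mu>, False, False))) = y"
    by (auto simp: coords_def fun_eq_iff)
qed

lemma qpoly_qre:
  assumes "f \<in> qpoly_funs"
  shows "(\<lambda>x. qreal (qre (f x))) \<in> qpoly_funs"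
proof -
  have "qreal (qre q) = qreal (1 / 2) * (q + qcnj q)" for q
    by (simp add: quat_eq_iff)
  then show ?thesis
    using assms by (simp add: qpoly_mult qpoly_add qpoly_const qpoly_cnj)
qed

definition lift_real :: "('n \<times> bool \<times> bool) rpoly \<Rightarrow> quat ^ 'n \<Rightarrow> quat" where
  "lift_real g = (\<lambda>x. qreal (ev g (coords x)))"

text \<open>The real coordinates are themselves quaternionic polynomial functions: half the sum of a
  quaternion and its conjugate is its real part, and left multiplication by -i, -j or -k moves
  another component into the real part.\<close>

lemma lift_real_qpoly: "lift_real g \<in> qpoly_funs"
proof (induction g rule: rpoly_induct)
  case (Cst c)
  then show ?case by (simp add: lift_real_def qpoly_const)
next
  case (Var v)
  obtain \<mu> b c where v: "v = (\<mu>, b, c)" by (cases v)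
  have "(\<lambda>x. qreal (qre (d * x $ \<mu>))) \<in> qpoly_funs" for d
    by (intro qpoly_qre qpoly_mult qpoly_const qpoly_var)
  from this[of 1] this[of "- quat_i"] this[of "- quat_j"] this[of "- quat_k"] show ?case
    by (cases b; cases c) (simp_all only: v lift_real_def Var.rep_eq coords_def prod.case if_True if_False
        quat_components[symmetric] mult_1)
next
  case (add f g)
  then show ?case using qpoly_add[of "lift_real f" "lift_real g"] by (simp add: lift_real_def qreal_hom)
next
  case (mult f g)
  then show ?case using qpoly_mult[of "lift_real f" "lift_real g"] by (simp add: lift_real_def qreal_hom)
qed

definition real_components :: "(quat ^ 'n \<Rightarrow> quat) \<Rightarrow> bool" where
  "real_components f \<longleftrightarrow> (\<exists>a b c d. \<forall>x. f x = Quat (ev a (coords x)) (ev b (coords x)) (ev c (coords x)) (ev d (coords x)))"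

lemma real_components_const: "real_components (\<lambda>x. q)"
  unfolding real_components_def
  by (intro exI[of _ "Cst (qre q)"] exI[of _ "Cst (qi q)"] exI[of _ "Cst (qj q)"] exI[of _ "Cst (qk q)"]) simp

lemma real_components_var: "real_components (\<lambda>x. x $ \<mu>)"
  unfolding real_components_def
  by (intro exI[of _ "Var (\<mu>, True, True)"] exI[of _ "Var (\<mu>, True, False)"]
      exI[of _ "Var (\<mu>, False, True)"] exI[of _ "Var (\<mu>, False, False)"]) (simp add: coords_def)

lemma real_components_add:
  assumes "real_components f" "real_components g"
  shows "real_components (\<lambda>x. f x + g x)"
proof -
  obtain a b c d a' b' c' d' where
    "\<And>x. f x = Quat (ev a (coords x)) (ev b (coords x)) (ev c (coords x)) (ev d (coords x))"
    "\<And>x. g x = Quat (ev a' (coords x)) (ev b' (coords x)) (ev c' (coords x)) (ev d' (coords x))"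
    using assms unfolding real_components_def by blast
  then show ?thesis
    unfolding real_components_def
    by (intro exI[of _ "a + a'"] exI[of _ "b + b'"] exI[of _ "c + c'"] exI[of _ "d + d'"])
      (simp add: quat_eq_iff)
qed

lemma real_components_mult:
  assumes "real_components f" "real_components g"
  shows "real_components (\<lambda>x. f x * g x)"
proof -
  obtain a b c d a' b' c' d' where
    "\<And>x. f x = Quat (ev a (coords x)) (ev b (coords x)) (ev c (coords x)) (ev d (coords x))"
    "\<And>x. g x = Quat (ev a' (coords x)) (ev b' (coords x)) (ev c' (coords x)) (ev d' (coords x))"
    using assms unfolding real_components_def by blast
  then show ?thesis
    unfolding real_components_def
    by (intro exI[of _ "a * a' - b * b' - c * c' - d * d'"] exI[of _ "a * b' + b * a' + c * d' - d * c'"]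
        exI[of _ "a * c' - b * d' + c * a' + d * b'"] exI[of _ "a * d' + b * c' - c * b' + d * a'"])
      (simp add: quat_eq_iff)
qed

lemma real_components_qmonom: "real_components (qmonom (w, c))"
proof (induction w)
  case Nil
  then show ?case by (simp add: qmonom_def real_components_const)
next
  case (Cons p w)
  obtain a \<mu> where "p = (a, \<mu>)" by (cases p)
  then have "qmonom (p # w, c) = (\<lambda>x. (a * x $ \<mu>) * qmonom (w, c) x)"
    by (simp add: qmonom_def fun_eq_iff mult.assoc)
  then show ?case
    using Cons by (simp add: real_components_mult real_components_const real_components_var)
qed

lemma real_components_qpoly:
  assumes "f \<in> qpoly_funs"
  shows "real_components f"
proof -
  obtain ts where ts: "f = (\<lambda>x. \<Sum>t\<leftarrow>ts. qmonom t x)"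
    using assms unfolding qpoly_funs_def by blast
  show ?thesis unfolding ts
  proof (induction ts)
    case Nil
    then show ?case by (simp add: real_components_const)
  next
    case (Cons t ts)
    then show ?case
      using real_components_qmonom[of "fst t" "snd t"] by (simp add: real_components_add)
  qed
qed

lemma qpoly_qre_rpoly:
  assumes "f \<in> qpoly_funs"
  obtains g where "\<And>x. ev g (coords x) = qre (f x)"
  using real_components_qpoly[OF assms] unfolding real_components_def by (metis quat.sel(1))


section \<open>Ideals of quaternionic polynomial functions\<close>

lemma qpoly_ring_sel [simp]: "carrier qpoly_ring = qpoly_funs"
  "f \<otimes>\<^bsub>qpoly_ring\<^esub> g = (\<lambda>x. f x * g x)" "f \<oplus>\<^bsub>qpoly_ring\<^esub> g = (\<lambda>x. f x + g x)"
  "\<zero>\<^bsub>qpoly_ring\<^esub> = (\<lambda>x. 0)"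
  by (simp_all add: qpoly_ring_def)

lemma ideal_qpolyD:
  assumes "ideal I qpoly_ring"
  shows "f \<in> I \<Longrightarrow> f \<in> qpoly_funs" "(\<lambda>x. 0) \<in> I"
    "f \<in> I \<Longrightarrow> g \<in> I \<Longrightarrow> (\<lambda>x. f x + g x) \<in> I"
    "f \<in> I \<Longrightarrow> r \<in> qpoly_funs \<Longrightarrow> (\<lambda>x. r x * f x) \<in> I"
    "f \<in> I \<Longrightarrow> r \<in> qpoly_funs \<Longrightarrow> (\<lambda>x. f x * r x) \<in> I"
proof -
  interpret ideal I qpoly_ring by (rule assms)
  show "f \<in> I \<Longrightarrow> f \<in> qpoly_funs" using a_subset by auto
  show "(\<lambda>x. 0) \<in> I" using additive_subgroup.zero_closed[OF is_additive_subgroup] by simp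
  show "f \<in> I \<Longrightarrow> g \<in> I \<Longrightarrow> (\<lambda>x. f x + g x) \<in> I" using additive_subgroup.a_closed[OF is_additive_subgroup, of f g] by simp
  show "f \<in> I \<Longrightarrow> r \<in> qpoly_funs \<Longrightarrow> (\<lambda>x. r x * f x) \<in> I" using I_l_closed[of f r] by simp
  show "f \<in> I \<Longrightarrow> r \<in> qpoly_funs \<Longrightarrow> (\<lambda>x. f x * r x) \<in> I" using I_r_closed[of f r] by simp
qed

text \<open>The identity \<open>4 Re q = q - i q i - j q j - k q k\<close> needs the ideal to be two-sided.\<close>

lemma ideal_qpoly_qre:
  assumes "ideal I qpoly_ring" "f \<in> I"
  shows "(\<lambda>x. qreal (qre (f x))) \<in> I"
proof -
  note I = ideal_qpolyD[OF assms(1)]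
  have sandwich: "(\<lambda>x. q * f x * r) \<in> I" for q r
    using I(5)[OF I(4)[OF assms(2) qpoly_const[of q]] qpoly_const[of r]] .
  have minus: "(\<lambda>x. g x - q * f x * r) \<in> I" if "g \<in> I" for g q r
    using I(3)[OF that sandwich[of "- q" r]] by simp
  have "(\<lambda>x. f x - quat_i * f x * quat_i - quat_j * f x * quat_j - quat_k * f x * quat_k) \<in> I"
    by (intro minus assms(2))
  from I(4)[OF this qpoly_const[of "qreal (1 / 4)"]] show ?thesis
    by (simp only: qre_eq_sandwich)
qed

lemma ideal_in_lift_real:
  assumes "ideal I qpoly_ring"
  shows "ideal_in UNIV {g. lift_real g \<in> I}"
  unfolding ideal_in_def
proof (intro conjI ballI)
  note I = ideal_qpolyD[OF assms]
  show "0 \<in> {g. lift_real g \<in> I}" using I(2) by (simp add: lift_real_def qreal_hom)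
  fix f g assume "f \<in> {g. lift_real g \<in> I}" "g \<in> {g. lift_real g \<in> I}"
  then show "f + g \<in> {g. lift_real g \<in> I}"
    using I(3)[of "lift_real f" "lift_real g"] by (simp add: lift_real_def qreal_hom)
next
  note I = ideal_qpolyD[OF assms]
  fix b g assume "g \<in> {g. lift_real g \<in> I}"
  then show "b * g \<in> {g. lift_real g \<in> I}"
    using I(4)[OF _ lift_real_qpoly[of b], of "lift_real g"] by (simp add: lift_real_def qreal_hom)
qed simp

text \<open>The ideal contains the real parts of \<open>f\<close> and of its left multiples by -i,
  -j and -k, and these are the four components of \<open>f\<close>.\<close>

lemma zero_set_lift_real:
  assumes "ideal I qpoly_ring" "\<forall>g. lift_real g \<in> I \<longrightarrow> ev g (coords x) = 0"
  shows "x \<in> zero_set I"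
proof -
  have re: "qre (f x) = 0" if "f \<in> I" for f
  proof -
    obtain g where g: "\<And>x. ev g (coords x) = qre (f x)"
      using qpoly_qre_rpoly[OF ideal_qpolyD(1)[OF assms(1) \<open>f \<in> I\<close>]] by blast
    have "lift_real g \<in> I"
      using ideal_qpoly_qre[OF assms(1) that] by (simp add: lift_real_def g)
    then show ?thesis using assms(2) g by metis
  qed
  have "f x = 0" if "f \<in> I" for f
  proof -
    have "qre (q * f x) = 0" for q
      using re[OF ideal_qpolyD(4)[OF assms(1) that qpoly_const]] .
    from this[of "- quat_i"] this[of "- quat_j"] this[of "- quat_k"] re[OF that] show ?thesis
      unfolding quat_eq_iff quat_components[of "f x"] by simp
  qed
  then show ?thesis by (simp add: zero_set_def)
qed

lemma vanishing_ideal_subset_radical: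
  assumes I: "ideal I (qpoly_ring :: (quat ^ 'n \<Rightarrow> quat) ring)" and f: "f \<in> vanishing_ideal (zero_set I)"
  shows "f \<in> quat_radical I"
proof -
  have fR: "f \<in> qpoly_funs" and f0: "\<And>a. a \<in> zero_set I \<Longrightarrow> f a = 0"
    using f by (auto simp: vanishing_ideal_def)
  obtain N where N: "\<And>x. ev N (coords x) = qre (f x * qcnj (f x))"
    using qpoly_qre_rpoly[OF qpoly_mult[OF fR qpoly_cnj[OF fR]]] by blast
  then have N: "\<And>x. ev N (coords x) = qnorm2 (f x)" by (simp add: mult_qcnj)
  have "ev N y = 0" if "\<forall>g\<in>{g. lift_real g \<in> I}. ev g y = 0" for y
  proof -
    obtain x where x: "y = coords x" using coords_surj by metis
    have "x \<in> zero_set I"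
      using zero_set_lift_real[OF I] that x by simp
    then show ?thesis by (simp add: x N f0 qnorm2_eq_0_iff)
  qed
  from real_nullstellensatz[OF ideal_in_lift_real[OF I] this] obtain m s where
    s: "s \<in> sos" "lift_real ((N * N) ^ m + s) \<in> I" by blast
  obtain l :: nat and h where h: "s = (\<Sum>i<l. h i * h i)"
    using sos_onE_sum[OF s(1)] by metis
  interpret e: cring_hom "\<lambda>g. ev g y" for y by (rule cring_hom_ev)
  \<comment> \<open>\<open>N\<close> is the real function \<open>f * qcnj f\<close>, so
    \<open>N * N\<close> contributes its square; a real function is its own conjugate, so each
    square in \<open>s\<close> already has the form required by the radical.\<close>
  have "lift_real ((N * N) ^ m + s) =
      (\<lambda>a. (f a * qcnj (f a)) ^ (2 * m) + (\<Sum>i<l. lift_real (h i) a * qcnj (lift_real (h i) a)))"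
    by (simp add: fun_eq_iff lift_real_def h qreal_hom e.hom_power e.hom_sum qreal_sum mult_qcnj N
        qcnj_qreal power_mult power2_eq_square flip: qreal_power)
  then have "\<exists>m (l::nat) g. (\<forall>i<l. g i \<in> carrier qpoly_ring) \<and>
      (\<lambda>a. (f a * qcnj (f a)) ^ m + (\<Sum>i<l. g i a * qcnj (g i a))) \<in> I"
    using s(2)
    by - (rule exI[of _ "2 * m"], rule exI[of _ l], rule exI[of _ "\<lambda>i. lift_real (h i)"],
        simp add: lift_real_qpoly)
  then show ?thesis using fR by (simp add: quat_radical_def)
qed

lemma sum_mult_qcnj: "(\<Sum>i\<in>A. q i * qcnj (q i)) = qreal (\<Sum>i\<in>A. qnorm2 (q i))"
  by (simp add: mult_qcnj qreal_sum)

lemma qreal_eq_0_iff: "qreal r = 0 \<longleftrightarrow> r = 0"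
  by (simp add: quat_eq_iff)

lemma radical_subset_vanishing_ideal:
  assumes "f \<in> quat_radical I"
  shows "f \<in> vanishing_ideal (zero_set I)"
proof -
  obtain m and l :: nat and g where fR: "f \<in> qpoly_funs"
    and in_I: "(\<lambda>a. (f a * qcnj (f a)) ^ m + (\<Sum>i<l. g i a * qcnj (g i a))) \<in> I"
    using assms by (auto simp: quat_radical_def)
  have "f a = 0" if "a \<in> zero_set I" for a
  proof -
    have "(f a * qcnj (f a)) ^ m + (\<Sum>i<l. g i a * qcnj (g i a)) = 0"
      using in_I that by (auto simp: zero_set_def)
    then have "qreal (qnorm2 (f a) ^ m + (\<Sum>i<l. qnorm2 (g i a))) = 0"
      by (simp add: mult_qcnj qreal_power qreal_hom qreal_sum)
    then have "qnorm2 (f a) ^ m + (\<Sum>i<l. qnorm2 (g i a)) = 0"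
      by (simp only: qreal_eq_0_iff)
    then have "qnorm2 (f a) ^ m = 0"
      by (simp add: add_nonneg_eq_0_iff qnorm2_nonneg sum_nonneg)
    \<comment> \<open>For \<open>m = 0\<close> the equation reads 1 = 0, so the zero set is empty in
      that case.\<close>
    then show ?thesis by (simp add: qnorm2_eq_0_iff)
  qed
  then show ?thesis using fR by (simp add: vanishing_ideal_def)
qed

lemma ideal_vanishing_ideal: "ideal (vanishing_ideal Z) qpoly_ring"
proof (rule idealI[OF ring_qpoly_ring])
  interpret ring qpoly_ring by (rule ring_qpoly_ring)
  show "subgroup (vanishing_ideal Z) (add_monoid qpoly_ring)"
  proof (rule add.subgroupI)
    show "vanishing_ideal Z \<noteq> {}"
      using qpoly_const[of 0] by (auto simp: vanishing_ideal_def)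
    fix f assume f: "f \<in> vanishing_ideal Z"
    then have fR: "f \<in> qpoly_funs" by (simp add: vanishing_ideal_def)
    have "\<ominus>\<^bsub>qpoly_ring\<^esub> f = (\<lambda>x. - f x)"
      using fR qpoly_uminus[OF fR] by (intro minus_equality) simp_all
    then show "\<ominus>\<^bsub>qpoly_ring\<^esub> f \<in> vanishing_ideal Z"
      using f qpoly_uminus[OF fR] by (simp add: vanishing_ideal_def)
  qed (auto simp: vanishing_ideal_def qpoly_add)
qed (auto simp: vanishing_ideal_def qpoly_mult)

lemma vanishing_ideal_sum_squares:
  assumes "\<forall>i<l. f i \<in> qpoly_funs" "(\<lambda>a. \<Sum>i<l. f i a * qcnj (f i a)) \<in> vanishing_ideal Z" "i < (l::nat)"
  shows "f i \<in> vanishing_ideal Z"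
proof -
  have "f i a = 0" if "a \<in> Z" for a
  proof -
    have "(\<Sum>i<l. f i a * qcnj (f i a)) = 0"
      using assms(2) that by (simp add: vanishing_ideal_def)
    then have "(\<Sum>i<l. qnorm2 (f i a)) = 0"
      by (simp only: sum_mult_qcnj qreal_eq_0_iff)
    then have "qnorm2 (f i a) = 0"
      using assms(3) by (simp add: sum_nonneg_eq_0_iff qnorm2_nonneg)
    then show ?thesis by (simp add: qnorm2_eq_0_iff)
  qed
  then show ?thesis using assms(1,3) by (simp add: vanishing_ideal_def)
qed

lemma qpoly_power: "f \<in> qpoly_funs \<Longrightarrow> (\<lambda>x. f x ^ m) \<in> qpoly_funs"
  by (induction m) (simp_all add: qpoly_const qpoly_mult)

text \<open>For the reverse inclusion, the radical gives a power of \<open>N\<close> plus a sum of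
  terms g \<open>qcnj\<close> g in \<open>I\<close>. The power has this form as well, so the
  condition puts its factor \<open>h m\<close> into \<open>I\<close>, hence \<open>N ^ m\<close>,
  and the exponent can then be lowered until \<open>f\<close> is reached.\<close>

lemma real_ideal_eq_vanishing_ideal:
  assumes I: "ideal I (qpoly_ring :: (quat ^ 'n \<Rightarrow> quat) ring)"
    and sums: "\<And>l (f :: nat \<Rightarrow> quat ^ 'n \<Rightarrow> quat) i. (\<forall>i<l. f i \<in> qpoly_funs) \<Longrightarrow>
      (\<lambda>a. \<Sum>i<l. f i a * qcnj (f i a)) \<in> I \<Longrightarrow> i < l \<Longrightarrow> f i \<in> I"
  shows "I = vanishing_ideal (zero_set I)"
proof
  note closed = ideal_qpolyD[OF I]
  show "I \<subseteq> vanishing_ideal (zero_set I)"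
    using closed(1) by (auto simp: vanishing_ideal_def zero_set_def)
  have single: "h \<in> I" if "h \<in> qpoly_funs" "(\<lambda>a. h a * qcnj (h a)) \<in> I" for h
    using sums[of 1 "\<lambda>_. h" 0] that by simp
  show "vanishing_ideal (zero_set I) \<subseteq> I"
  proof
    fix f assume "f \<in> vanishing_ideal (zero_set I)"
    from vanishing_ideal_subset_radical[OF I this] obtain m and l :: nat and g where
      fR: "f \<in> qpoly_funs" and gR: "\<forall>i<l. g i \<in> qpoly_funs"
      and rad: "(\<lambda>a. (f a * qcnj (f a)) ^ m + (\<Sum>i<l. g i a * qcnj (g i a))) \<in> I"
      by (auto simp: quat_radical_def)
    define N where "N a = f a * qcnj (f a)" for a
    have N: "N a = qreal (qnorm2 (f a))" for a by (simp add: N_def mult_qcnj)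
    have NR: "N \<in> qpoly_funs" unfolding N_def by (intro qpoly_mult qpoly_cnj fR)
    \<comment> \<open>A factor with \<open>h k * qcnj (h k) = N ^ k\<close>; for odd
      \<open>k\<close> the missing half power of \<open>N\<close> is supplied by
      \<open>f\<close>.\<close>
    define h where "h k = (if even k then (\<lambda>a. N a ^ (k div 2)) else (\<lambda>a. N a ^ (k div 2) * f a))" for k
    have hR: "h k \<in> qpoly_funs" for k
      by (simp add: h_def qpoly_mult qpoly_power NR fR)
    have h_square: "h k a * qcnj (h k a) = N a ^ k" for k a
    proof (cases "even k")
      case True
      then obtain j where "k = 2 * j" by blast
      then show ?thesis
        by (simp add: h_def N qreal_power qcnj_qreal flip: qreal_hom power_mult_distrib)
          (simp add: power_mult power2_eq_square power_mult_distrib)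
    next
      case False
      then obtain j where k: "k = 2 * j + 1" by (rule oddE)
      have "h k a * qcnj (h k a) = N a ^ j * (f a * qcnj (f a)) * N a ^ j"
        using k by (simp add: h_def qcnj_mult N qreal_power qcnj_qreal mult.assoc)
      also have "\<dots> = N a ^ (j + 1 + j)" unfolding N_def[symmetric] by (simp only: power_add power_one_right)
      finally show ?thesis by (simp add: k mult_2)
    qed
    \<comment> \<open>Multiplying by the conjugate of \<open>f\<close> turns the factor
      \<open>f\<close> into another \<open>N\<close>. For odd \<open>k > 1\<close> the new exponent
      is still smaller than \<open>k\<close>.\<close>
    have up: "(\<lambda>a. N a ^ Suc (k div 2)) \<in> I" if "h k \<in> I" "odd k" for k
      using closed(5)[OF that(1) qpoly_cnj[OF fR]] that(2)
      by (simp add: h_def mult.assoc power_commutes flip: N_def)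
    have descent: "f \<in> I" if "(\<lambda>a. N a ^ k) \<in> I" for k
      using that
    proof (induction k rule: less_induct)
      case (less k)
      have hI: "h k \<in> I"
        using single[OF hR] less.prems by (simp add: h_square)
      consider "k = 0" | "k = 1" | "1 < k" "even k" | "1 < k" "odd k" by linarith
      then show ?case
      proof cases
        \<comment> \<open>Here the constant function 1 lies in \<open>I\<close>, so \<open>I\<close>
          is the whole ring.\<close>
        case 1
        then show ?thesis using closed(4)[OF less.prems fR] by simp
      next
        case 2
        then show ?thesis using hI by (simp add: h_def)
      next
        case 3
        then show ?thesis using hI less.IH[of "k div 2"] by (simp add: h_def)
      next
        case 4
        then have "Suc (k div 2) < k" by presburger
        then show ?thesis using less.IH up[OF hI 4(2)] by blast
      qed
    qed
    \<comment> \<open>The factor of \<open>N ^ m\<close> is put in front of the \<open>g j\<close>,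
      so that the element of \<open>I\<close> becomes a single sum of \<open>Suc l\<close>
      terms.\<close>
    define F where "F i = (case i of 0 \<Rightarrow> h m | Suc j \<Rightarrow> g j)" for i
    have "F 0 \<in> I"
    proof (rule sums)
      show "\<forall>i<Suc l. F i \<in> qpoly_funs" using hR gR by (auto simp: F_def split: nat.splits)
      have "(\<lambda>a. \<Sum>i<Suc l. F i a * qcnj (F i a)) = (\<lambda>a. N a ^ m + (\<Sum>i<l. g i a * qcnj (g i a)))"
        unfolding sum.lessThan_Suc_shift by (simp add: F_def h_square)
      then show "(\<lambda>a. \<Sum>i<Suc l. F i a * qcnj (F i a)) \<in> I" using rad by (simp add: N_def)
    qed simp
    then have "(\<lambda>a. h m a * qcnj (h m a)) \<in> I"
      using closed(5)[OF _ qpoly_cnj[OF hR[of m]], of "h m"] by (simp add: F_def)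
    then show "f \<in> I" using descent by (simp add: h_square)
  qed
qed

theorem theorem1:
  shows "(\<forall>I :: (quat ^ 'n \<Rightarrow> quat) set. ideal I qpoly_ring \<longrightarrow>
            vanishing_ideal (zero_set I) = quat_radical I) \<and>
         {I. \<exists>Z :: (quat ^ 'n) set. I = vanishing_ideal Z} =
           {I. ideal I qpoly_ring \<and>
               (\<forall>l\<ge>1. \<forall>f :: nat \<Rightarrow> quat ^ 'n \<Rightarrow> quat.
                  (\<forall>i<l. f i \<in> carrier qpoly_ring) \<longrightarrow>
                  (\<lambda>a. \<Sum>i<l. f i a * qcnj (f i a)) \<in> I \<longrightarrow>
                  (\<forall>i<l. f i \<in> I))}"
proof (intro conjI allI impI)
  fix I :: "(quat ^ 'n \<Rightarrow> quat) set"
  assume "ideal I qpoly_ring"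
  then show "vanishing_ideal (zero_set I) = quat_radical I"
    using vanishing_ideal_subset_radical radical_subset_vanishing_ideal by blast
next
  show "{I. \<exists>Z :: (quat ^ 'n) set. I = vanishing_ideal Z} =
           {I. ideal I qpoly_ring \<and>
               (\<forall>l\<ge>1. \<forall>f :: nat \<Rightarrow> quat ^ 'n \<Rightarrow> quat.
                  (\<forall>i<l. f i \<in> carrier qpoly_ring) \<longrightarrow>
                  (\<lambda>a. \<Sum>i<l. f i a * qcnj (f i a)) \<in> I \<longrightarrow>
                  (\<forall>i<l. f i \<in> I))}" (is "?A = ?B")
  proof (intro equalityI subsetI)
    fix I assume "I \<in> ?A"
    then obtain Z :: "(quat ^ 'n) set" where "I = vanishing_ideal Z" by blast
    then show "I \<in> ?B"
      using ideal_vanishing_ideal vanishing_ideal_sum_squares[of _ _ Z] by simp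
  next
    fix I assume I: "I \<in> ?B"
    have "f i \<in> I" if "\<forall>i<l. f i \<in> qpoly_funs" "(\<lambda>a. \<Sum>i<l. f i a * qcnj (f i a)) \<in> I" "i < l"
      for l :: nat and f :: "nat \<Rightarrow> quat ^ 'n \<Rightarrow> quat" and i
    proof -
      have "1 \<le> l" using \<open>i < l\<close> by simp
      with I that show ?thesis by (simp only: mem_Collect_eq qpoly_ring_sel)
    qed
    then have "I = vanishing_ideal (zero_set I)"
      using real_ideal_eq_vanishing_ideal I by blast
    then show "I \<in> ?A" by blast
  qed
qed

end
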